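(* Suppose that (H3.0) $\{\tau\phi-\Theta\zeta:\phi\in\bar{\mathcal H}_2,\ \zeta\in\mathfrak h\}=\mathfrak h$, and (H3.1) $\mathrm{Ran}(\tau^* )\cap\mathcal H_{-1}=\{0\}$. Let $\lambda\in\mathbb R$, $\lambda\neq0$, and let $$D(\tilde W_\Theta):=\{(\phi_0,\psi,\zeta_\phi)\in\bar{\mathcal H}_1\oplus\mathcal H_0\oplus\mathfrak h_\Theta:\ \phi_0\in\bar{\mathcal H}_2,\ \psi=\psi_\lambda+G(\lambda)\zeta_\psi,\ \psi_\lambda\in\mathcal H_1,\ \zeta_\psi\in\mathfrak h,\ \Theta\zeta_\phi=\tau\phi_0\}.$$ Then $$\tilde W_\Theta:D(\tilde W_\Theta)\subseteq\bar{\mathcal H}_1\oplus\mathcal H_0\oplus\mathfrak h_\Theta\to\bar{\mathcal H}_1\oplus\mathcal H_0\oplus\mathfrak h_\Theta,\qquad \tilde W_\Theta(\phi_0,\psi,\zeta_\phi):=(\psi_0,\bar A\phi_0,\zeta_\psi),$$ is a skew-adjoint extension of the restriction of $\tilde W$ to the dense set $$\mathcal N_\Theta:=\{(\phi,\psi,\zeta)\in\bar{\mathcal H}_2\oplus\mathcal H_1\oplus\mathfrak h_\Theta:\ \tau\phi=\Theta\zeta\}.$$ Here $\psi_0\in\bar{\mathcal H}_1$, defined by $\psi_0:=\psi_\lambda-\lambda^2\bar B^{-1}B^{-1}G(\lambda)\zeta_\psi$, does not depend on $\lambda$. The resolvent of $\tilde W_\Theta$ is given by $$(-\tilde W_\Theta+\lambda)^{-1}=(-\tilde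 W+\lambda)^{-1}+G_\Theta(\lambda)\Gamma_\Theta(\lambda)^{-1}\breve G_\Theta(\lambda),$$ where $(-\tilde W+\lambda)^{-1}$, $\breve G_\Theta(\lambda)$, $G_\Theta(\lambda)$, $\Gamma_\Theta(\lambda)^{-1}$ are bounded linear operators.
   Context: $\mathsf B(X,Y)$ denotes the bounded everywhere defined linear operators from $X$ to $Y$, and $\mathsf B(X):=\mathsf B(X,X)$. $\mathcal H_0$ is a Hilbert space with scalar product $\langle\cdot,\cdot\rangle_0$ and norm $\|\cdot\|_0$; $B:D(B)\subseteq\mathcal H_0\to\mathcal H_0$ is self-adjoint with $\mathrm{Ker}(B)=\{0\}$. For $k\ge1$, $\mathcal H_k:=D(B^k)$ with scalar product $\langle\phi_1,\phi_2\rangle_k:=\langle B^k\phi_1,B^k\phi_2\rangle_0+\langle\phi_1,\phi_2\rangle_0$. $\mathcal H_{-k}$ is the completion of $\mathcal H_0$ for $\langle(B^{2k}+1)^{-1/2}\phi_1,(B^{2k}+1)^{-1/2}\phi_2\rangle_0$, so $\mathcal H_{-1}\subseteq\mathcal H_{-2}$. $\bar{\mathcal H}_1$ is the completion of $D(B)$ for $[\phi_1,\phi_2]_1:=\langle B\phi_1,B\phi_2\rangle_0$ (so $\mathcal H_1\subseteq\bar{\mathcal H}_1$ densely). $\bar B\in\mathsf B(\bar{\mathcal H}_1,\mathcal H_0)$ is the bounded extension of $B:\mathcal H_1\subseteq\bar{\mathcal H}_1\to\mathcal H_0$; it is boundedly invertible and $\bar B^{-1}$ is the bounded extension of $B^{-1}:\mathrm{Ran}(B)\subseteq\mathcal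 H_0\to\bar{\mathcal H}_1$. For $k\ge1$, $\bar{\mathcal H}_k:=\{\phi\in\bar{\mathcal H}_1:\bar B\phi\in\mathcal H_{k-1}\}$ with scalar product $[\phi_1,\phi_2]_k:=\langle\bar B\phi_1,\bar B\phi_2\rangle_{k-1}$. $\bar A:=-B\bar B:\bar{\mathcal H}_2\to\mathcal H_0$. For real $\lambda\ne0$, $R_0(\lambda):=(B^2+\lambda^2)^{-1}\in\mathsf B(\mathcal H_0,\mathcal H_2)$, and $\bar R_0(\lambda)\in\mathsf B(\bar{\mathcal H}_1,\bar{\mathcal H}_3)$ is the bounded extension of $R_0(\lambda):\mathcal H_1\subseteq\bar{\mathcal H}_1\to\bar{\mathcal H}_3$. $\mathfrak h$ is a Hilbert space, $\Theta$ a bounded, positive, injective self-adjoint operator on $\mathfrak h$; $\mathfrak h_\Theta$ denotes the Hilbert space given by $\mathfrak h$ endowed with the scalar product $\langle\zeta_1,\zeta_2\rangle_\Theta:=\langle\Theta\zeta_1,\zeta_2\rangle_{\mathfrak h}$. The scalar product on $\bar{\mathcal H}_1\oplus\mathcal H_0\oplus\mathfrak h_\Theta$ is $\langle\bar B\phi_1,\bar B\phi_2\rangle_0+\langle\psi_1,\psi_2\rangle_0+\langle\zeta_1,\zeta_2\rangle_\Theta$. $W(\phi,\psi):=(\psi,\bar A\phi)$ on $D(W)=\bar{\mathcal H}_2\oplus\mathcal H_1\subseteq\bar{\mathcal H}_1\oplus\mathcal H_0$ and $\tilde W(\phi,\psi,\zeta):=(W(\phi,\psi),0)$ on $D(\tilde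 W)=\bar{\mathcal H}_2\oplus\mathcal H_1\oplus\mathfrak h_\Theta$; both are skew-adjoint and $(-\tilde W+\lambda)^{-1}(\phi,\psi,\zeta)=((-W+\lambda)^{-1}(\phi,\psi),\lambda^{-1}\zeta)$. $\tau\in\mathsf B(\bar{\mathcal H}_2,\mathfrak h)$; $\tau^*\in\mathsf B(\mathfrak h,\mathcal H_{-2})$ is defined by $\langle(B^4+1)^{-1/2}\tau^*\zeta,(B^4+1)^{1/2}\phi\rangle_0=\langle\zeta,\tau\phi\rangle_{\mathfrak h}$ for $\zeta\in\mathfrak h$, $\phi\in\mathcal H_2$ (with $(B^4+1)^{-1/2}$ extended to $\mathcal H_{-2}$). For real $\lambda\ne0$: $\breve G(\lambda):=\tau R_0(\lambda)\in\mathsf B(\mathcal H_0,\mathfrak h)$, $G(\lambda):=\breve G(\lambda)^*\in\mathsf B(\mathfrak h,\mathcal H_0)$, $\breve{\bar G}(\lambda):=\tau\bar R_0(\lambda)\in\mathsf B(\bar{\mathcal H}_1,\mathfrak h)$, $\bar G(\lambda):=\breve{\bar G}(\lambda)^*\in\mathsf B(\mathfrak h,\bar{\mathcal H}_1)$. One has $\mathrm{Ran}(G(\lambda))\subseteq\mathrm{Ran}(B)$ and $\bar G(\lambda)=\bar B^{-1}B^{-1}G(\lambda)\in\mathsf B(\mathfrak h,\bar{\mathcal H}_2)$. Finally $\breve G_\Theta(\lambda)(\phi,\psi,\zeta):=\lambda\breve{\bar G}(\lambda)\phi+\breve G(\lambda)\psi-\lambda^{-1}\Theta\zeta$, $G_\Theta(\lambda)\zeta:=(\lambda\bar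 G(\lambda)\zeta,-G(\lambda)\zeta,-\lambda^{-1}\zeta)$, $\Gamma_\Theta(\lambda):=-\lambda\tau\bar G(\lambda)-\lambda^{-1}\Theta\in\mathsf B(\mathfrak h)$.
   Formalization: The formal theorem additionally assumes that τ* is injective (equivalently, Ran(τ) is dense in 𝔥); without this the claim fails (τ=0, Θ=1, 𝔥≠0), and it is necessary for the density of N_Θ. *)

theory Defs
  imports "HOL-Analysis.Analysis"
begin

section \<open>Scalars\<close>

text \<open>
  Hilbert spaces are treated simultaneously over the real and over the complex numbers.  In a
  normed field over the reals with multiplicative norm the law x * kconj x = |x|^2 forces
  kconj x = |x|^2 / x, so the instances are the real numbers (with the identity) and the
  complex numbers (with complex conjugation).
\<close>

class rc_scalar = real_normed_field +
  fixes kconj :: "'a \<Rightarrow> 'a"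
  assumes kconj_add: "kconj (x + y) = kconj x + kconj y"
    and mult_kconj: "x * kconj x = (norm x * norm x) *\<^sub>R 1"

instantiation real :: rc_scalar
begin
definition kconj_real :: "real \<Rightarrow> real" where "kconj_real x = x"
instance by standard (simp_all add: kconj_real_def)
end

instantiation complex :: rc_scalar
begin
definition kconj_complex :: "complex \<Rightarrow> complex" where "kconj_complex = cnj"
instance
proof
  fix x y :: complex
  show "kconj (x + y) = kconj x + kconj y" by (simp add: kconj_complex_def)
  show "x * kconj x = (norm x * norm x) *\<^sub>R 1"
    using complex_norm_square[of x]
    by (simp add: kconj_complex_def scaleR_conv_of_real power2_eq_square)
qed
end

section \<open>Inner product spaces and Hilbert spaces with explicit carrier\<close>

record ('k, 'v) ip_space =
  carr :: "'v set"
  smul :: "'k \<Rightarrow> 'v \<Rightarrow> 'v"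
  ip :: "'v \<Rightarrow> 'v \<Rightarrow> 'k"

definition inner_product_space :: "('k::rc_scalar, 'v::ab_group_add) ip_space \<Rightarrow> bool" where
  "inner_product_space X \<longleftrightarrow>
     vector_space (smul X) \<and> module.subspace (smul X) (carr X) \<and>
     (\<forall>x\<in>carr X. \<forall>y\<in>carr X. \<forall>z\<in>carr X. ip X x (y + z) = ip X x y + ip X x z) \<and>
     (\<forall>x\<in>carr X. \<forall>y\<in>carr X. \<forall>c. ip X x (smul X c y) = c * ip X x y) \<and>
     (\<forall>x\<in>carr X. \<forall>y\<in>carr X. ip X y x = kconj (ip X x y)) \<and>
     (\<forall>x\<in>carr X. \<exists>r\<ge>0. ip X x x = of_real r) \<and>
     (\<forall>x\<in>carr X. ip X x x = 0 \<longrightarrow> x = 0)"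

text \<open>The scalar ip X x x is a nonnegative real, so its norm is its value.\<close>

definition hnorm :: "('k::rc_scalar, 'v::ab_group_add) ip_space \<Rightarrow> 'v \<Rightarrow> real" where
  "hnorm X x = sqrt (norm (ip X x x))"

text \<open>
  The locale Metric_space requires symmetry of the distance on the whole type, whereas nothing
  is known about ip X outside the carrier; hence the guard.
\<close>

definition hdist :: "('k::rc_scalar, 'v::ab_group_add) ip_space \<Rightarrow> 'v \<Rightarrow> 'v \<Rightarrow> real" where
  "hdist X x y = (if x \<in> carr X \<and> y \<in> carr X then hnorm X (x - y) else 0)"

definition hilbert :: "('k::rc_scalar, 'v::ab_group_add) ip_space \<Rightarrow> bool" where
  "hilbert X \<longleftrightarrow> inner_product_space X \<and> Metric_space.mcomplete (carr X) (hdist X)"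

definition dense_in :: "('k::rc_scalar, 'v::ab_group_add) ip_space \<Rightarrow> 'v set \<Rightarrow> bool" where
  "dense_in X D \<longleftrightarrow> D \<subseteq> carr X \<and>
     Metric_space.mtopology (carr X) (hdist X) closure_of D = carr X"

definition dsum :: "('k::rc_scalar, 'v::ab_group_add) ip_space \<Rightarrow> ('k, 'w::ab_group_add) ip_space
    \<Rightarrow> ('k, 'v \<times> 'w) ip_space" (infixr \<open>\<oplus>\<^sub>H\<close> 65) where
  "X \<oplus>\<^sub>H Y = \<lparr>carr = carr X \<times> carr Y,
     smul = (\<lambda>c. map_prod (smul X c) (smul Y c)),
     ip = (\<lambda>u v. ip X (fst u) (fst v) + ip Y (snd u) (snd v))\<rparr>"

text \<open>
  The bounded linear operators defined on all of X.  An operator is a function of the ambient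
  type; only its values on the carrier are constrained.
\<close>

definition BL :: "('k::rc_scalar, 'v::ab_group_add) ip_space \<Rightarrow> ('k, 'w::ab_group_add) ip_space
    \<Rightarrow> ('v \<Rightarrow> 'w) set" where
  "BL X Y = {F. (\<forall>x\<in>carr X. F x \<in> carr Y) \<and>
     (\<forall>x\<in>carr X. \<forall>y\<in>carr X. F (x + y) = F x + F y) \<and>
     (\<forall>x\<in>carr X. \<forall>c. F (smul X c x) = smul Y c (F x)) \<and>
     (\<exists>C. \<forall>x\<in>carr X. hnorm Y (F x) \<le> C * hnorm X x)}"

text \<open>Unique on the carrier of X (Riesz) when X is a Hilbert space and F is in BL X Y.\<close>

definition bdd_adj :: "('k::rc_scalar, 'v::ab_group_add) ip_space \<Rightarrow> ('k, 'w::ab_group_add) ip_space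
    \<Rightarrow> ('v \<Rightarrow> 'w) \<Rightarrow> 'w \<Rightarrow> 'v" where
  "bdd_adj X Y F = (SOME S. S \<in> BL Y X \<and>
     (\<forall>x\<in>carr X. \<forall>y\<in>carr Y. ip Y (F x) y = ip X x (S y)))"

text \<open>
  The bounded extension to X of the map f on D, where D is regarded as a subset of X by means of
  the embedding e; it is unique on the carrier of X when e ` D is dense in X.
\<close>

definition bdd_ext :: "('k::rc_scalar, 'v::ab_group_add) ip_space \<Rightarrow> ('k, 'w::ab_group_add) ip_space
    \<Rightarrow> ('u \<Rightarrow> 'v) \<Rightarrow> 'u set \<Rightarrow> ('u \<Rightarrow> 'w) \<Rightarrow> 'v \<Rightarrow> 'w" where
  "bdd_ext X Y e D f = (SOME F. F \<in> BL X Y \<and> (\<forall>x\<in>D. F (e x) = f x))"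

text \<open>
  The Hilbert space Y, with the embedding e, is a completion of the inner product space X.
  Completions are unique up to a unique isometric isomorphism.
\<close>

definition is_completion :: "('k::rc_scalar, 'v::ab_group_add) ip_space
    \<Rightarrow> ('k, 'w::ab_group_add) ip_space \<Rightarrow> ('v \<Rightarrow> 'w) \<Rightarrow> bool" where
  "is_completion X Y e \<longleftrightarrow> inner_product_space X \<and> hilbert Y \<and> e \<in> BL X Y \<and>
     (\<forall>x\<in>carr X. \<forall>y\<in>carr X. ip Y (e x) (e y) = ip X x y) \<and>
     dense_in Y (e ` carr X)"

section \<open>Unbounded operators as graphs\<close>

definition lin_op :: "('k::rc_scalar, 'v::ab_group_add) ip_space \<Rightarrow> ('k, 'w::ab_group_add) ip_space
    \<Rightarrow> ('v \<times> 'w) set \<Rightarrow> bool" where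
  "lin_op X Y T \<longleftrightarrow> T \<subseteq> carr X \<times> carr Y \<and> single_valued T \<and>
     module.subspace (smul (X \<oplus>\<^sub>H Y)) T"

definition ap :: "('v \<times> 'w) set \<Rightarrow> 'v \<Rightarrow> 'w" where
  "ap T x = (THE y. (x, y) \<in> T)"

definition graph_adj :: "('k::rc_scalar, 'v::ab_group_add) ip_space
    \<Rightarrow> ('v \<times> 'v) set \<Rightarrow> ('v \<times> 'v) set" where
  "graph_adj X T = {(y, z). y \<in> carr X \<and> z \<in> carr X \<and> (\<forall>(x, w)\<in>T. ip X w y = ip X x z)}"

definition selfadjoint :: "('k::rc_scalar, 'v::ab_group_add) ip_space \<Rightarrow> ('v \<times> 'v) set \<Rightarrow> bool" where
  "selfadjoint X T \<longleftrightarrow> lin_op X X T \<and> dense_in X (Domain T) \<and> graph_adj X T = T"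

definition skewadjoint :: "('k::rc_scalar, 'v::ab_group_add) ip_space \<Rightarrow> ('v \<times> 'v) set \<Rightarrow> bool" where
  "skewadjoint X T \<longleftrightarrow> lin_op X X T \<and> dense_in X (Domain T) \<and>
     graph_adj X T = (\<lambda>(x, y). (x, - y)) ` T"

definition graph_on :: "('k, 'v) ip_space \<Rightarrow> ('v \<Rightarrow> 'w) \<Rightarrow> ('v \<times> 'w) set" where
  "graph_on X F = {(x, F x) | x. x \<in> carr X}"

text \<open>The graph of the inverse of - T + l.\<close>

definition resolvent :: "('k::rc_scalar, 'v::ab_group_add) ip_space \<Rightarrow> ('v \<times> 'v) set \<Rightarrow> real
    \<Rightarrow> ('v \<times> 'v) set" where
  "resolvent X T l = {(- y + smul X (of_real l) x, x) | x y. (x, y) \<in> T}"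

section \<open>Bounded positive operators\<close>

definition positive_sa :: "('k::rc_scalar, 'v::ab_group_add) ip_space \<Rightarrow> ('v \<Rightarrow> 'v) \<Rightarrow> bool" where
  "positive_sa X P \<longleftrightarrow> P \<in> BL X X \<and>
     (\<forall>x\<in>carr X. \<forall>y\<in>carr X. ip X (P x) y = ip X x (P y)) \<and>
     (\<forall>x\<in>carr X. \<exists>r\<ge>0. ip X (P x) x = of_real r)"

text \<open>S is the (unique) positive square root of P.\<close>

definition is_pos_sqrt :: "('k::rc_scalar, 'v::ab_group_add) ip_space
    \<Rightarrow> ('v \<Rightarrow> 'v) \<Rightarrow> ('v \<Rightarrow> 'v) \<Rightarrow> bool" where
  "is_pos_sqrt X S P \<longleftrightarrow> positive_sa X S \<and> (\<forall>x\<in>carr X. S (S x) = P x)"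

section \<open>The data\<close>

text \<open>
  H0 is the base space, opB the graph of B, H1bar the completion of D(B) for the scalar product
  of B phi_1 and B phi_2, emb the embedding of D(B) into this completion, and auxsp, Theta, trac
  are the auxiliary space, the parameter and the map tau.
\<close>

record ('k, 'a, 'b, 'h) wave_data =
  H0 :: "('k, 'a) ip_space"
  opB :: "('a \<times> 'a) set"
  H1bar :: "('k, 'b) ip_space"
  emb :: "'a \<Rightarrow> 'b"
  auxsp :: "('k, 'h) ip_space"
  Theta :: "'h \<Rightarrow> 'h"
  trac :: "'b \<Rightarrow> 'h"

subsection \<open>The scale of spaces\<close>

definition Hk :: "('k::rc_scalar, 'a::ab_group_add, 'b, 'h) wave_data \<Rightarrow> nat \<Rightarrow> ('k, 'a) ip_space" where
  "Hk M k = (if k = 0 then H0 M else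
     (H0 M) \<lparr>carr := Domain (opB M ^^ k),
       ip := (\<lambda>x y. ip (H0 M) (ap (opB M ^^ k) x) (ap (opB M ^^ k) y) + ip (H0 M) x y)\<rparr>)"

text \<open>D(B) with the scalar product that is completed to H1bar.\<close>

definition H1dot :: "('k::rc_scalar, 'a::ab_group_add, 'b, 'h) wave_data \<Rightarrow> ('k, 'a) ip_space" where
  "H1dot M = (H0 M) \<lparr>carr := Domain (opB M),
     ip := (\<lambda>x y. ip (H0 M) (ap (opB M) x) (ap (opB M) y))\<rparr>"

definition Bbar :: "('k::rc_scalar, 'a::ab_group_add, 'b::ab_group_add, 'h) wave_data \<Rightarrow> 'b \<Rightarrow> 'a" where
  "Bbar M = bdd_ext (H1bar M) (H0 M) (emb M) (Domain (opB M)) (ap (opB M))"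

definition Bbar_inv :: "('k::rc_scalar, 'a::ab_group_add, 'b::ab_group_add, 'h) wave_data \<Rightarrow> 'a \<Rightarrow> 'b" where
  "Bbar_inv M = inv_into (carr (H1bar M)) (Bbar M)"

text \<open>Meant for k \<ge> 1.\<close>

definition Hbar :: "('k::rc_scalar, 'a::ab_group_add, 'b::ab_group_add, 'h) wave_data \<Rightarrow> nat
    \<Rightarrow> ('k, 'b) ip_space" where
  "Hbar M k = (H1bar M)
     \<lparr>carr := {x \<in> carr (H1bar M). Bbar M x \<in> carr (Hk M (k - 1))},
      ip := (\<lambda>x y. ip (Hk M (k - 1)) (Bbar M x) (Bbar M y))\<rparr>"

definition Abar :: "('k::rc_scalar, 'a::ab_group_add, 'b::ab_group_add, 'h) wave_data \<Rightarrow> 'b \<Rightarrow> 'a" where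
  "Abar M x = - ap (opB M) (Bbar M x)"

text \<open>The operator inverse to B^m + c on the base space.\<close>

definition pow_res :: "('k::rc_scalar, 'a::ab_group_add, 'b, 'h) wave_data \<Rightarrow> nat \<Rightarrow> real \<Rightarrow> 'a \<Rightarrow> 'a" where
  "pow_res M m c x = (THE y. (y, x - smul (H0 M) (of_real c) y) \<in> opB M ^^ m)"

text \<open>H0 with the norm of S x, where S is the inverse square root of B^(2k) + 1.\<close>

definition Hneg_pre :: "('k::rc_scalar, 'a::ab_group_add, 'b, 'h) wave_data \<Rightarrow> ('a \<Rightarrow> 'a)
    \<Rightarrow> ('k, 'a) ip_space" where
  "Hneg_pre M S = (H0 M) \<lparr>ip := (\<lambda>x y. ip (H0 M) (S x) (S y))\<rparr>"

definition is_Hneg :: "('k::rc_scalar, 'a::ab_group_add, 'b, 'h) wave_data \<Rightarrow> nat \<Rightarrow> ('a \<Rightarrow> 'a)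
    \<Rightarrow> ('k, 'm::ab_group_add) ip_space \<Rightarrow> ('a \<Rightarrow> 'm) \<Rightarrow> bool" where
  "is_Hneg M k S X j \<longleftrightarrow>
     is_pos_sqrt (H0 M) S (pow_res M (2 * k) 1) \<and> is_completion (Hneg_pre M S) X j"

text \<open>The space X1 = H(-1) as a subset of X2 = H(-2): the image of the extended identity of H0.\<close>

definition Hneg1_in_Hneg2 :: "('k::rc_scalar, 'a::ab_group_add, 'b, 'h) wave_data
    \<Rightarrow> ('k, 'm1::ab_group_add) ip_space \<Rightarrow> ('a \<Rightarrow> 'm1)
    \<Rightarrow> ('k, 'm2::ab_group_add) ip_space \<Rightarrow> ('a \<Rightarrow> 'm2) \<Rightarrow> 'm2 set" where
  "Hneg1_in_Hneg2 M X1 j1 X2 j2 = bdd_ext X1 X2 j1 (carr (H0 M)) j2 ` carr X1"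

text \<open>The adjoint of tau; here S is the inverse square root of B^4 + 1 and X, j is H(-2).\<close>

definition tau_star :: "('k::rc_scalar, 'a::ab_group_add, 'b::ab_group_add, 'h::ab_group_add) wave_data
    \<Rightarrow> ('a \<Rightarrow> 'a) \<Rightarrow> ('k, 'm::ab_group_add) ip_space \<Rightarrow> ('a \<Rightarrow> 'm) \<Rightarrow> 'h \<Rightarrow> 'm" where
  "tau_star M S X j = (SOME T. T \<in> BL (auxsp M) X \<and>
     (\<forall>\<zeta>\<in>carr (auxsp M). \<forall>\<phi>\<in>carr (Hk M 2).
        ip (H0 M) (bdd_ext X (H0 M) j (carr (H0 M)) S (T \<zeta>)) (inv_into (carr (H0 M)) S \<phi>)
        = ip (auxsp M) \<zeta> (trac M (emb M \<phi>))))"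

subsection \<open>The operator W and its perturbation\<close>

definition hTheta :: "('k::rc_scalar, 'a, 'b, 'h::ab_group_add) wave_data \<Rightarrow> ('k, 'h) ip_space" where
  "hTheta M = (auxsp M) \<lparr>ip := (\<lambda>x y. ip (auxsp M) (Theta M x) y)\<rparr>"

definition Htot :: "('k::rc_scalar, 'a::ab_group_add, 'b::ab_group_add, 'h::ab_group_add) wave_data
    \<Rightarrow> ('k, 'b \<times> 'a \<times> 'h) ip_space" where
  "Htot M = Hbar M 1 \<oplus>\<^sub>H H0 M \<oplus>\<^sub>H hTheta M"

text \<open>Elements of H(1) enter the first component through the embedding.\<close>

definition Wtilde :: "('k::rc_scalar, 'a::ab_group_add, 'b::ab_group_add, 'h::ab_group_add) wave_data
    \<Rightarrow> (('b \<times> 'a \<times> 'h) \<times> ('b \<times> 'a \<times> 'h)) set" where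
  "Wtilde M = {((\<phi>, \<psi>, \<zeta>), (emb M \<psi>, Abar M \<phi>, 0)) | \<phi> \<psi> \<zeta>.
     \<phi> \<in> carr (Hbar M 2) \<and> \<psi> \<in> carr (Hk M 1) \<and> \<zeta> \<in> carr (hTheta M)}"

definition R0 :: "('k::rc_scalar, 'a::ab_group_add, 'b, 'h) wave_data \<Rightarrow> real \<Rightarrow> 'a \<Rightarrow> 'a" where
  "R0 M l = pow_res M 2 (l\<^sup>2)"

definition R0bar :: "('k::rc_scalar, 'a::ab_group_add, 'b::ab_group_add, 'h) wave_data \<Rightarrow> real
    \<Rightarrow> 'b \<Rightarrow> 'b" where
  "R0bar M l = bdd_ext (H1bar M) (Hbar M 3) (emb M) (carr (Hk M 1)) (\<lambda>x. emb M (R0 M l x))"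

definition Gbreve :: "('k::rc_scalar, 'a::ab_group_add, 'b, 'h) wave_data \<Rightarrow> real \<Rightarrow> 'a \<Rightarrow> 'h" where
  "Gbreve M l x = trac M (emb M (R0 M l x))"

definition G :: "('k::rc_scalar, 'a::ab_group_add, 'b, 'h::ab_group_add) wave_data \<Rightarrow> real
    \<Rightarrow> 'h \<Rightarrow> 'a" where
  "G M l = bdd_adj (H0 M) (auxsp M) (Gbreve M l)"

definition Gbarbreve :: "('k::rc_scalar, 'a::ab_group_add, 'b::ab_group_add, 'h) wave_data \<Rightarrow> real
    \<Rightarrow> 'b \<Rightarrow> 'h" where
  "Gbarbreve M l x = trac M (R0bar M l x)"

definition Gbar :: "('k::rc_scalar, 'a::ab_group_add, 'b::ab_group_add, 'h::ab_group_add) wave_data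
    \<Rightarrow> real \<Rightarrow> 'h \<Rightarrow> 'b" where
  "Gbar M l = bdd_adj (Hbar M 1) (auxsp M) (Gbarbreve M l)"

definition GTheta_breve ::
    "('k::rc_scalar, 'a::ab_group_add, 'b::ab_group_add, 'h::ab_group_add) wave_data
    \<Rightarrow> real \<Rightarrow> 'b \<times> 'a \<times> 'h \<Rightarrow> 'h" where
  "GTheta_breve M l = (\<lambda>(\<phi>, \<psi>, \<zeta>).
     smul (auxsp M) (of_real l) (Gbarbreve M l \<phi>) + Gbreve M l \<psi>
     - smul (auxsp M) (of_real (inverse l)) (Theta M \<zeta>))"

definition GTheta ::
    "('k::rc_scalar, 'a::ab_group_add, 'b::ab_group_add, 'h::ab_group_add) wave_data
    \<Rightarrow> real \<Rightarrow> 'h \<Rightarrow> 'b \<times> 'a \<times> 'h" where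
  "GTheta M l \<zeta> = (smul (H1bar M) (of_real l) (Gbar M l \<zeta>), - G M l \<zeta>,
     - smul (auxsp M) (of_real (inverse l)) \<zeta>)"

definition GammaTheta ::
    "('k::rc_scalar, 'a::ab_group_add, 'b::ab_group_add, 'h::ab_group_add) wave_data
    \<Rightarrow> real \<Rightarrow> 'h \<Rightarrow> 'h" where
  "GammaTheta M l \<zeta> = - smul (auxsp M) (of_real l) (trac M (Gbar M l \<zeta>))
     - smul (auxsp M) (of_real (inverse l)) (Theta M \<zeta>)"

definition NTheta :: "('k::rc_scalar, 'a::ab_group_add, 'b::ab_group_add, 'h::ab_group_add) wave_data
    \<Rightarrow> ('b \<times> 'a \<times> 'h) set" where
  "NTheta M = {(\<phi>, \<psi>, \<zeta>). \<phi> \<in> carr (Hbar M 2) \<and> \<psi> \<in> carr (Hk M 1) \<and>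
     \<zeta> \<in> carr (hTheta M) \<and> trac M \<phi> = Theta M \<zeta>}"

definition psi0 :: "('k::rc_scalar, 'a::ab_group_add, 'b::ab_group_add, 'h::ab_group_add) wave_data
    \<Rightarrow> real \<Rightarrow> 'a \<Rightarrow> 'h \<Rightarrow> 'b" where
  "psi0 M l \<psi>l \<zeta>\<psi> = emb M \<psi>l
     - smul (H1bar M) (of_real (l\<^sup>2)) (Bbar_inv M (ap (converse (opB M)) (G M l \<zeta>\<psi>)))"

definition DWTheta :: "('k::rc_scalar, 'a::ab_group_add, 'b::ab_group_add, 'h::ab_group_add) wave_data
    \<Rightarrow> real \<Rightarrow> ('b \<times> 'a \<times> 'h) set" where
  "DWTheta M l = {(\<phi>0, \<psi>, \<zeta>\<phi>) \<in> carr (Htot M). \<phi>0 \<in> carr (Hbar M 2) \<and>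
     (\<exists>\<psi>l\<in>carr (Hk M 1). \<exists>\<zeta>\<psi>\<in>carr (auxsp M). \<psi> = \<psi>l + G M l \<zeta>\<psi>) \<and>
     Theta M \<zeta>\<phi> = trac M \<phi>0}"

text \<open>
  A priori a relation: that the decomposition of psi, hence the value, is unique is part of
  the assertion that this is the graph of a linear operator.
\<close>

definition WTheta :: "('k::rc_scalar, 'a::ab_group_add, 'b::ab_group_add, 'h::ab_group_add) wave_data
    \<Rightarrow> real \<Rightarrow> (('b \<times> 'a \<times> 'h) \<times> ('b \<times> 'a \<times> 'h)) set" where
  "WTheta M l = {((\<phi>0, \<psi>, \<zeta>\<phi>), (psi0 M l \<psi>l \<zeta>\<psi>, Abar M \<phi>0, \<zeta>\<psi>)) | \<phi>0 \<psi> \<zeta>\<phi> \<psi>l \<zeta>\<psi>.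
     (\<phi>0, \<psi>, \<zeta>\<phi>) \<in> DWTheta M l \<and>
     \<psi>l \<in> carr (Hk M 1) \<and> \<zeta>\<psi> \<in> carr (auxsp M) \<and> \<psi> = \<psi>l + G M l \<zeta>\<psi>}"

end

theory Submission
  imports Defs
begin

text \<open>
  The isometry Bbar identifies the completed space H1bar with H0. Under it the trace map becomes
  a map t on D(B), bounded for the graph norm, with trac phi = t (Bbar phi). For l \<noteq> 0 let g l be
  the adjoint of t when D(B) carries the scalar product <Bu, Bv> + l^2 <u, v>. Two short
  computations give Gbar(l) = Bbar^(-1) g l and G(l) = B (g l), and hence
  - l Gamma_Theta(l) = l^2 t (g l) + Theta.

  The operator has a weak description in which l does not occur. For psi = psi_l + G(l) eta put
  omega = Bbar psi_0 = B psi_l - l^2 g l eta. The definition of g l and the self-adjointness of B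
  show that psi, omega, eta arise in this way if and only if
    <Bu, psi> = <u, omega> + <t u, eta>  for all u in D(B)
  (weak_of_decomposition and weak_decomposition). Independence of l, linearity and skew-symmetry
  of the operator can be read off from this identity.

  Condition (H3.1) enters in one form only (G_range_trivial): if G(1) xi lies in D(B), then xi = 0.
  Indeed, in that case the functional phi |-> <xi, trac phi> is bounded for the norm of H_1, so
  that the adjoint of the trace maps xi into H_(-1). An equivalent formulation is that a
  functional <t u, xi> of u which is bounded in the norm of H0 has xi = 0 (trace_unbounded). This
  makes eta and omega functions of psi.

  To solve (- W + l) x = (a, beta, c) one eliminates everything but the last component. What
  remains is an equation for the operator A l = l^2 t (g l) + Theta, which is positive. It is also
  coercive (A_coercive): by (H3.0) every y is of the form t u - Theta w, and then the
  Cauchy-Schwarz inequality bounds <z, y> for all z with <A l z, z> \<le> 1; the set of these z is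
  therefore weakly bounded, and by the principle of uniform boundedness it is bounded. As the
  equation is solvable for l and for - l, the skew-symmetric operator is skew-adjoint.

  The space h_Theta may be incomplete, so a trivial orthogonal complement in it is no proof of
  density. The set N_Theta is dense even for the stronger norm of h in the last component, where
  the space is complete; its annihilator there is computed with the inverse of A 1
  (NTheta_annihilator) and vanishes by trace_unbounded.

  The Hilbert space theory used above (Riesz representation, bounded extensions and adjoints,
  uniform boundedness, inverse of B^2 + c, domain of square roots) is developed first, for real
  and complex scalars at once.
\<close>

section \<open>Scalars and semi-inner products\<close>

lemma kconj_0 [simp]: "kconj (0::'k::rc_scalar) = 0"
  using kconj_add[of "0::'k" 0] by simp

lemma kconj_minus [simp]: "kconj (- x) = - kconj (x::'k::rc_scalar)"
  using kconj_add[of x "- x"] by (simp add: eq_neg_iff_add_eq_0 add.commute)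

text \<open>
  This identity determines the conjugation: kconj x = |x|^2 / x. Multiplicativity, the
  values on the reals and kconj (kconj x) = x are consequences.
\<close>

lemma mult_kconj': "x * kconj x = of_real ((norm (x::'k::rc_scalar))\<^sup>2)"
  by (simp only: mult_kconj of_real_def power2_eq_square)

lemma kconj_eq_divide: "kconj x = of_real ((norm x)\<^sup>2) / (x::'k::rc_scalar)"
  using mult_kconj'[of x] by (cases "x = 0") (auto simp: field_simps)

lemma kconj_mult [simp]: "kconj (x * y) = kconj x * kconj (y::'k::rc_scalar)"
  by (simp add: kconj_eq_divide norm_mult power_mult_distrib)

lemma kconj_of_real [simp]: "kconj (of_real r :: 'k::rc_scalar) = of_real r"
  by (cases "r = 0") (auto simp: kconj_eq_divide power2_eq_square)

lemma norm_kconj [simp]: "norm (kconj (x::'k::rc_scalar)) = norm x"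
  by (cases "x = 0") (auto simp: kconj_eq_divide norm_divide norm_mult power2_eq_square)

lemma kconj_kconj [simp]: "kconj (kconj (x::'k::rc_scalar)) = x"
proof (cases "x = 0")
  case False
  have "kconj (kconj x) * kconj x = x * kconj x"
    using mult_kconj'[of "kconj x"] mult_kconj'[of x] by (simp add: mult.commute)
  moreover have "kconj x \<noteq> 0" using False norm_kconj[of x] by fastforce
  ultimately show ?thesis by simp
qed simp

text \<open>
  Definiteness is left out because the form of Theta is an inner product only as a consequence of
  its own Cauchy-Schwarz inequality.
\<close>

definition semi_ip_space :: "('k::rc_scalar, 'v::ab_group_add) ip_space \<Rightarrow> bool" where
  "semi_ip_space X \<longleftrightarrow>
     vector_space (smul X) \<and> module.subspace (smul X) (carr X) \<and>
     (\<forall>x\<in>carr X. \<forall>y\<in>carr X. \<forall>z\<in>carr X. ip X x (y + z) = ip X x y + ip X x z) \<and>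
     (\<forall>x\<in>carr X. \<forall>y\<in>carr X. \<forall>c. ip X x (smul X c y) = c * ip X x y) \<and>
     (\<forall>x\<in>carr X. \<forall>y\<in>carr X. ip X y x = kconj (ip X x y)) \<and>
     (\<forall>x\<in>carr X. \<exists>r\<ge>0. ip X x x = of_real r)"

lemma inner_product_space_iff_semi:
  "inner_product_space X \<longleftrightarrow> semi_ip_space X \<and> (\<forall>x\<in>carr X. ip X x x = 0 \<longrightarrow> x = 0)"
  by (simp only: inner_product_space_def semi_ip_space_def conj_assoc)

lemma hnorm_ge_0 [simp]: "0 \<le> hnorm X x" by (simp add: hnorm_def)

lemma ips_semi: "inner_product_space X \<Longrightarrow> semi_ip_space X"
  by (simp add: inner_product_space_iff_semi)

lemma hilbert_ips: "hilbert X \<Longrightarrow> inner_product_space X"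
  by (simp add: hilbert_def)

lemma hilbert_semi: "hilbert X \<Longrightarrow> semi_ip_space X"
  by (simp add: hilbert_ips ips_semi)

context
  fixes X :: "('k::rc_scalar, 'v::ab_group_add) ip_space"
  assumes X: "semi_ip_space X"
begin

lemma semi_vs: "vector_space (smul X)" using X unfolding semi_ip_space_def by blast

lemma semi_module: "module (smul X)"
  using semi_vs by (simp add: module_iff_vector_space)

lemma semi_subspace: "module.subspace (smul X) (carr X)" using X unfolding semi_ip_space_def by blast

lemma smul_add_right: "smul X c (x + y) = smul X c x + smul X c y"
  using vector_space.vector_space_assms(1)[OF semi_vs] .
lemma smul_add_left: "smul X (c + d) x = smul X c x + smul X d x"
  using vector_space.vector_space_assms(2)[OF semi_vs] .
lemma smul_smul: "smul X c (smul X d x) = smul X (c * d) x"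
  using vector_space.vector_space_assms(3)[OF semi_vs] .
lemma smul_one: "smul X 1 x = x"
  using vector_space.vector_space_assms(4)[OF semi_vs] .
lemma smul_0_left: "smul X 0 x = 0" using module.scale_zero_left[OF semi_module] .
lemma smul_0_right: "smul X c 0 = 0" using module.scale_zero_right[OF semi_module] .
lemma smul_minus_left: "smul X (- c) x = - smul X c x"
  using module.scale_minus_left[OF semi_module] .
lemma smul_minus_right: "smul X c (- x) = - smul X c x"
  using module.scale_minus_right[OF semi_module] .
lemma smul_diff_right: "smul X c (x - y) = smul X c x - smul X c y"
  using module.scale_right_diff_distrib[OF semi_module] .
lemmas smul_simps = smul_add_right smul_smul smul_one smul_0_left smul_0_right
  smul_minus_left smul_minus_right smul_diff_right

lemma carr_0: "0 \<in> carr X" using module.subspace_0[OF semi_module semi_subspace] .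
lemma carr_add: "x \<in> carr X \<Longrightarrow> y \<in> carr X \<Longrightarrow> x + y \<in> carr X"
  using module.subspace_add[OF semi_module semi_subspace] .
lemma carr_diff: "x \<in> carr X \<Longrightarrow> y \<in> carr X \<Longrightarrow> x - y \<in> carr X"
  using module.subspace_diff[OF semi_module semi_subspace] .
lemma carr_neg: "x \<in> carr X \<Longrightarrow> - x \<in> carr X"
  using module.subspace_neg[OF semi_module semi_subspace] .
lemma carr_smul: "x \<in> carr X \<Longrightarrow> smul X c x \<in> carr X"
  using module.subspace_scale[OF semi_module semi_subspace] .

lemmas carr_simps = carr_0 carr_add carr_diff carr_neg carr_smul

lemma ip_conj: "x \<in> carr X \<Longrightarrow> y \<in> carr X \<Longrightarrow> kconj (ip X x y) = ip X y x"
  using X[unfolded semi_ip_space_def, THEN conjunct2, THEN conjunct2, THEN conjunct2, THEN conjunct2,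
      THEN conjunct1] by (metis kconj_kconj)
lemma ip_add_right: "x \<in> carr X \<Longrightarrow> y \<in> carr X \<Longrightarrow> z \<in> carr X \<Longrightarrow> ip X x (y + z) = ip X x y + ip X x z"
  using X[unfolded semi_ip_space_def, THEN conjunct2, THEN conjunct2, THEN conjunct1] by simp
lemma ip_smul_right: "x \<in> carr X \<Longrightarrow> y \<in> carr X \<Longrightarrow> ip X x (smul X c y) = c * ip X x y"
  using X[unfolded semi_ip_space_def, THEN conjunct2, THEN conjunct2, THEN conjunct2, THEN conjunct1]
  by simp
lemma ip_add_left: "x \<in> carr X \<Longrightarrow> y \<in> carr X \<Longrightarrow> z \<in> carr X \<Longrightarrow> ip X (y + z) x = ip X y x + ip X z x"
  using ip_conj[of x "y + z"] ip_conj[of x y] ip_conj[of x z]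
  by (simp add: ip_add_right kconj_add carr_add)
lemma ip_smul_left: "x \<in> carr X \<Longrightarrow> y \<in> carr X \<Longrightarrow> ip X (smul X c y) x = kconj c * ip X y x"
  using ip_conj[of x "smul X c y"] ip_conj[of x y] by (simp add: ip_smul_right carr_smul)
lemma ip_minus_right: "x \<in> carr X \<Longrightarrow> y \<in> carr X \<Longrightarrow> ip X x (- y) = - ip X x y"
  using ip_smul_right[of x y "-1"] by (simp add: smul_simps)
lemma ip_minus_left: "x \<in> carr X \<Longrightarrow> y \<in> carr X \<Longrightarrow> ip X (- y) x = - ip X y x"
  using ip_conj[of x "- y"] ip_conj[of x y] by (simp add: ip_minus_right carr_neg)
lemma ip_diff_right: "x \<in> carr X \<Longrightarrow> y \<in> carr X \<Longrightarrow> z \<in> carr X \<Longrightarrow> ip X x (y - z) = ip X x y - ip X x z"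
  using ip_add_right[of x y "- z"] by (simp add: ip_minus_right carr_simps)
lemma ip_diff_left: "x \<in> carr X \<Longrightarrow> y \<in> carr X \<Longrightarrow> z \<in> carr X \<Longrightarrow> ip X (y - z) x = ip X y x - ip X z x"
  using ip_add_left[of x y "- z"] by (simp add: ip_minus_left carr_simps)
lemma ip_0_right: "x \<in> carr X \<Longrightarrow> ip X x 0 = 0"
  using ip_smul_right[of x x 0] by (simp add: smul_simps)
lemma ip_0_left: "x \<in> carr X \<Longrightarrow> ip X 0 x = 0"
  using ip_conj[of x 0] by (simp add: ip_0_right carr_0)

lemmas ip_simps = ip_add_right ip_add_left ip_smul_right ip_smul_left ip_minus_right ip_minus_left
  ip_diff_right ip_diff_left ip_0_right ip_0_left

lemma ip_self: "x \<in> carr X \<Longrightarrow> ip X x x = of_real ((hnorm X x)\<^sup>2)"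
proof -
  assume "x \<in> carr X"
  then obtain r where "r \<ge> 0" "ip X x x = of_real r"
    using X unfolding semi_ip_space_def by blast
  then show ?thesis by (simp add: hnorm_def del: of_real_power)
qed

lemma hnorm_0: "hnorm X 0 = 0" by (simp add: hnorm_def ip_0_right carr_0)

lemma hnorm_smul: "x \<in> carr X \<Longrightarrow> hnorm X (smul X c x) = norm c * hnorm X x"
  by (simp add: hnorm_def ip_simps carr_simps norm_mult real_sqrt_mult)

lemma hnorm_minus: "x \<in> carr X \<Longrightarrow> hnorm X (- x) = hnorm X x"
  by (simp add: hnorm_def ip_simps carr_simps)

lemma hnorm_minus_commute: "x \<in> carr X \<Longrightarrow> y \<in> carr X \<Longrightarrow> hnorm X (x - y) = hnorm X (y - x)"
  by (metis hnorm_minus carr_diff minus_diff_eq)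

lemma norm_ip_commute: "x \<in> carr X \<Longrightarrow> y \<in> carr X \<Longrightarrow> norm (ip X x y) = norm (ip X y x)"
  by (metis ip_conj norm_kconj)

text \<open>
  The shift in the direction of y is by a real multiple of <y, x>. This keeps all terms real, so
  that no real part of a scalar has to be formed; minimality arguments below test with this shift.
\<close>

lemma hnorm_sq_shift:
  assumes "x \<in> carr X" "y \<in> carr X"
  shows "(hnorm X (x - smul X (of_real r * ip X y x) y))\<^sup>2
    = (hnorm X x)\<^sup>2 - 2 * r * (norm (ip X x y))\<^sup>2 + r\<^sup>2 * (norm (ip X x y))\<^sup>2 * (hnorm X y)\<^sup>2"
proof -
  let ?s = "of_real r * ip X y x"
  have c: "kconj (ip X y x) = ip X x y" "ip X y x * ip X x y = of_real ((norm (ip X x y))\<^sup>2)"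
    "ip X x y * ip X y x = of_real ((norm (ip X x y))\<^sup>2)"
    using mult_kconj'[of "ip X x y"] assms by (simp_all add: ip_conj mult.commute)
  have "(of_real ((hnorm X (x - smul X ?s y))\<^sup>2) :: 'k) = ip X (x - smul X ?s y) (x - smul X ?s y)"
    using assms by (simp add: ip_self carr_simps)
  also have "\<dots> = ip X x x - of_real r * (ip X y x * ip X x y) - of_real r * (ip X x y * ip X y x)
      + of_real r * of_real r * (ip X x y * ip X y x) * ip X y y"
    using assms by (simp add: ip_simps carr_simps c(1) algebra_simps)
  also have "\<dots> = of_real ((hnorm X x)\<^sup>2 - 2 * r * (norm (ip X x y))\<^sup>2
      + r\<^sup>2 * (norm (ip X x y))\<^sup>2 * (hnorm X y)\<^sup>2)"
    using assms by (simp only: c(2,3) ip_self) (simp add: algebra_simps power2_eq_square)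
  finally show ?thesis by (simp only: of_real_eq_iff)
qed

lemma cauchy_schwarz:
  assumes "x \<in> carr X" "y \<in> carr X"
  shows "norm (ip X x y) \<le> hnorm X x * hnorm X y"
proof -
  let ?a = "(hnorm X x)\<^sup>2" and ?b = "(hnorm X y)\<^sup>2" and ?p = "(norm (ip X x y))\<^sup>2"
  \<comment> \<open>A real quadratic polynomial in r without sign change; if its leading coefficient vanishes, so does the linear one.\<close>
  have pos: "0 \<le> ?a - 2 * r * ?p + r\<^sup>2 * ?p * ?b" for r
    by (metis hnorm_sq_shift[OF assms] zero_le_power2)
  have "?p \<le> ?a * ?b"
  proof (cases "?b = 0")
    case True
    have "?p = 0"
    proof (rule ccontr)
      assume "?p \<noteq> 0"
      then have "?p > 0" by simp
      then have "?a - 2 * ((?a + 1) / ?p) * ?p < 0" by (simp add: sum_power2_ge_zero) (smt (verit) zero_le_power2)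
      then show False using pos[of "(?a + 1) / ?p"] True by simp
    qed
    then show ?thesis by simp
  next
    case False
    then have b: "?b > 0" by simp
    have "0 \<le> ?a - 2 * (1 / ?b) * ?p + (1 / ?b)\<^sup>2 * ?p * ?b" by (rule pos)
    also have "(1 / ?b)\<^sup>2 * ?p * ?b = (1 / ?b) * ?p" using b by (simp add: power2_eq_square)
    finally have "(1 / ?b) * ?p \<le> ?a" by simp
    then show ?thesis using b by (simp add: divide_simps mult.commute)
  qed
  then have "?p \<le> (hnorm X x * hnorm X y)\<^sup>2" by (simp add: power_mult_distrib)
  then show ?thesis by (simp add: power2_le_iff_abs_le)
qed

lemma hnorm_sq_add:
  assumes "x \<in> carr X" "y \<in> carr X"
  shows "of_real ((hnorm X (x + y))\<^sup>2) = of_real ((hnorm X x)\<^sup>2) + ip X x y + ip X y x + of_real ((hnorm X y)\<^sup>2)"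
  unfolding ip_self[symmetric, OF assms(1)] ip_self[symmetric, OF assms(2)]
    ip_self[symmetric, OF carr_add[OF assms]]
  using assms by (simp add: ip_simps carr_simps)

lemma hnorm_triangle:
  assumes "x \<in> carr X" "y \<in> carr X"
  shows "hnorm X (x + y) \<le> hnorm X x + hnorm X y"
proof -
  have "(hnorm X (x + y))\<^sup>2 = norm (of_real ((hnorm X (x + y))\<^sup>2) :: 'k)" by (simp add: norm_power)
  also have "\<dots> \<le> norm (of_real ((hnorm X x)\<^sup>2) :: 'k) + norm (ip X x y) + norm (ip X y x)
      + norm (of_real ((hnorm X y)\<^sup>2) :: 'k)"
    unfolding hnorm_sq_add[OF assms]
    by (intro order_trans[OF norm_triangle_ineq] add_mono order_refl)
  also have "\<dots> \<le> (hnorm X x)\<^sup>2 + hnorm X x * hnorm X y + hnorm X y * hnorm X x + (hnorm X y)\<^sup>2"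
    using cauchy_schwarz assms by (intro add_mono) (simp_all add: norm_power)
  also have "\<dots> = (hnorm X x + hnorm X y)\<^sup>2" by (simp add: power2_eq_square algebra_simps)
  finally show ?thesis by (simp add: power2_le_iff_abs_le)
qed

lemma hnorm_triangle_diff:
  assumes "x \<in> carr X" "y \<in> carr X"
  shows "hnorm X (x - y) \<le> hnorm X x + hnorm X y"
  using hnorm_triangle[of x "- y"] assms by (simp add: hnorm_minus carr_simps)

lemma hnorm_triangle3:
  assumes "x \<in> carr X" "y \<in> carr X" "z \<in> carr X"
  shows "hnorm X (x - z) \<le> hnorm X (x - y) + hnorm X (y - z)"
  using hnorm_triangle[of "x - y" "y - z"] assms by (simp add: carr_simps)

lemma parallelogram:
  assumes "x \<in> carr X" "y \<in> carr X"
  shows "(hnorm X (x + y))\<^sup>2 + (hnorm X (x - y))\<^sup>2 = 2 * (hnorm X x)\<^sup>2 + 2 * (hnorm X y)\<^sup>2"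
proof -
  have "(of_real ((hnorm X (x + y))\<^sup>2 + (hnorm X (x - y))\<^sup>2) :: 'k)
      = of_real ((hnorm X (x + y))\<^sup>2) + of_real ((hnorm X (x - y))\<^sup>2)" by simp
  also have "\<dots> = ip X (x + y) (x + y) + ip X (x - y) (x - y)"
    using assms by (simp only: ip_self carr_simps)
  also have "\<dots> = 2 * ip X x x + 2 * ip X y y"
    using assms by (simp add: ip_simps carr_simps algebra_simps)
  also have "\<dots> = of_real (2 * (hnorm X x)\<^sup>2 + 2 * (hnorm X y)\<^sup>2)"
    using assms by (simp add: ip_self)
  finally show ?thesis by (simp only: of_real_eq_iff)
qed

end

lemma ip_self_eq_0: "inner_product_space X \<Longrightarrow> x \<in> carr X \<Longrightarrow> ip X x x = 0 \<Longrightarrow> x = 0"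
  unfolding inner_product_space_def by blast

lemma hnorm_eq_0: "inner_product_space X \<Longrightarrow> x \<in> carr X \<Longrightarrow> hnorm X x = 0 \<longleftrightarrow> x = 0"
  using ip_self[OF ips_semi, of X x] ip_self_eq_0[of X x] hnorm_0[OF ips_semi, of X] by auto

lemma ip_all_0:
  assumes "inner_product_space X" "x \<in> carr X" "\<And>y. y \<in> carr X \<Longrightarrow> ip X y x = 0"
  shows "x = 0"
  using assms by (simp add: ip_self_eq_0)

lemma hnorm_cong: "ip X x x = ip Y y y \<Longrightarrow> hnorm X x = hnorm Y y"
  by (simp add: hnorm_def)

section \<open>Metric notions in terms of the norm\<close>

lemma ips_metric:
  assumes "inner_product_space X"
  shows "Metric_space (carr X) (hdist X)"
proof
  note s = ips_semi[OF assms]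
  show "0 \<le> hdist X x y" for x y by (simp add: hdist_def)
  show "hdist X x y = hdist X y x" for x y
    by (auto simp: hdist_def hnorm_minus_commute[OF s])
  show "x \<in> carr X \<Longrightarrow> y \<in> carr X \<Longrightarrow> (hdist X x y = 0) = (x = y)" for x y
    by (simp add: hdist_def hnorm_eq_0[OF assms] carr_diff[OF s])
  show "x \<in> carr X \<Longrightarrow> y \<in> carr X \<Longrightarrow> z \<in> carr X \<Longrightarrow> hdist X x z \<le> hdist X x y + hdist X y z" for x y z
    using hnorm_triangle3[OF s] by (simp add: hdist_def)
qed

lemma dense_in_iff:
  assumes "inner_product_space X"
  shows "dense_in X D \<longleftrightarrow> D \<subseteq> carr X \<and> (\<forall>x\<in>carr X. \<forall>e>0. \<exists>d\<in>D. hnorm X (d - x) < e)"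
proof -
  interpret Metric_space "carr X" "hdist X" by (rule ips_metric[OF assms])
  note s = ips_semi[OF assms]
  show ?thesis
    unfolding dense_in_def metric_closure_of
    by (auto simp: in_mball hdist_def subset_iff set_eq_iff hnorm_minus_commute[OF s])
      (metis hnorm_minus_commute[OF s])+
qed

lemma dense_in_sub: "dense_in X D \<Longrightarrow> D \<subseteq> carr X" by (simp add: dense_in_def)

lemma dense_inD:
  "inner_product_space X \<Longrightarrow> dense_in X D \<Longrightarrow> x \<in> carr X \<Longrightarrow> e > 0 \<Longrightarrow> \<exists>d\<in>D. hnorm X (d - x) < e"
  by (simp add: dense_in_iff)

definition cauchy_in :: "('k::rc_scalar, 'v::ab_group_add) ip_space \<Rightarrow> (nat \<Rightarrow> 'v) \<Rightarrow> bool" where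
  "cauchy_in X s \<longleftrightarrow> (\<forall>n. s n \<in> carr X) \<and> (\<forall>e>0. \<exists>N. \<forall>m\<ge>N. \<forall>n\<ge>N. hnorm X (s m - s n) < e)"

lemma hilbert_iff:
  "hilbert X \<longleftrightarrow> inner_product_space X \<and>
     (\<forall>s. cauchy_in X s \<longrightarrow> (\<exists>x\<in>carr X. (\<lambda>n. hnorm X (s n - x)) \<longlonglongrightarrow> 0))"
proof (cases "inner_product_space X")
  case True
  interpret Metric_space "carr X" "hdist X" by (rule ips_metric[OF True])
  have c: "MCauchy s \<longleftrightarrow> cauchy_in X s" for s
    unfolding MCauchy_def cauchy_in_def hdist_def by (auto simp: image_subset_iff)
  have l: "limitin mtopology s x sequentially \<longleftrightarrow> x \<in> carr X \<and> (\<lambda>n. hnorm X (s n - x)) \<longlonglongrightarrow> 0"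
    if "\<forall>n. s n \<in> carr X" for s x
    unfolding limitin_metric_dist_null using that by (auto simp: hdist_def)
  show ?thesis
    unfolding hilbert_def mcomplete_def c using True l
    by (metis cauchy_in_def)
qed (simp add: hilbert_def)

lemma hilbertD:
  assumes "hilbert X" "cauchy_in X s"
  obtains x where "x \<in> carr X" "(\<lambda>n. hnorm X (s n - x)) \<longlonglongrightarrow> 0"
  using assms unfolding hilbert_iff by blast

lemma ip_tendsto:
  assumes X: "semi_ip_space X" and s: "\<And>n. s n \<in> carr X" and x: "x \<in> carr X"
    and l: "(\<lambda>n. hnorm X (s n - x)) \<longlonglongrightarrow> 0" and y: "y \<in> carr X"
  shows "(\<lambda>n. ip X y (s n)) \<longlonglongrightarrow> ip X y x" "(\<lambda>n. ip X (s n) y) \<longlonglongrightarrow> ip X x y"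
proof -
  have l': "(\<lambda>n. hnorm X y * hnorm X (s n - x)) \<longlonglongrightarrow> 0"
    using tendsto_mult[OF tendsto_const l] by simp
  have "norm (ip X y (s n) - ip X y x) \<le> hnorm X y * hnorm X (s n - x)" for n
    using cauchy_schwarz[OF X y carr_diff[OF X s x]] by (simp add: ip_simps[OF X] s x y)
  then have "(\<lambda>n. ip X y (s n) - ip X y x) \<longlonglongrightarrow> 0"
    by (intro Lim_null_comparison[OF _ l']) auto
  then show "(\<lambda>n. ip X y (s n)) \<longlonglongrightarrow> ip X y x" by (simp add: LIM_zero_iff)
  have "norm (ip X (s n) y - ip X x y) \<le> hnorm X y * hnorm X (s n - x)" for n
    using cauchy_schwarz[OF X carr_diff[OF X s x] y] by (simp add: ip_simps[OF X] s x y mult.commute)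
  then have "(\<lambda>n. ip X (s n) y - ip X x y) \<longlonglongrightarrow> 0"
    by (intro Lim_null_comparison[OF _ l']) auto
  then show "(\<lambda>n. ip X (s n) y) \<longlonglongrightarrow> ip X x y" by (simp add: LIM_zero_iff)
qed

lemma hilbert_equiv:
  assumes X: "hilbert X" and Y: "inner_product_space Y" and c: "carr Y = carr X"
    and le: "\<And>x. x \<in> carr X \<Longrightarrow> hnorm X x \<le> C * hnorm Y x"
      "\<And>x. x \<in> carr X \<Longrightarrow> hnorm Y x \<le> C' * hnorm X x"
  shows "hilbert Y"
  unfolding hilbert_iff
proof (intro conjI Y allI impI)
  fix s assume s: "cauchy_in Y s"
  have sX: "\<And>n. s n \<in> carr X" using s c by (simp add: cauchy_in_def)
  have le1: "hnorm X x \<le> (\<bar>C\<bar> + 1) * hnorm Y x" if "x \<in> carr X" for x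
    by (rule order_trans[OF le(1)[OF that] mult_right_mono]) auto
  have "cauchy_in X s"
    unfolding cauchy_in_def
  proof (intro conjI allI impI sX)
    fix e :: real assume "e > 0"
    then obtain N where N: "\<And>m n. m \<ge> N \<Longrightarrow> n \<ge> N \<Longrightarrow> hnorm Y (s m - s n) < e / (\<bar>C\<bar> + 1)"
      using s unfolding cauchy_in_def by (metis add_pos_nonneg abs_ge_zero divide_pos_pos zero_less_one add.commute)
    have "hnorm X (s m - s n) < e" if "m \<ge> N" "n \<ge> N" for m n
    proof -
      have "hnorm X (s m - s n) \<le> (\<bar>C\<bar> + 1) * hnorm Y (s m - s n)"
        using le1 sX carr_diff[OF hilbert_semi[OF X]] by simp
      also have "\<dots> < (\<bar>C\<bar> + 1) * (e / (\<bar>C\<bar> + 1))" using N[OF that] by (intro mult_strict_left_mono) auto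
      also have "\<dots> = e" by simp
      finally show ?thesis .
    qed
    then show "\<exists>N. \<forall>m\<ge>N. \<forall>n\<ge>N. hnorm X (s m - s n) < e" by blast
  qed
  then obtain x where x: "x \<in> carr X" "(\<lambda>n. hnorm X (s n - x)) \<longlonglongrightarrow> 0" by (rule hilbertD[OF X])
  have "(\<lambda>n. C' * hnorm X (s n - x)) \<longlonglongrightarrow> 0"
    using tendsto_mult[OF tendsto_const x(2)] by simp
  then have "(\<lambda>n. hnorm Y (s n - x)) \<longlonglongrightarrow> 0"
    using le(2) sX x(1) carr_diff[OF hilbert_semi[OF X]]
    by (elim Lim_null_comparison[rotated]) (auto simp: hnorm_def)
  then show "\<exists>x\<in>carr Y. (\<lambda>n. hnorm Y (s n - x)) \<longlonglongrightarrow> 0" using x(1) c by blast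
qed

lemma inner_product_spaceI:
  assumes "vector_space (smul X)" "module.subspace (smul X) (carr X)"
    "\<And>x y z. x \<in> carr X \<Longrightarrow> y \<in> carr X \<Longrightarrow> z \<in> carr X \<Longrightarrow> ip X x (y + z) = ip X x y + ip X x z"
    "\<And>x y c. x \<in> carr X \<Longrightarrow> y \<in> carr X \<Longrightarrow> ip X x (smul X c y) = c * ip X x y"
    "\<And>x y. x \<in> carr X \<Longrightarrow> y \<in> carr X \<Longrightarrow> kconj (ip X x y) = ip X y x"
    "\<And>x. x \<in> carr X \<Longrightarrow> \<exists>r\<ge>0. ip X x x = of_real r"
    "\<And>x. x \<in> carr X \<Longrightarrow> ip X x x = 0 \<Longrightarrow> x = 0"
  shows "inner_product_space X"
  unfolding inner_product_space_def
  by (intro conjI ballI allI impI assms(1-4,6,7) assms(5)[symmetric])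

lemma ips_real:
  "semi_ip_space X \<Longrightarrow> x \<in> carr X \<Longrightarrow> \<exists>r\<ge>0. ip X x x = of_real r"
  using ip_self[of X x] by (metis zero_le_power2)

lemma inner_product_space_cong:
  assumes "carr Y = carr X" "smul Y = smul X" "\<And>x y. x \<in> carr X \<Longrightarrow> y \<in> carr X \<Longrightarrow> ip Y x y = ip X x y"
    "inner_product_space X"
  shows "inner_product_space Y"
proof -
  note S = ips_semi[OF assms(4)]
  show ?thesis
  proof (rule inner_product_spaceI)
    show "\<And>x. x \<in> carr Y \<Longrightarrow> \<exists>r\<ge>0. ip Y x x = of_real r" using ips_real[OF S] assms by metis
    show "\<And>x. x \<in> carr Y \<Longrightarrow> ip Y x x = 0 \<Longrightarrow> x = 0" using ip_self_eq_0[OF assms(4)] assms by metis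
  qed (use assms semi_vs[OF S] semi_subspace[OF S] in
    \<open>simp_all add: ip_simps[OF S] ip_conj[OF S] carr_simps[OF S]\<close>)
qed

lemma hilbert_cong:
  assumes "carr Y = carr X" "smul Y = smul X" "\<And>x y. x \<in> carr X \<Longrightarrow> y \<in> carr X \<Longrightarrow> ip Y x y = ip X x y"
    "hilbert X"
  shows "hilbert Y"
  by (rule hilbert_equiv[OF assms(4) inner_product_space_cong[OF assms(1-3) hilbert_ips[OF assms(4)]] assms(1),
    where C = 1 and C' = 1])
    (simp_all add: hnorm_def assms(3))

section \<open>Elements of minimal norm and the Riesz representation\<close>

text \<open>
  By the parallelogram law and the midpoint condition a minimizing sequence is a Cauchy sequence.
  Its limit x may lie outside E; this is what allows functionals that are given on a subspace only.
\<close>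

lemma minimal_norm_element:
  assumes X: "hilbert X" and E: "E \<subseteq> carr X" "E \<noteq> {}"
    and mid: "\<And>x y. x \<in> E \<Longrightarrow> y \<in> E \<Longrightarrow> smul X (of_real (1/2)) (x + y) \<in> E"
  obtains x s where "x \<in> carr X" "\<And>n::nat. s n \<in> E" "(\<lambda>n. hnorm X (s n - x)) \<longlonglongrightarrow> 0"
    "\<And>y. y \<in> E \<Longrightarrow> hnorm X x \<le> hnorm X y"
proof -
  note S = hilbert_semi[OF X]
  let ?d = "Inf (hnorm X ` E)"
  have bb: "bdd_below (hnorm X ` E)" by (rule bdd_belowI[of _ 0]) (auto simp: hnorm_def)
  have d: "?d \<le> hnorm X y" if "y \<in> E" for y using bb that by (intro cInf_lower) auto
  have d0: "?d \<ge> 0" using E(2) by (intro cInf_greatest) (auto simp: hnorm_def)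
  have "\<exists>y\<in>E. hnorm X y < ?d + 1 / Suc n" for n
  proof -
    have "?d < ?d + 1 / Suc n" by simp
    then obtain v where "v \<in> hnorm X ` E" "v < ?d + 1 / Suc n" using cInf_lessD E(2) by (metis image_is_empty)
    then show ?thesis by blast
  qed
  then obtain s where sE: "\<And>n. s n \<in> E" and sd: "\<And>n. hnorm X (s n) < ?d + 1 / Suc n" by metis
  have sX: "s n \<in> carr X" for n using sE E(1) by blast
  have diff: "(hnorm X (s m - s n))\<^sup>2 \<le> (8 * ?d + 4) * (1 / Suc N)" if "m \<ge> N" "n \<ge> N" for m n N
  proof -
    have le: "hnorm X (s k) \<le> ?d + 1 / Suc N" if "k \<ge> N" for k
      using sd[of k] that by (smt (verit) frac_le of_nat_0_less_iff of_nat_le_iff Suc_le_mono zero_less_Suc)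
    have sq: "(hnorm X (s k))\<^sup>2 \<le> (?d + 1 / Suc N)\<^sup>2" if "k \<ge> N" for k
      using le[OF that] by (intro power_mono) (auto simp: hnorm_def)
    have "?d \<le> hnorm X (smul X (of_real (1/2)) (s m + s n))" using mid sE d by blast
    also have "\<dots> = hnorm X (s m + s n) / 2"
      using hnorm_smul[OF S, of "s m + s n" "of_real (1/2)"] sX carr_add[OF S] by (simp add: norm_divide)
    finally have "(2 * ?d)\<^sup>2 \<le> (hnorm X (s m + s n))\<^sup>2" using d0 by (intro power_mono) auto
    then have "(hnorm X (s m - s n))\<^sup>2 \<le> 4 * (?d + 1 / Suc N)\<^sup>2 - 4 * ?d\<^sup>2"
      using parallelogram[OF S, of "s m" "s n"] sX sq[OF that(1)] sq[OF that(2)]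
      by (simp add: power_mult_distrib)
    also have "\<dots> = 8 * ?d * (1 / Suc N) + 4 * (1 / Suc N)\<^sup>2"
      by (simp add: power2_eq_square algebra_simps)
    also have "\<dots> \<le> 8 * ?d * (1 / Suc N) + 4 * (1 / Suc N)"
      by (intro add_left_mono mult_left_mono) (auto simp: power2_eq_square divide_simps)
    finally show ?thesis by (simp add: algebra_simps)
  qed
  have "cauchy_in X s" unfolding cauchy_in_def
  proof (intro conjI allI impI sX)
    fix e :: real assume e: "e > 0"
    obtain N where N: "inverse (of_nat (Suc N)) < e\<^sup>2 / (8 * ?d + 4)"
      using reals_Archimedean[of "e\<^sup>2 / (8 * ?d + 4)"] e d0 by auto
    have "hnorm X (s m - s n) < e" if "m \<ge> N" "n \<ge> N" for m n
    proof -
      have "(hnorm X (s m - s n))\<^sup>2 < e\<^sup>2"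
      proof -
        have "(8 * ?d + 4) * (1 / Suc N) < (8 * ?d + 4) * (e\<^sup>2 / (8 * ?d + 4))"
          using N d0 by (intro mult_strict_left_mono) (auto simp: inverse_eq_divide)
        then show ?thesis using diff[OF that] d0 by simp
      qed
      then show ?thesis using e by (simp add: power2_less_imp_less)
    qed
    then show "\<exists>N. \<forall>m\<ge>N. \<forall>n\<ge>N. hnorm X (s m - s n) < e" by blast
  qed
  then obtain x where x: "x \<in> carr X" "(\<lambda>n. hnorm X (s n - x)) \<longlonglongrightarrow> 0" by (rule hilbertD[OF X])
  have "hnorm X x \<le> hnorm X (s n - x) + (?d + 1 / Suc n)" for n
    using hnorm_triangle_diff[OF S sX carr_diff[OF S sX x(1)], of n n] sd[of n] by simp
  moreover have "(\<lambda>n. hnorm X (s n - x) + (?d + 1 / Suc n)) \<longlonglongrightarrow> ?d"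
    using tendsto_add[OF x(2) tendsto_add[OF tendsto_const LIMSEQ_inverse_real_of_nat, of ?d]]
    by (simp add: inverse_eq_divide)
  ultimately have "hnorm X x \<le> ?d" by (intro LIMSEQ_le_const) auto
  then have "hnorm X x \<le> hnorm X y" if "y \<in> E" for y using d[OF that] by linarith
  then show thesis using that[OF x(1) sE x(2)] by blast
qed

lemma orthogonal_if_minimal:
  assumes X: "semi_ip_space X" "x \<in> carr X" "n \<in> carr X"
    and min: "\<And>c. hnorm X x \<le> hnorm X (x - smul X c n)"
  shows "ip X x n = 0"
proof (rule ccontr)
  assume "ip X x n \<noteq> 0"
  then have p: "(norm (ip X x n))\<^sup>2 > 0" (is "?p > 0") by simp
  define b where "b = (hnorm X n)\<^sup>2"
  have b: "b \<ge> 0" by (simp add: b_def)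
  define r where "r = 1 / (b + 1)"
  have r: "r > 0" "r * b < 1" using b by (auto simp: r_def divide_simps)
  have "(hnorm X x)\<^sup>2 \<le> (hnorm X (x - smul X (of_real r * ip X n x) n))\<^sup>2"
    using min by (intro power_mono) auto
  then have "0 \<le> - 2 * r * ?p + r\<^sup>2 * ?p * b"
    using hnorm_sq_shift[OF X, of r] by (simp add: b_def)
  also have "\<dots> = r * ?p * (r * b - 2)" by (simp add: power2_eq_square algebra_simps)
  also have "\<dots> < 0" using r p by (intro mult_pos_neg) auto
  finally show False by simp
qed

text \<open>
  Passage from the elements s k - n of a set to the element x - n of its closure.
\<close>

lemma limit_minimal:
  assumes X: "semi_ip_space X" and x: "x \<in> carr X" and n: "n \<in> carr X" and s: "\<And>k. s k \<in> carr X"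
    and lim: "(\<lambda>k. hnorm X (s k - x)) \<longlonglongrightarrow> 0"
    and min: "\<And>k. hnorm X x \<le> hnorm X (s k - n)"
  shows "hnorm X x \<le> hnorm X (x - n)"
proof -
  have "hnorm X x \<le> hnorm X (s k - x) + hnorm X (x - n)" for k
    using min[of k] hnorm_triangle3[OF X s x n, of k] by linarith
  moreover have "(\<lambda>k. hnorm X (s k - x) + hnorm X (x - n)) \<longlonglongrightarrow> 0 + hnorm X (x - n)"
    by (intro tendsto_intros lim)
  ultimately show ?thesis by (intro LIMSEQ_le_const[of _ "hnorm X (x - n)"]) auto
qed

text \<open>
  The representing vector is a multiple of the element x of minimal norm in the closure of the
  affine subspace where f = 1: minimality makes x orthogonal to the kernel of f. A representation
  in X of a functional that is bounded on a subspace combines the theorems of Riesz and of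
  Hahn and Banach.
\<close>

theorem riesz_on_subspace:
  assumes X: "hilbert X" and D: "D \<subseteq> carr X" "\<And>x y. x \<in> D \<Longrightarrow> y \<in> D \<Longrightarrow> x + y \<in> D"
      "\<And>c x. x \<in> D \<Longrightarrow> smul X c x \<in> D"
    and add: "\<And>x y. x \<in> D \<Longrightarrow> y \<in> D \<Longrightarrow> f (x + y) = f x + f y"
    and hom: "\<And>c x. x \<in> D \<Longrightarrow> f (smul X c x) = c * f x"
    and bd: "\<And>x. x \<in> D \<Longrightarrow> norm (f x) \<le> C * hnorm X x"
  obtains z where "z \<in> carr X" "\<And>x. x \<in> D \<Longrightarrow> f x = ip X z x"
proof (cases "\<forall>x\<in>D. f x = 0")
  case True
  note S = hilbert_semi[OF X]
  show thesis by (rule that[of 0]) (use True D(1) in \<open>auto simp: carr_0[OF S] ip_0_left[OF S]\<close>)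
next
  case False
  note S = hilbert_semi[OF X]
  have diff: "x - y \<in> D" "f (x - y) = f x - f y" if "x \<in> D" "y \<in> D" for x y
    using D(2)[OF that(1) D(3)[OF that(2), of "-1"]] add[OF that(1) D(3)[OF that(2), of "-1"]]
      hom[OF that(2), of "-1"] by (simp_all add: smul_simps[OF S])
  obtain x0 where x0: "x0 \<in> D" "f x0 \<noteq> 0" using False by blast
  define E where "E = {x \<in> D. f x = 1}"
  have ED: "E \<subseteq> D" by (auto simp: E_def)
  have "smul X (1 / f x0) x0 \<in> E" using x0 D(3) by (simp add: E_def hom)
  then have E0: "E \<noteq> {}" by blast
  have mid: "smul X (of_real (1/2)) (x + y) \<in> E" if "x \<in> E" "y \<in> E" for x y
    using that D(2,3) by (simp add: E_def hom add)
  obtain x s where x: "x \<in> carr X" and s: "\<And>n::nat. s n \<in> E"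
    and lim: "(\<lambda>n. hnorm X (s n - x)) \<longlonglongrightarrow> 0" and min: "\<And>y. y \<in> E \<Longrightarrow> hnorm X x \<le> hnorm X y"
    using minimal_norm_element[OF X _ E0 mid] ED D(1) by blast
  have sD: "s n \<in> D" and sX: "s n \<in> carr X" and sf: "f (s n) = 1" for n
    using s[of n] D(1) by (auto simp: E_def)
  have ker: "ip X x y = 0" if y: "y \<in> D" "f y = 0" for y
  proof (rule orthogonal_if_minimal[OF S x])
    show "y \<in> carr X" using y D(1) by blast
    fix c
    show "hnorm X x \<le> hnorm X (x - smul X c y)"
    proof (rule limit_minimal[OF S x _ sX lim])
      show "smul X c y \<in> carr X" using D y by blast
      show "hnorm X x \<le> hnorm X (s k - smul X c y)" for k
        using diff[OF sD[of k] D(3)[OF y(1)], of c] sf[of k] hom[OF y(1), of c] y(2)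
        by (intro min) (simp add: E_def)
    qed
  qed
  \<comment> \<open>On the set where f = 1 the functional <x, .> is constant; its value is <x, x>, as x is a limit of such elements.\<close>
  have const: "ip X x (s n) = ip X x (s 0)" for n
    using ker[of "s n - s 0"] diff[OF sD sD, of n 0] sf by (simp add: ip_simps[OF S] x sX)
  have xs: "ip X x (s 0) = ip X x x"
  proof -
    have "(\<lambda>n. ip X x (s n)) = (\<lambda>n. ip X x (s 0))" using const by (rule ext)
    then have "(\<lambda>n. ip X x (s 0)) \<longlonglongrightarrow> ip X x x" using ip_tendsto(1)[OF S sX x lim x] by simp
    then show ?thesis by (simp add: LIMSEQ_const_iff)
  qed
  have "1 \<le> \<bar>C\<bar> * (hnorm X (s n - x) + hnorm X x)" for n
  proof -
    have "1 \<le> C * hnorm X (s n)" using bd[OF sD, of n] sf by simp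
    also have "\<dots> \<le> \<bar>C\<bar> * hnorm X (s n)" by (intro mult_right_mono) auto
    also have "\<dots> \<le> \<bar>C\<bar> * (hnorm X (s n - x) + hnorm X x)"
      using hnorm_triangle[OF S carr_diff[OF S sX x] x, of n] by (intro mult_left_mono) auto
    finally show ?thesis .
  qed
  moreover have "(\<lambda>n. \<bar>C\<bar> * (hnorm X (s n - x) + hnorm X x)) \<longlonglongrightarrow> \<bar>C\<bar> * (0 + hnorm X x)"
    by (intro tendsto_intros lim)
  ultimately have "1 \<le> \<bar>C\<bar> * (0 + hnorm X x)" by (intro LIMSEQ_le_const) auto
  then have nz: "hnorm X x \<noteq> 0" by auto
  show thesis
  proof (rule that[of "smul X (of_real (1 / (hnorm X x)\<^sup>2)) x"])
    show "smul X (of_real (1 / (hnorm X x)\<^sup>2)) x \<in> carr X" using x by (simp add: carr_smul[OF S])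
    fix y assume y: "y \<in> D"
    then have yX: "y \<in> carr X" using D(1) by blast
    have "ip X x (y - smul X (f y) (s 0)) = 0"
      using diff[OF y D(3)[OF sD], of "f y" 0] hom[OF sD, of "f y" 0] sf by (intro ker) auto
    then have "ip X x y = f y * ip X x x"
      using x yX sX xs by (simp add: ip_simps[OF S] carr_simps[OF S])
    then show "f y = ip X (smul X (of_real (1 / (hnorm X x)\<^sup>2)) x) y"
      using x yX nz by (simp add: ip_smul_left[OF S] ip_self[OF S] del: of_real_divide)
        (simp add: field_simps)
  qed
qed

lemma smul_half:
  assumes "semi_ip_space X"
  shows "smul X (of_real (1/2)) x + smul X (of_real (1/2)) x = x"
proof -
  have "smul X (of_real (1/2)) x + smul X (of_real (1/2)) x = smul X (of_real (1/2) + of_real (1/2)) x"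
    by (rule smul_add_left[OF assms, symmetric])
  also have "\<dots> = x" by (simp only: of_real_add[symmetric]) (simp add: smul_one[OF assms])
  finally show ?thesis .
qed

text \<open>
  An element of minimal norm in the closure of x0 - D is orthogonal to D, hence zero.
\<close>

theorem dense_in_if_orthogonal:
  assumes X: "hilbert X" and D: "D \<subseteq> carr X" "0 \<in> D" "\<And>x y. x \<in> D \<Longrightarrow> y \<in> D \<Longrightarrow> x + y \<in> D"
      "\<And>c x. x \<in> D \<Longrightarrow> smul X c x \<in> D"
    and orth: "\<And>x. x \<in> carr X \<Longrightarrow> (\<And>d. d \<in> D \<Longrightarrow> ip X x d = 0) \<Longrightarrow> x = 0"
  shows "dense_in X D"
  unfolding dense_in_iff[OF hilbert_ips[OF X]]
proof (intro conjI D ballI allI impI)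
  note S = hilbert_semi[OF X]
  fix x0 and e :: real assume x0: "x0 \<in> carr X" and e: "e > 0"
  define E where "E = (\<lambda>d. x0 - d) ` D"
  have EX: "E \<subseteq> carr X" "E \<noteq> {}" using D x0 by (auto simp: E_def carr_simps[OF S])
  have mid: "smul X (of_real (1/2)) (x + y) \<in> E" if "x \<in> E" "y \<in> E" for x y
  proof -
    from that obtain a b where ab: "a \<in> D" "b \<in> D" "x = x0 - a" "y = x0 - b" by (auto simp: E_def)
    have "smul X (of_real (1/2)) (x + y) = x0 - smul X (of_real (1/2)) (a + b)"
      unfolding ab using smul_half[OF S, of x0]
      by (simp only: smul_add_right[OF S] smul_diff_right[OF S]) (simp add: algebra_simps)
    then show ?thesis using ab D by (auto simp: E_def)
  qed
  obtain x s where x: "x \<in> carr X" and s: "\<And>n::nat. s n \<in> E"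
    and lim: "(\<lambda>n. hnorm X (s n - x)) \<longlonglongrightarrow> 0" and min: "\<And>y. y \<in> E \<Longrightarrow> hnorm X x \<le> hnorm X y"
    using minimal_norm_element[OF X EX mid] by blast
  have sX: "s n \<in> carr X" for n using s EX(1) by blast
  have shift: "y - d \<in> E" if "y \<in> E" "d \<in> D" for y d
  proof -
    from that(1) obtain a where "a \<in> D" "y = x0 - a" by (auto simp: E_def)
    then show ?thesis using D(3)[OF \<open>a \<in> D\<close> that(2)] by (auto simp: E_def diff_diff_eq)
  qed
  have "x = 0"
  proof (rule orth[OF x])
    fix d assume d: "d \<in> D"
    show "ip X x d = 0"
    proof (rule orthogonal_if_minimal[OF S x])
      show "d \<in> carr X" using d D(1) by blast
      fix c
      show "hnorm X x \<le> hnorm X (x - smul X c d)"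
        by (rule limit_minimal[OF S x _ sX lim]) (use d D shift s min in blast)+
    qed
  qed
  then have "(\<lambda>n. hnorm X (s n)) \<longlonglongrightarrow> 0" using lim by simp
  then obtain n where n: "hnorm X (s n) < e" using e
    by (metis LIMSEQ_D[of "\<lambda>n. hnorm X (s n)" 0 e] abs_of_nonneg diff_zero hnorm_ge_0 order_refl real_norm_def)
  obtain d where d: "d \<in> D" "s n = x0 - d" using s[of n] by (auto simp: E_def)
  then have "hnorm X (d - x0) < e"
    using n hnorm_minus_commute[OF S x0, of d] D(1) by auto
  then show "\<exists>d\<in>D. hnorm X (d - x0) < e" using d(1) by blast
qed

lemma dense_orthogonal:
  assumes X: "inner_product_space X" and D: "dense_in X D" and x: "x \<in> carr X"
    and o: "\<And>d. d \<in> D \<Longrightarrow> ip X d x = 0"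
  shows "x = 0"
proof (rule ccontr)
  note S = ips_semi[OF X]
  assume "x \<noteq> 0"
  then have p: "hnorm X x > 0" using hnorm_eq_0[OF X x] by (simp add: less_le)
  obtain d where d: "d \<in> D" "hnorm X (d - x) < hnorm X x" using dense_inD[OF X D x p] by blast
  have dX: "d \<in> carr X" using d dense_in_sub[OF D] by blast
  have "(hnorm X x)\<^sup>2 = norm (ip X x x)" by (simp add: ip_self[OF S x] norm_power)
  also have "ip X x x = - ip X (d - x) x" using o[OF d(1)] x dX by (simp add: ip_simps[OF S])
  also have "norm \<dots> \<le> hnorm X (d - x) * hnorm X x"
    using cauchy_schwarz[OF S carr_diff[OF S dX x] x] by simp
  also have "\<dots> < hnorm X x * hnorm X x" using d p by (intro mult_strict_right_mono)
  finally show False by (simp add: power2_eq_square)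
qed

lemma norm_le_if_dense:
  assumes X: "inner_product_space X" and D: "dense_in X D" and z: "z \<in> carr X" and K: "K \<ge> 0"
    and bd: "\<And>u. u \<in> D \<Longrightarrow> norm (ip X z u) \<le> K * hnorm X u"
  shows "hnorm X z \<le> K"
proof -
  note S = ips_semi[OF X]
  have "(hnorm X z)\<^sup>2 \<le> K * hnorm X z + e" if e: "e > 0" for e
  proof -
    define r where "r = e / (K + hnorm X z + 1)"
    have p: "K + hnorm X z + 1 > 0" using K hnorm_ge_0[of X z] by linarith
    then have r: "r > 0" using e by (simp add: r_def)
    obtain u where u: "u \<in> D" "hnorm X (u - z) < r" using dense_inD[OF X D z r] by blast
    have uX: "u \<in> carr X" using u dense_in_sub[OF D] by blast
    have "ip X z z = ip X z u - ip X z (u - z)" using z uX by (simp add: ip_simps[OF S])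
    then have "norm (ip X z z) \<le> norm (ip X z u) + norm (ip X z (u - z))" by (simp add: norm_triangle_ineq4)
    also have "\<dots> \<le> K * hnorm X u + hnorm X z * hnorm X (u - z)"
      using bd[OF u(1)] cauchy_schwarz[OF S z carr_diff[OF S uX z]] by linarith
    also have "\<dots> \<le> K * (hnorm X z + r) + hnorm X z * r"
    proof -
      have "hnorm X u \<le> hnorm X z + r"
        using hnorm_triangle[OF S carr_diff[OF S uX z] z] u(2) by simp
      then show ?thesis using K u(2) by (intro add_mono mult_left_mono) auto
    qed
    also have "\<dots> = K * hnorm X z + (K + hnorm X z) * r" by (simp add: algebra_simps)
    also have "\<dots> \<le> K * hnorm X z + (K + hnorm X z + 1) * r"
      using r by (intro add_left_mono mult_right_mono) auto
    also have "(K + hnorm X z + 1) * r = e" using p by (simp add: r_def)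
    finally show ?thesis using z by (simp add: ip_self[OF S] norm_power)
  qed
  then have "(hnorm X z)\<^sup>2 \<le> K * hnorm X z" by (rule field_le_epsilon)
  then show ?thesis using K by (cases "hnorm X z = 0") (auto simp: power2_eq_square less_le)
qed

text \<open>
  Applied below to the change from the norm of h to the weaker norm of h_Theta.
\<close>

lemma dense_in_weaker:
  assumes X: "inner_product_space X" and Y: "inner_product_space Y" and c: "carr Y = carr X"
    and le: "\<And>x. x \<in> carr X \<Longrightarrow> hnorm Y x \<le> C * hnorm X x" and D: "dense_in X D"
  shows "dense_in Y D"
  unfolding dense_in_iff[OF Y] c
proof (intro conjI ballI allI impI)
  show "D \<subseteq> carr X" using dense_in_sub[OF D] .
  fix x and e :: real assume x: "x \<in> carr X" and e: "e > 0"
  have "e / (\<bar>C\<bar> + 1) > 0" using e by simp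
  then obtain d where d: "d \<in> D" "hnorm X (d - x) < e / (\<bar>C\<bar> + 1)" using dense_inD[OF X D x] by blast
  have dx: "d - x \<in> carr X" using d(1) x dense_in_sub[OF D] carr_diff[OF ips_semi[OF X]] by blast
  have "hnorm Y (d - x) \<le> C * hnorm X (d - x)" by (rule le[OF dx])
  also have "\<dots> \<le> (\<bar>C\<bar> + 1) * hnorm X (d - x)" by (intro mult_right_mono) auto
  also have "\<dots> < (\<bar>C\<bar> + 1) * (e / (\<bar>C\<bar> + 1))" using d(2) by (intro mult_strict_left_mono) auto
  also have "\<dots> = e" by simp
  finally show "\<exists>d\<in>D. hnorm Y (d - x) < e" using d(1) by blast
qed

section \<open>Bounded operators\<close>

definition lin_on :: "('k::rc_scalar, 'v::ab_group_add) ip_space \<Rightarrow> ('k, 'w::ab_group_add) ip_space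
    \<Rightarrow> ('v \<Rightarrow> 'w) \<Rightarrow> bool" where
  "lin_on X Y F \<longleftrightarrow> (\<forall>x\<in>carr X. F x \<in> carr Y) \<and>
     (\<forall>x\<in>carr X. \<forall>y\<in>carr X. F (x + y) = F x + F y) \<and>
     (\<forall>x\<in>carr X. \<forall>c. F (smul X c x) = smul Y c (F x))"

lemma lin_onI:
  assumes "\<And>x. x \<in> carr X \<Longrightarrow> F x \<in> carr Y"
    "\<And>x y. x \<in> carr X \<Longrightarrow> y \<in> carr X \<Longrightarrow> F (x + y) = F x + F y"
    "\<And>x c. x \<in> carr X \<Longrightarrow> F (smul X c x) = smul Y c (F x)"
  shows "lin_on X Y F"
  using assms by (simp add: lin_on_def)

lemma lin_on_carr: "lin_on X Y F \<Longrightarrow> x \<in> carr X \<Longrightarrow> F x \<in> carr Y"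
  and lin_on_add: "lin_on X Y F \<Longrightarrow> x \<in> carr X \<Longrightarrow> y \<in> carr X \<Longrightarrow> F (x + y) = F x + F y"
  and lin_on_smul: "lin_on X Y F \<Longrightarrow> x \<in> carr X \<Longrightarrow> F (smul X c x) = smul Y c (F x)"
  by (simp_all add: lin_on_def)

lemma lin_on_0: "semi_ip_space X \<Longrightarrow> semi_ip_space Y \<Longrightarrow> lin_on X Y F \<Longrightarrow> F 0 = 0"
  using lin_on_smul[of X Y F 0 0] by (simp add: smul_simps carr_0)

lemma lin_on_minus: "semi_ip_space X \<Longrightarrow> semi_ip_space Y \<Longrightarrow> lin_on X Y F \<Longrightarrow> x \<in> carr X \<Longrightarrow> F (- x) = - F x"
  using lin_on_smul[of X Y F x "-1"] by (simp add: smul_simps)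

lemma lin_on_diff: "semi_ip_space X \<Longrightarrow> semi_ip_space Y \<Longrightarrow> lin_on X Y F \<Longrightarrow> x \<in> carr X \<Longrightarrow> y \<in> carr X
    \<Longrightarrow> F (x - y) = F x - F y"
  using lin_on_add[of X Y F x "- y"] by (simp add: lin_on_minus carr_neg)

lemma BL_iff: "F \<in> BL X Y \<longleftrightarrow> lin_on X Y F \<and> (\<exists>C. \<forall>x\<in>carr X. hnorm Y (F x) \<le> C * hnorm X x)"
  by (auto simp: BL_def lin_on_def)

lemma BL_I: "lin_on X Y F \<Longrightarrow> (\<And>x. x \<in> carr X \<Longrightarrow> hnorm Y (F x) \<le> C * hnorm X x) \<Longrightarrow> F \<in> BL X Y"
  by (auto simp: BL_iff)

lemma BL_lin: "F \<in> BL X Y \<Longrightarrow> lin_on X Y F" by (simp add: BL_iff)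

lemma BL_carr: "F \<in> BL X Y \<Longrightarrow> x \<in> carr X \<Longrightarrow> F x \<in> carr Y" by (auto simp: BL_iff intro: lin_on_carr)

lemma BL_bound:
  assumes "F \<in> BL X Y"
  obtains C where "C \<ge> 0" "\<And>x. x \<in> carr X \<Longrightarrow> hnorm Y (F x) \<le> C * hnorm X x"
proof -
  obtain C where C: "\<And>x. x \<in> carr X \<Longrightarrow> hnorm Y (F x) \<le> C * hnorm X x" using assms by (auto simp: BL_iff)
  have "hnorm Y (F x) \<le> \<bar>C\<bar> * hnorm X x" if "x \<in> carr X" for x
    by (rule order_trans[OF C[OF that] mult_right_mono]) auto
  then show thesis using that[of "\<bar>C\<bar>"] by simp
qed

lemma BL_eq_on_dense:
  assumes X: "inner_product_space X" and Y: "inner_product_space Y" and F: "F \<in> BL X Y" "F' \<in> BL X Y"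
    and D: "dense_in X D" and eq: "\<And>d. d \<in> D \<Longrightarrow> F d = F' d" and x: "x \<in> carr X"
  shows "F x = F' x"
proof -
  note S = ips_semi[OF X] ips_semi[OF Y]
  obtain C where C: "C \<ge> 0" "\<And>x. x \<in> carr X \<Longrightarrow> hnorm Y (F x) \<le> C * hnorm X x"
    using BL_bound[OF F(1)] by blast
  obtain C' where C': "C' \<ge> 0" "\<And>x. x \<in> carr X \<Longrightarrow> hnorm Y (F' x) \<le> C' * hnorm X x"
    using BL_bound[OF F(2)] by blast
  have "hnorm Y (F x - F' x) \<le> 0 + e" if e: "e > 0" for e
  proof -
    have "e / (C + C' + 1) > 0" using e C C' by simp
    then obtain d where d: "d \<in> D" "hnorm X (d - x) < e / (C + C' + 1)"
      using dense_inD[OF X D x] by blast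
    have dX: "d \<in> carr X" using d dense_in_sub[OF D] by blast
    have "F x - F' x = F' (d - x) - F (d - x)"
      using eq[OF d(1)] dX x by (simp add: lin_on_diff[OF S BL_lin] F)
    also have "hnorm Y \<dots> \<le> hnorm Y (F' (d - x)) + hnorm Y (F (d - x))"
      using dX x by (intro hnorm_triangle_diff[OF S(2)] BL_carr[OF F(1)] BL_carr[OF F(2)] carr_diff[OF S(1)])
    also have "\<dots> \<le> C' * hnorm X (d - x) + C * hnorm X (d - x)"
      using C C' dX x by (intro add_mono) (auto simp: carr_diff[OF S(1)])
    also have "\<dots> = (C + C') * hnorm X (d - x)" by (simp add: algebra_simps)
    also have "\<dots> \<le> (C + C' + 1) * hnorm X (d - x)" by (intro mult_right_mono) auto
    also have "\<dots> \<le> (C + C' + 1) * (e / (C + C' + 1))" using d C C' by (intro mult_left_mono) auto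
    also have "\<dots> = e" using C C' by simp
    finally show ?thesis by simp
  qed
  then have "hnorm Y (F x - F' x) \<le> 0" by (rule field_le_epsilon)
  then have "hnorm Y (F x - F' x) = 0" by (simp add: order_antisym)
  then show ?thesis
    using hnorm_eq_0[OF Y carr_diff[OF S(2)]] F x by (auto dest: BL_carr)
qed

lemma BL_comp:
  assumes "F \<in> BL X Y" "F' \<in> BL Y Z"
  shows "(\<lambda>x. F' (F x)) \<in> BL X Z"
proof -
  obtain C where C: "C \<ge> 0" "\<And>x. x \<in> carr X \<Longrightarrow> hnorm Y (F x) \<le> C * hnorm X x" using BL_bound[OF assms(1)] by blast
  obtain C' where C': "C' \<ge> 0" "\<And>x. x \<in> carr Y \<Longrightarrow> hnorm Z (F' x) \<le> C' * hnorm Y x" using BL_bound[OF assms(2)] by blast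
  note L = BL_lin[OF assms(1)] BL_lin[OF assms(2)]
  show ?thesis
  proof (rule BL_I[where C = "C' * C"])
    show "lin_on X Z (\<lambda>x. F' (F x))"
      by (rule lin_onI) (simp_all add: lin_on_carr[OF L(1)] lin_on_carr[OF L(2)] lin_on_add[OF L(1)]
        lin_on_add[OF L(2)] lin_on_smul[OF L(1)] lin_on_smul[OF L(2)])
    fix x assume x: "x \<in> carr X"
    have "hnorm Z (F' (F x)) \<le> C' * hnorm Y (F x)" using C'(2) lin_on_carr[OF L(1) x] by simp
    also have "\<dots> \<le> C' * (C * hnorm X x)" using C C' x by (intro mult_left_mono) auto
    finally show "hnorm Z (F' (F x)) \<le> C' * C * hnorm X x" by (simp add: mult.assoc)
  qed
qed

lemma BL_id: "(\<lambda>x. x) \<in> BL X X"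
  by (rule BL_I[where C = 1]) (simp_all add: lin_onI)

lemma BL_cong: "F \<in> BL X Y \<Longrightarrow> (\<And>x. x \<in> carr X \<Longrightarrow> F' x = F x) \<Longrightarrow> semi_ip_space X \<Longrightarrow> F' \<in> BL X Y"
  by (auto simp: BL_iff lin_on_def carr_add carr_smul)

lemma BL_add:
  assumes Y: "semi_ip_space Y" and F: "F \<in> BL X Y" "F' \<in> BL X Y"
  shows "(\<lambda>x. F x + F' x) \<in> BL X Y"
proof -
  obtain C where C: "C \<ge> 0" "\<And>x. x \<in> carr X \<Longrightarrow> hnorm Y (F x) \<le> C * hnorm X x" using BL_bound[OF F(1)] by blast
  obtain C' where C': "C' \<ge> 0" "\<And>x. x \<in> carr X \<Longrightarrow> hnorm Y (F' x) \<le> C' * hnorm X x" using BL_bound[OF F(2)] by blast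
  note L = BL_lin[OF F(1)] BL_lin[OF F(2)]
  show ?thesis
  proof (rule BL_I[where C = "C + C'"])
    show "lin_on X Y (\<lambda>x. F x + F' x)"
      by (rule lin_onI) (simp_all add: lin_on_carr[OF L(1)] lin_on_carr[OF L(2)] carr_add[OF Y]
        lin_on_add[OF L(1)] lin_on_add[OF L(2)] lin_on_smul[OF L(1)] lin_on_smul[OF L(2)] smul_add_right[OF Y] algebra_simps)
    fix x assume x: "x \<in> carr X"
    have "hnorm Y (F x + F' x) \<le> hnorm Y (F x) + hnorm Y (F' x)"
      using x lin_on_carr[OF L(1)] lin_on_carr[OF L(2)] by (intro hnorm_triangle[OF Y])
    also have "\<dots> \<le> (C + C') * hnorm X x" using C(2)[OF x] C'(2)[OF x] by (simp add: algebra_simps)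
    finally show "hnorm Y (F x + F' x) \<le> (C + C') * hnorm X x" .
  qed
qed

lemma BL_smul:
  assumes Y: "semi_ip_space Y" and F: "F \<in> BL X Y"
  shows "(\<lambda>x. smul Y c (F x)) \<in> BL X Y"
proof -
  obtain C where C: "C \<ge> 0" "\<And>x. x \<in> carr X \<Longrightarrow> hnorm Y (F x) \<le> C * hnorm X x" using BL_bound[OF F] by blast
  note L = BL_lin[OF F]
  show ?thesis
  proof (rule BL_I[where C = "norm c * C"])
    show "lin_on X Y (\<lambda>x. smul Y c (F x))"
      by (rule lin_onI) (simp_all add: lin_on_carr[OF L] carr_smul[OF Y] lin_on_add[OF L] lin_on_smul[OF L]
        smul_add_right[OF Y] smul_smul[OF Y] mult.commute)
    fix x assume x: "x \<in> carr X"
    have "norm c * hnorm Y (F x) \<le> norm c * (C * hnorm X x)" using C(2)[OF x] by (intro mult_left_mono) auto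
    then show "hnorm Y (smul Y c (F x)) \<le> norm c * C * hnorm X x"
      using x by (simp add: hnorm_smul[OF Y] lin_on_carr[OF L] mult.assoc)
  qed
qed

lemma BL_minus:
  assumes "semi_ip_space Y" "F \<in> BL X Y"
  shows "(\<lambda>x. - F x) \<in> BL X Y"
  using BL_smul[OF assms, of "-1"] by (simp add: smul_simps[OF assms(1)])

lemma BL_diff:
  assumes "semi_ip_space Y" "F \<in> BL X Y" "F' \<in> BL X Y"
  shows "(\<lambda>x. F x - F' x) \<in> BL X Y"
  using BL_add[OF assms(1,2) BL_minus[OF assms(1,3)]] by simp

section \<open>Adjoints and bounded extensions\<close>

text \<open>
  Here f is regarded as an operator from X to Y which is defined on the dense subspace e(U). Its
  adjoint exists by the representation theorem on subspaces. Both the adjoint of a bounded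
  operator (e the identity) and the bounded extension of a densely defined one (adjoint of the
  adjoint) are obtained from it.
\<close>

theorem densely_defined_adjoint:
  assumes U: "semi_ip_space U" and X: "hilbert X" and Y: "semi_ip_space Y"
    and e: "lin_on U X e" and dense: "dense_in X (e ` carr U)" and f: "lin_on U Y f"
    and bd: "\<And>d. d \<in> carr U \<Longrightarrow> hnorm Y (f d) \<le> C * hnorm X (e d)"
  obtains T where "T \<in> BL Y X"
    "\<And>d y. d \<in> carr U \<Longrightarrow> y \<in> carr Y \<Longrightarrow> ip Y (f d) y = ip X (e d) (T y)"
proof -
  note S = hilbert_semi[OF X]
  note cs = carr_simps[OF U] carr_simps[OF S] carr_simps[OF Y] lin_on_carr[OF e] lin_on_carr[OF f]
  have bd': "hnorm Y (f d) \<le> \<bar>C\<bar> * hnorm X (e d)" if "d \<in> carr U" for d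
    by (rule order_trans[OF bd[OF that] mult_right_mono]) auto
  have pair_bd: "norm (ip Y y (f d)) \<le> \<bar>C\<bar> * hnorm Y y * hnorm X (e d)"
    if "y \<in> carr Y" "d \<in> carr U" for y d
  proof -
    have "norm (ip Y y (f d)) \<le> hnorm Y y * hnorm Y (f d)" using that by (simp add: cauchy_schwarz[OF Y] cs)
    also have "\<dots> \<le> hnorm Y y * (\<bar>C\<bar> * hnorm X (e d))" using bd'[OF that(2)] by (intro mult_left_mono) auto
    finally show ?thesis by (simp add: mult_ac)
  qed
  have "\<exists>z\<in>carr X. \<forall>d\<in>carr U. ip Y y (f d) = ip X z (e d)" if y: "y \<in> carr Y" for y
  proof -
    let ?F = "\<lambda>v. ip Y y (f (inv_into (carr U) e v))"
    \<comment> \<open>The functional does not depend on the chosen preimage: the bound makes it vanish on the kernel of e.\<close>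
    have F: "?F (e d) = ip Y y (f d)" if d: "d \<in> carr U" for d
    proof -
      let ?d = "inv_into (carr U) e (e d)"
      have d': "?d \<in> carr U" "e ?d = e d" using d by (auto intro: inv_into_into f_inv_into_f)
      have "norm (ip Y y (f (?d - d))) \<le> \<bar>C\<bar> * hnorm Y y * hnorm X (e (?d - d))"
        using y d d' by (intro pair_bd) (simp_all add: cs)
      then have "ip Y y (f (?d - d)) = 0"
        using d d' by (simp add: lin_on_diff[OF U S e] hnorm_0[OF S])
      then show ?thesis using y d d' by (simp add: lin_on_diff[OF U Y f] ip_simps[OF Y] cs)
    qed
    show ?thesis
    proof (rule riesz_on_subspace[OF X, where D = "e ` carr U" and f = ?F and C = "\<bar>C\<bar> * hnorm Y y"])
      fix v assume "v \<in> e ` carr U"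
      then obtain d where d: "d \<in> carr U" "v = e d" by blast
      show "norm (?F v) \<le> \<bar>C\<bar> * hnorm Y y * hnorm X v" using pair_bd[OF y d(1)] F[OF d(1)] d(2) by simp
      show "smul X c v \<in> e ` carr U" for c using d by (auto simp: lin_on_smul[OF e, symmetric] cs)
      show "?F (smul X c v) = c * ?F v" for c
        using d F[of "smul U c d"] F[OF d(1)] y by (simp add: cs lin_on_smul[OF e] lin_on_smul[OF f] ip_simps[OF Y])
      fix v' assume "v' \<in> e ` carr U"
      then obtain d' where d': "d' \<in> carr U" "v' = e d'" by blast
      show "v + v' \<in> e ` carr U" using d d' by (auto simp: lin_on_add[OF e, symmetric] cs)
      show "?F (v + v') = ?F v + ?F v'"
        using d d' F[of "d + d'"] F[OF d(1)] F[OF d'(1)] y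
        by (simp add: cs lin_on_add[OF e] lin_on_add[OF f] ip_simps[OF Y])
    next
      fix z assume "z \<in> carr X" "\<And>v. v \<in> e ` carr U \<Longrightarrow> ?F v = ip X z v"
      then show ?thesis using F by (intro bexI[of _ z]) auto
    qed (use cs in auto)
  qed
  then obtain T where T: "\<And>y. y \<in> carr Y \<Longrightarrow> T y \<in> carr X"
      "\<And>y d. y \<in> carr Y \<Longrightarrow> d \<in> carr U \<Longrightarrow> ip Y y (f d) = ip X (T y) (e d)" by metis
  have eq: "ip Y (f d) y = ip X (e d) (T y)" if "d \<in> carr U" "y \<in> carr Y" for d y
    using arg_cong[OF T(2)[OF that(2,1)], of kconj] that T(1) by (simp add: ip_conj[OF S] ip_conj[OF Y] cs)
  have unique: "u = v" if "u \<in> carr X" "v \<in> carr X" "\<And>d. d \<in> carr U \<Longrightarrow> ip X (e d) u = ip X (e d) v" for u v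
  proof -
    have "u - v = 0"
      by (rule dense_orthogonal[OF hilbert_ips[OF X] dense]) (use that in \<open>auto simp: ip_simps[OF S] cs\<close>)
    then show ?thesis by simp
  qed
  have "lin_on Y X T"
  proof (rule lin_onI)
    show "T (x + y) = T x + T y" if "x \<in> carr Y" "y \<in> carr Y" for x y
      by (rule unique) (use that T(1) in \<open>simp_all add: cs ip_simps[OF S] eq[symmetric] ip_simps[OF Y]\<close>)
    show "T (smul Y c x) = smul X c (T x)" if "x \<in> carr Y" for x c
      by (rule unique) (use that T(1) in \<open>simp_all add: cs ip_simps[OF S] eq[symmetric] ip_simps[OF Y]\<close>)
  qed (rule T(1))
  moreover have "hnorm X (T y) \<le> \<bar>C\<bar> * hnorm Y y" if y: "y \<in> carr Y" for y
  proof (rule norm_le_if_dense[OF hilbert_ips[OF X] dense T(1)[OF y]])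
    show "norm (ip X (T y) u) \<le> \<bar>C\<bar> * hnorm Y y * hnorm X u" if "u \<in> e ` carr U" for u
      using that pair_bd[OF y] T(2)[OF y] by auto
  qed simp
  ultimately have "T \<in> BL Y X" by (rule BL_I)
  then show thesis using that eq by blast
qed

lemma dense_in_carr:
  assumes "inner_product_space X"
  shows "dense_in X ((\<lambda>x. x) ` carr X)"
proof -
  have "\<exists>d\<in>carr X. hnorm X (d - x) < e" if "x \<in> carr X" "e > 0" for x e
    using that hnorm_0[OF ips_semi[OF assms]] by (intro bexI[of _ x]) simp_all
  then show ?thesis by (simp add: dense_in_iff[OF assms])
qed

theorem bdd_adj_props:
  assumes X: "hilbert X" and Y: "semi_ip_space Y" and F: "F \<in> BL X Y"
  shows "bdd_adj X Y F \<in> BL Y X"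
    "\<And>x y. x \<in> carr X \<Longrightarrow> y \<in> carr Y \<Longrightarrow> ip Y (F x) y = ip X x (bdd_adj X Y F y)"
proof -
  obtain C where C: "\<And>x. x \<in> carr X \<Longrightarrow> hnorm Y (F x) \<le> C * hnorm X x" using BL_bound[OF F] by blast
  obtain S where "S \<in> BL Y X" "\<And>x y. x \<in> carr X \<Longrightarrow> y \<in> carr Y \<Longrightarrow> ip Y (F x) y = ip X x (S y)"
    using densely_defined_adjoint[OF hilbert_semi[OF X] X Y BL_lin[OF BL_id] dense_in_carr[OF hilbert_ips[OF X]]
      BL_lin[OF F] C] by blast
  then have "\<exists>S. S \<in> BL Y X \<and> (\<forall>x\<in>carr X. \<forall>y\<in>carr Y. ip Y (F x) y = ip X x (S y))" by blast
  from someI_ex[OF this]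
  show "bdd_adj X Y F \<in> BL Y X"
    "\<And>x y. x \<in> carr X \<Longrightarrow> y \<in> carr Y \<Longrightarrow> ip Y (F x) y = ip X x (bdd_adj X Y F y)"
    unfolding bdd_adj_def by blast+
qed

theorem bdd_ext_props:
  assumes U: "semi_ip_space U" and X: "hilbert X" and Y: "hilbert Y"
    and e: "lin_on U X e" and dense: "dense_in X (e ` carr U)" and f: "lin_on U Y f"
    and bd: "\<And>d. d \<in> carr U \<Longrightarrow> hnorm Y (f d) \<le> C * hnorm X (e d)"
  shows "bdd_ext X Y e (carr U) f \<in> BL X Y" "\<And>d. d \<in> carr U \<Longrightarrow> bdd_ext X Y e (carr U) f (e d) = f d"
proof -
  note S = hilbert_semi[OF X] hilbert_semi[OF Y]
  obtain T where T: "T \<in> BL Y X" "\<And>d y. d \<in> carr U \<Longrightarrow> y \<in> carr Y \<Longrightarrow> ip Y (f d) y = ip X (e d) (T y)"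
    using densely_defined_adjoint[OF U X S(2) e dense f bd] by blast
  let ?F = "bdd_adj Y X T"
  note F = bdd_adj_props[OF Y S(1) T(1)]
  have "?F (e d) = f d" if d: "d \<in> carr U" for d
  proof -
    have c: "e d \<in> carr X" "f d \<in> carr Y" "?F (e d) \<in> carr Y"
      using d lin_on_carr[OF e] lin_on_carr[OF f] BL_carr[OF F(1)] by auto
    have "ip Y y (?F (e d) - f d) = 0" if y: "y \<in> carr Y" for y
      using F(2)[OF y c(1)] arg_cong[OF T(2)[OF d y], of kconj] y c BL_carr[OF T(1) y]
      by (simp add: ip_simps[OF S(2)] ip_conj[OF S(1)] ip_conj[OF S(2)])
    then have "?F (e d) - f d = 0"
      by (rule ip_all_0[OF hilbert_ips[OF Y] carr_diff[OF S(2) c(3,2)]])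
    then show ?thesis by simp
  qed
  then have "\<exists>F. F \<in> BL X Y \<and> (\<forall>d\<in>carr U. F (e d) = f d)" using F(1) by blast
  from someI_ex[OF this] show "bdd_ext X Y e (carr U) f \<in> BL X Y"
    "\<And>d. d \<in> carr U \<Longrightarrow> bdd_ext X Y e (carr U) f (e d) = f d"
    unfolding bdd_ext_def by blast+
qed

text \<open>
  If the inner product of U is that of X pulled back along a map f with dense range, then the
  completion of U is X itself. The inverse of the extension V is its adjoint W: the equation
  W V = 1 holds on the dense subspace e(U), and V W x - x is orthogonal to the range of f. This is
  applied to Bbar and to the extensions of the square roots to the negative order spaces.
\<close>

theorem completion_unitary:
  assumes c: "is_completion U Y e" and X: "hilbert X" and f: "lin_on U X f"
    and iso: "\<And>x y. x \<in> carr U \<Longrightarrow> y \<in> carr U \<Longrightarrow> ip X (f x) (f y) = ip U x y"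
    and dense: "\<And>x. x \<in> carr X \<Longrightarrow> (\<And>d. d \<in> carr U \<Longrightarrow> ip X (f d) x = 0) \<Longrightarrow> x = 0"
  defines "V \<equiv> bdd_ext Y X e (carr U) f"
  shows "V \<in> BL Y X" "\<And>d. d \<in> carr U \<Longrightarrow> V (e d) = f d"
    "\<And>y y'. y \<in> carr Y \<Longrightarrow> y' \<in> carr Y \<Longrightarrow> ip X (V y) (V y') = ip Y y y'"
    "bij_betw V (carr Y) (carr X)"
proof -
  have U: "inner_product_space U" and Y: "hilbert Y" and eB: "e \<in> BL U Y"
    and ei: "\<And>x y. x \<in> carr U \<Longrightarrow> y \<in> carr U \<Longrightarrow> ip Y (e x) (e y) = ip U x y"
    and ed: "dense_in Y (e ` carr U)"
    using c unfolding is_completion_def by blast+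
  note SU = ips_semi[OF U] and SY = hilbert_semi[OF Y] and SX = hilbert_semi[OF X]
  note e = BL_lin[OF eB]
  have n: "hnorm X (f d) \<le> 1 * hnorm Y (e d)" if "d \<in> carr U" for d
    using that by (simp add: hnorm_def iso ei)
  note ext = bdd_ext_props[OF SU Y X e ed f n, folded V_def]
  show V: "V \<in> BL Y X" and Ve: "\<And>d. d \<in> carr U \<Longrightarrow> V (e d) = f d" using ext by blast+
  note Vc = BL_carr[OF V]
  define W where "W = bdd_adj Y X V"
  have WB: "W \<in> BL X Y" and adj: "\<And>y x. y \<in> carr Y \<Longrightarrow> x \<in> carr X \<Longrightarrow> ip X (V y) x = ip Y y (W x)"
    using bdd_adj_props[OF Y SX V] unfolding W_def by blast+
  note Wc = BL_carr[OF WB]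
  have WV: "W (V y) = y" if y: "y \<in> carr Y" for y
  proof (rule BL_eq_on_dense[OF hilbert_ips[OF Y] hilbert_ips[OF Y] BL_comp[OF V WB] BL_id ed _ y])
    fix d assume "d \<in> e ` carr U"
    then obtain u where u: "u \<in> carr U" "d = e u" by blast
    have "W (V (e u)) - e u = 0"
    proof (rule dense_orthogonal[OF hilbert_ips[OF Y] ed])
      show "W (V (e u)) - e u \<in> carr Y" using u by (simp add: carr_diff[OF SY] Wc Vc lin_on_carr[OF e])
      fix d' assume "d' \<in> e ` carr U"
      then obtain u' where u': "u' \<in> carr U" "d' = e u'" by blast
      show "ip Y d' (W (V (e u)) - e u) = 0"
        using u u' by (simp add: ip_simps[OF SY] Wc Vc lin_on_carr[OF e] adj[symmetric] Ve iso ei lin_on_carr[OF f])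
    qed
    then show "W (V d) = d" using u by simp
  qed
  show iso: "ip X (V y) (V y') = ip Y y y'" if "y \<in> carr Y" "y' \<in> carr Y" for y y'
    using that by (simp add: adj Vc WV)
  have VW: "V (W x) = x" if x: "x \<in> carr X" for x
  proof -
    have "V (W x) - x = 0"
    proof (rule dense)
      show "V (W x) - x \<in> carr X" using x by (simp add: carr_diff[OF SX] Wc Vc)
      fix d assume d: "d \<in> carr U"
      show "ip X (f d) (V (W x) - x) = 0"
        using d x by (simp add: Ve[symmetric] ip_simps[OF SX] Wc Vc lin_on_carr[OF e] adj WV)
    qed
    then show ?thesis by simp
  qed
  show "bij_betw V (carr Y) (carr X)"
    by (rule bij_betw_byWitness[where f' = W]) (auto simp: WV VW Wc Vc)
qed

lemma isometry_inverse_BL: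
  assumes Y: "hilbert Y" and X: "semi_ip_space X" and V: "V \<in> BL Y X"
    and iso: "\<And>y y'. y \<in> carr Y \<Longrightarrow> y' \<in> carr Y \<Longrightarrow> ip X (V y) (V y') = ip Y y y'"
    and bij: "bij_betw V (carr Y) (carr X)"
  shows "inv_into (carr Y) V \<in> BL X Y"
proof -
  note S = hilbert_semi[OF Y] and L = BL_lin[OF V]
  have I: "inv_into (carr Y) V x \<in> carr Y" "V (inv_into (carr Y) V x) = x" if "x \<in> carr X" for x
    using that bij by (metis bij_betw_imp_surj_on inv_into_into f_inv_into_f)+
  have uni: "inv_into (carr Y) V x = y" if "y \<in> carr Y" "V y = x" for x y
    using that bij by (metis bij_betw_imp_inj_on inv_into_f_f)
  show ?thesis
  proof (rule BL_I[of _ _ _ 1])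
    show "lin_on X Y (inv_into (carr Y) V)"
    proof (rule lin_onI)
      show "inv_into (carr Y) V (x + y) = inv_into (carr Y) V x + inv_into (carr Y) V y"
        if "x \<in> carr X" "y \<in> carr X" for x y
        using that by (intro uni) (simp_all add: I carr_simps[OF S] lin_on_add[OF L])
      show "inv_into (carr Y) V (smul X c x) = smul Y c (inv_into (carr Y) V x)" if "x \<in> carr X" for x c
        using that by (intro uni) (simp_all add: I carr_simps[OF S] lin_on_smul[OF L])
    qed (rule I)
    fix x assume x: "x \<in> carr X"
    show "hnorm Y (inv_into (carr Y) V x) \<le> 1 * hnorm X x"
      using iso[OF I(1)[OF x] I(1)[OF x]] x by (simp add: hnorm_def I)
  qed
qed

section \<open>Direct sums\<close>

lemma dsum_simps [simp]:
  "carr (X \<oplus>\<^sub>H Y) = carr X \<times> carr Y" "smul (X \<oplus>\<^sub>H Y) c (x, y) = (smul X c x, smul Y c y)"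
  "ip (X \<oplus>\<^sub>H Y) (x, y) (x', y') = ip X x x' + ip Y y y'"
  by (simp_all add: dsum_def)

lemma dsum_vs:
  assumes "vector_space (smul X)" "vector_space (smul Y)"
  shows "vector_space (smul (X \<oplus>\<^sub>H Y))"
proof -
  note X = vector_space.vector_space_assms[OF assms(1)] and Y = vector_space.vector_space_assms[OF assms(2)]
  show ?thesis by unfold_locales (auto simp: X Y)
qed

lemma module_subspace_iff:
  "vector_space s \<Longrightarrow> module.subspace s T \<longleftrightarrow> 0 \<in> T \<and> (\<forall>x\<in>T. \<forall>y\<in>T. x + y \<in> T) \<and> (\<forall>c. \<forall>x\<in>T. s c x \<in> T)"
  by (simp add: module.subspace_def module_iff_vector_space)

lemma dsum_ips:
  assumes X: "inner_product_space X" and Y: "inner_product_space Y"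
  shows "inner_product_space (X \<oplus>\<^sub>H Y)"
proof (rule inner_product_spaceI)
  note S = ips_semi[OF X] ips_semi[OF Y]
  show V: "vector_space (smul (X \<oplus>\<^sub>H Y))" by (rule dsum_vs[OF semi_vs[OF S(1)] semi_vs[OF S(2)]])
  show "module.subspace (smul (X \<oplus>\<^sub>H Y)) (carr (X \<oplus>\<^sub>H Y))"
    unfolding module_subspace_iff[OF V] by (auto simp: carr_simps[OF S(1)] carr_simps[OF S(2)] zero_prod_def)
  fix x y z c assume x: "x \<in> carr (X \<oplus>\<^sub>H Y)"
  {
    assume y: "y \<in> carr (X \<oplus>\<^sub>H Y)" and z: "z \<in> carr (X \<oplus>\<^sub>H Y)"
    show "ip (X \<oplus>\<^sub>H Y) x (y + z) = ip (X \<oplus>\<^sub>H Y) x y + ip (X \<oplus>\<^sub>H Y) x z"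
      using x y z by (auto simp: ip_simps[OF S(1)] ip_simps[OF S(2)])
  next
    assume y: "y \<in> carr (X \<oplus>\<^sub>H Y)"
    show "ip (X \<oplus>\<^sub>H Y) x (smul (X \<oplus>\<^sub>H Y) c y) = c * ip (X \<oplus>\<^sub>H Y) x y"
      using x y by (auto simp: ip_simps[OF S(1)] ip_simps[OF S(2)] algebra_simps)
    show "kconj (ip (X \<oplus>\<^sub>H Y) x y) = ip (X \<oplus>\<^sub>H Y) y x"
      using x y by (auto simp: ip_conj[OF S(1)] ip_conj[OF S(2)] kconj_add)
  }
  obtain a b where ab: "x = (a, b)" "a \<in> carr X" "b \<in> carr Y" using x by auto
  have s: "ip (X \<oplus>\<^sub>H Y) x x = of_real ((hnorm X a)\<^sup>2 + (hnorm Y b)\<^sup>2)"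
    using ab by (simp add: ip_self[OF S(1)] ip_self[OF S(2)])
  then show "\<exists>r\<ge>0. ip (X \<oplus>\<^sub>H Y) x x = of_real r" by (metis sum_power2_ge_zero)
  assume "ip (X \<oplus>\<^sub>H Y) x x = 0"
  then have "(hnorm X a)\<^sup>2 + (hnorm Y b)\<^sup>2 = 0" unfolding s by (simp only: of_real_eq_0_iff)
  then have "hnorm X a = 0" "hnorm Y b = 0" by simp_all
  then show "x = 0" using ab by (simp add: hnorm_eq_0[OF X] hnorm_eq_0[OF Y] zero_prod_def)
qed

lemma hnorm_dsum:
  assumes "semi_ip_space X" "semi_ip_space Y" "x \<in> carr X" "y \<in> carr Y"
  shows "(hnorm (X \<oplus>\<^sub>H Y) (x, y))\<^sup>2 = (hnorm X x)\<^sup>2 + (hnorm Y y)\<^sup>2"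
proof -
  have "ip (X \<oplus>\<^sub>H Y) (x, y) (x, y) = of_real ((hnorm X x)\<^sup>2 + (hnorm Y y)\<^sup>2)"
    using assms by (simp add: ip_self)
  then have "hnorm (X \<oplus>\<^sub>H Y) (x, y) = sqrt ((hnorm X x)\<^sup>2 + (hnorm Y y)\<^sup>2)"
    by (simp only: hnorm_def[of "X \<oplus>\<^sub>H Y"] norm_of_real) simp
  then show ?thesis by simp
qed

lemma hnorm_dsum_bounds:
  assumes "semi_ip_space X" "semi_ip_space Y" "x \<in> carr X" "y \<in> carr Y"
  shows "hnorm X x \<le> hnorm (X \<oplus>\<^sub>H Y) (x, y)" "hnorm Y y \<le> hnorm (X \<oplus>\<^sub>H Y) (x, y)"
    "hnorm (X \<oplus>\<^sub>H Y) (x, y) \<le> hnorm X x + hnorm Y y"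
proof -
  note e = hnorm_dsum[OF assms]
  show "hnorm X x \<le> hnorm (X \<oplus>\<^sub>H Y) (x, y)" "hnorm Y y \<le> hnorm (X \<oplus>\<^sub>H Y) (x, y)"
    by (rule power2_le_imp_le; simp add: e)+
  show "hnorm (X \<oplus>\<^sub>H Y) (x, y) \<le> hnorm X x + hnorm Y y"
    by (rule power2_le_imp_le) (simp_all add: e power2_sum)
qed

lemma dsum_hilbert:
  assumes X: "hilbert X" and Y: "hilbert Y"
  shows "hilbert (X \<oplus>\<^sub>H Y)"
  unfolding hilbert_iff
proof (intro conjI allI impI dsum_ips hilbert_ips X Y)
  note S = hilbert_semi[OF X] hilbert_semi[OF Y]
  fix s assume s: "cauchy_in (X \<oplus>\<^sub>H Y) s"
  define a b where "a n = fst (s n)" and "b n = snd (s n)" for n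
  have sab: "s n = (a n, b n)" for n by (simp add: a_def b_def)
  have carr: "a n \<in> carr X" "b n \<in> carr Y" for n
    using s unfolding cauchy_in_def sab by auto
  have d: "hnorm X (a m - a n) \<le> hnorm (X \<oplus>\<^sub>H Y) (s m - s n)"
    "hnorm Y (b m - b n) \<le> hnorm (X \<oplus>\<^sub>H Y) (s m - s n)" for m n
    unfolding sab using carr by (auto intro!: hnorm_dsum_bounds[OF S] simp: carr_diff[OF S(1)] carr_diff[OF S(2)])
  have "cauchy_in X a" "cauchy_in Y b"
    using s carr d unfolding cauchy_in_def by (meson le_less_trans)+
  then obtain x y where x: "x \<in> carr X" "(\<lambda>n. hnorm X (a n - x)) \<longlonglongrightarrow> 0"
    and y: "y \<in> carr Y" "(\<lambda>n. hnorm Y (b n - y)) \<longlonglongrightarrow> 0"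
    by (metis hilbertD[OF X] hilbertD[OF Y])
  have "(\<lambda>n. hnorm X (a n - x) + hnorm Y (b n - y)) \<longlonglongrightarrow> 0"
    using tendsto_add[OF x(2) y(2)] by simp
  then have "(\<lambda>n. hnorm (X \<oplus>\<^sub>H Y) (s n - (x, y))) \<longlonglongrightarrow> 0"
    by (rule Lim_null_comparison[rotated])
      (use carr x y hnorm_dsum_bounds(3)[OF S] in \<open>auto simp: sab carr_diff[OF S(1)] carr_diff[OF S(2)]\<close>)
  then show "\<exists>x\<in>carr (X \<oplus>\<^sub>H Y). (\<lambda>n. hnorm (X \<oplus>\<^sub>H Y) (s n - x)) \<longlonglongrightarrow> 0"
    using x y by (intro bexI[of _ "(x, y)"]) auto
qed

lemma BL_fst: "semi_ip_space X \<Longrightarrow> semi_ip_space Y \<Longrightarrow> fst \<in> BL (X \<oplus>\<^sub>H Y) X"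
  by (rule BL_I[of _ _ _ 1]) (auto simp: lin_on_def hnorm_dsum_bounds)

lemma BL_snd: "semi_ip_space X \<Longrightarrow> semi_ip_space Y \<Longrightarrow> snd \<in> BL (X \<oplus>\<^sub>H Y) Y"
  by (rule BL_I[of _ _ _ 1]) (auto simp: lin_on_def hnorm_dsum_bounds)

lemma BL_Pair:
  assumes X: "semi_ip_space X" and Y: "semi_ip_space Y" and F: "F \<in> BL Z X" "F' \<in> BL Z Y"
  shows "(\<lambda>z. (F z, F' z)) \<in> BL Z (X \<oplus>\<^sub>H Y)"
proof -
  obtain C where C: "C \<ge> 0" "\<And>x. x \<in> carr Z \<Longrightarrow> hnorm X (F x) \<le> C * hnorm Z x" using BL_bound[OF F(1)] by blast
  obtain C' where C': "C' \<ge> 0" "\<And>x. x \<in> carr Z \<Longrightarrow> hnorm Y (F' x) \<le> C' * hnorm Z x" using BL_bound[OF F(2)] by blast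
  note L = BL_lin[OF F(1)] BL_lin[OF F(2)]
  show ?thesis
  proof (rule BL_I[where C = "C + C'"])
    show "lin_on Z (X \<oplus>\<^sub>H Y) (\<lambda>z. (F z, F' z))"
      by (rule lin_onI) (simp_all add: lin_on_carr[OF L(1)] lin_on_carr[OF L(2)]
        lin_on_add[OF L(1)] lin_on_add[OF L(2)] lin_on_smul[OF L(1)] lin_on_smul[OF L(2)])
    fix x assume x: "x \<in> carr Z"
    have "hnorm (X \<oplus>\<^sub>H Y) (F x, F' x) \<le> hnorm X (F x) + hnorm Y (F' x)"
      using hnorm_dsum_bounds(3)[OF X Y lin_on_carr[OF L(1) x] lin_on_carr[OF L(2) x]] .
    also have "\<dots> \<le> (C + C') * hnorm Z x" using C(2)[OF x] C'(2)[OF x] by (simp add: algebra_simps)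
    finally show "hnorm (X \<oplus>\<^sub>H Y) (F x, F' x) \<le> (C + C') * hnorm Z x" .
  qed
qed

section \<open>Uniform boundedness and coercive operators\<close>

text \<open>
  The principle of uniform boundedness, by the category theorem: one of the closed sets
  F n of all y with |<z, y>| \<le> n for all z in Z contains a ball.
\<close>

theorem weakly_bounded_imp_bounded:
  assumes X: "hilbert X" and Z: "Z \<subseteq> carr X"
    and wb: "\<And>y. y \<in> carr X \<Longrightarrow> \<exists>K. \<forall>z\<in>Z. norm (ip X z y) \<le> K"
  shows "\<exists>K. \<forall>z\<in>Z. hnorm X z \<le> K"
proof -
  note S = hilbert_semi[OF X]
  interpret Metric_space "carr X" "hdist X" by (rule ips_metric[OF hilbert_ips[OF X]])
  have complete: "mcomplete" using X by (simp add: hilbert_def)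
  define F where "F n = {y \<in> carr X. \<forall>z\<in>Z. norm (ip X z y) \<le> real n}" for n
  have dist: "hdist X x y = hnorm X (x - y)" if "x \<in> carr X" "y \<in> carr X" for x y
    using that by (simp add: hdist_def)
  have closed: "closedin mtopology (F n)" for n
  proof -
    have "x \<in> F n" if x: "x \<in> mtopology closure_of F n" for x
    proof -
      from x have xX: "x \<in> carr X" and near: "\<And>r. r > 0 \<Longrightarrow> \<exists>y\<in>F n. y \<in> mball x r"
        by (auto simp: metric_closure_of)
      have "norm (ip X z x) \<le> real n" if z: "z \<in> Z" for z
      proof (rule field_le_epsilon)
        fix e :: real assume e: "e > 0"
        have zX: "z \<in> carr X" using z Z by blast
        have "e / (hnorm X z + 1) > 0" using e by (simp add: add_nonneg_pos)
        then obtain y where y: "y \<in> F n" "y \<in> mball x (e / (hnorm X z + 1))" using near by blast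
        then have yX: "y \<in> carr X" and d: "hnorm X (x - y) < e / (hnorm X z + 1)"
          using xX dist by (auto simp: F_def in_mball)
        have "ip X z x = ip X z y + ip X z (x - y)" using zX xX yX by (simp add: ip_simps[OF S])
        then have "norm (ip X z x) \<le> norm (ip X z y) + norm (ip X z (x - y))" by (simp add: norm_triangle_ineq)
        also have "\<dots> \<le> real n + hnorm X z * hnorm X (x - y)"
          using y(1) z by (intro add_mono cauchy_schwarz[OF S zX carr_diff[OF S xX yX]]) (auto simp: F_def)
        also have "\<dots> \<le> real n + (hnorm X z + 1) * hnorm X (x - y)"
          by (intro add_left_mono mult_right_mono) auto
        also have "\<dots> \<le> real n + (hnorm X z + 1) * (e / (hnorm X z + 1))"
          using d by (intro add_left_mono mult_left_mono) auto
        also have "\<dots> = real n + e" using hnorm_ge_0[of X z] by (simp add: add_nonneg_eq_0_iff)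
        finally show "norm (ip X z x) \<le> real n + e" .
      qed
      then show ?thesis using xX by (simp add: F_def)
    qed
    moreover have "F n \<subseteq> topspace mtopology" by (auto simp: F_def)
    ultimately show ?thesis using closure_of_subset_eq by blast
  qed
  have "\<Union>(range F) = carr X"
  proof -
    have "y \<in> \<Union>(range F)" if y: "y \<in> carr X" for y
    proof -
      obtain K where K: "\<forall>z\<in>Z. norm (ip X z y) \<le> K" using wb[OF y] by blast
      obtain n where "K \<le> real n" using real_arch_simple by blast
      then have "y \<in> F n" using K y by (force simp: F_def)
      then show ?thesis by blast
    qed
    then show ?thesis by (auto simp: F_def)
  qed
  then have "mtopology interior_of \<Union>(range F) \<noteq> {}"
    using carr_0[OF S] by (metis empty_iff interior_of_topspace topspace_mtopology)
  then have "\<exists>n. mtopology interior_of F n \<noteq> {}"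
    using metric_Baire_category_alt[OF complete, of "range F"] closed by auto
  then obtain n where "mtopology interior_of F n \<noteq> {}" by blast
  then obtain y U where U: "openin mtopology U" "y \<in> U" "U \<subseteq> F n"
    by (auto simp: interior_of_def)
  then obtain r where r: "r > 0" "mball y r \<subseteq> F n" unfolding openin_mtopology by blast
  have yF: "y \<in> F n" using U by blast
  then have yX: "y \<in> carr X" by (simp add: F_def)
  have "hnorm X z \<le> 4 * real n / r" if z: "z \<in> Z" for z
  proof (cases "hnorm X z = 0")
    case False
    then have p: "hnorm X z > 0" by (simp add: less_le)
    have zX: "z \<in> carr X" using z Z by blast
    \<comment> \<open>The vector in the direction of z of length r / 2, so that y + v stays in the open ball.\<close>
    define v where "v = smul X (of_real (r / (2 * hnorm X z))) z"
    have vX: "v \<in> carr X" using zX by (simp add: v_def carr_simps[OF S])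
    have "hnorm X v = r / 2" using p r(1) zX by (simp add: v_def hnorm_smul[OF S] norm_divide norm_mult)
    then have "y + v \<in> mball y r" using yX vX r(1)
      by (simp add: in_mball carr_simps[OF S] dist hnorm_minus[OF S])
    then have "norm (ip X z (y + v)) \<le> real n" using r(2) z by (auto simp: F_def)
    moreover have "norm (ip X z y) \<le> real n" using yF z by (simp add: F_def)
    moreover have "ip X z v = ip X z (y + v) - ip X z y" using zX yX vX by (simp add: ip_simps[OF S])
    ultimately have "norm (ip X z v) \<le> 2 * real n"
      using norm_triangle_ineq4[of "ip X z (y + v)" "ip X z y"] by simp
    moreover have "norm (ip X z v) = r / 2 * hnorm X z"
      using p r(1) zX
      by (simp add: v_def ip_simps[OF S] ip_self[OF S] norm_mult norm_divide norm_power power2_eq_square)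
    ultimately show ?thesis using r(1) by (simp add: field_simps)
  qed (use r in simp)
  then show ?thesis by blast
qed

lemma positive_saD:
  assumes "positive_sa X P"
  shows "P \<in> BL X X" "\<And>x y. x \<in> carr X \<Longrightarrow> y \<in> carr X \<Longrightarrow> ip X (P x) y = ip X x (P y)"
    "\<And>x. x \<in> carr X \<Longrightarrow> \<exists>r\<ge>0. ip X (P x) x = of_real r"
  using assms unfolding positive_sa_def by blast+

definition form_space :: "('k::rc_scalar, 'v::ab_group_add) ip_space \<Rightarrow> ('v \<Rightarrow> 'v) \<Rightarrow> ('k, 'v) ip_space" where
  "form_space X P = X\<lparr>ip := (\<lambda>x y. ip X (P x) y)\<rparr>"

lemma form_space_simps [simp]: "carr (form_space X P) = carr X" "smul (form_space X P) = smul X"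
  "ip (form_space X P) x y = ip X (P x) y"
  by (simp_all add: form_space_def)

lemma form_space_semi:
  assumes X: "semi_ip_space X" and P: "positive_sa X P"
  shows "semi_ip_space (form_space X P)"
proof -
  have Pc: "P x \<in> carr X" if "x \<in> carr X" for x using BL_carr[OF positive_saD(1)[OF P] that] .
  have sym: "ip X (P y) x = kconj (ip X (P x) y)" if "x \<in> carr X" "y \<in> carr X" for x y
    using that Pc by (simp add: positive_saD(2)[OF P] ip_conj[OF X])
  show ?thesis unfolding semi_ip_space_def
  proof (intro conjI ballI allI)
    show "vector_space (smul (form_space X P))" "module.subspace (smul (form_space X P)) (carr (form_space X P))"
      using semi_vs[OF X] semi_subspace[OF X] by simp_all
    show "ip (form_space X P) y x = kconj (ip (form_space X P) x y)"
      if "x \<in> carr (form_space X P)" "y \<in> carr (form_space X P)" for x y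
      using sym[of x y] that by (simp only: form_space_simps)
    show "\<exists>r\<ge>0. ip (form_space X P) x x = of_real r" if "x \<in> carr (form_space X P)" for x
      using that positive_saD(3)[OF P] by simp
  qed (simp_all add: Pc ip_add_right[OF X] ip_smul_right[OF X])
qed

text \<open>
  The form of P is an equivalent inner product, and the Riesz representation for it solves
  P x = y.
\<close>

theorem coercive_bijection:
  assumes X: "hilbert X" and P: "positive_sa X P" and c: "c > 0"
    and co: "\<And>x. x \<in> carr X \<Longrightarrow> c * (hnorm X x)\<^sup>2 \<le> norm (ip X (P x) x)"
  shows "bij_betw P (carr X) (carr X)" "inv_into (carr X) P \<in> BL X X"
proof -
  note S = hilbert_semi[OF X]
  note PB = positive_saD(1)[OF P]
  note L = BL_lin[OF PB]
  obtain C where C: "C \<ge> 0" "\<And>x. x \<in> carr X \<Longrightarrow> hnorm X (P x) \<le> C * hnorm X x"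
    using BL_bound[OF PB] by blast
  let ?Y = "form_space X P"
  have nY: "(hnorm ?Y x)\<^sup>2 = norm (ip X (P x) x)" for x by (simp add: hnorm_def)
  have lower: "hnorm X x \<le> 1 / sqrt c * hnorm ?Y x" if "x \<in> carr X" for x
  proof -
    have "(hnorm X x)\<^sup>2 \<le> (1 / sqrt c * hnorm ?Y x)\<^sup>2"
      using co[OF that] c by (simp add: power_mult_distrib nY power_divide pos_le_divide_eq mult.commute)
    then show ?thesis by (rule power2_le_imp_le) (use c in auto)
  qed
  have upper: "hnorm ?Y x \<le> sqrt C * hnorm X x" if "x \<in> carr X" for x
  proof -
    have "norm (ip X (P x) x) \<le> hnorm X (P x) * hnorm X x"
      using that by (intro cauchy_schwarz[OF S]) (auto intro: BL_carr[OF PB])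
    also have "\<dots> \<le> C * hnorm X x * hnorm X x" using C that by (intro mult_right_mono) auto
    also have "\<dots> = (sqrt C * hnorm X x)\<^sup>2"
      using C(1) by (simp add: power_mult_distrib) (simp add: power2_eq_square)
    finally have "(hnorm ?Y x)\<^sup>2 \<le> (sqrt C * hnorm X x)\<^sup>2" by (simp only: nY)
    then show ?thesis by (rule power2_le_imp_le) (use C(1) in auto)
  qed
  have SY: "semi_ip_space ?Y" by (rule form_space_semi[OF S P])
  have "x = 0" if "x \<in> carr X" "ip X (P x) x = 0" for x
    using co[OF that(1)] that c hnorm_eq_0[OF hilbert_ips[OF X] that(1)]
    by (simp add: mult_le_0_iff)
  then have Y: "inner_product_space ?Y" using SY by (simp add: inner_product_space_iff_semi)
  have HY: "hilbert ?Y" by (rule hilbert_equiv[OF X Y _ lower upper]) simp_all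
  have surj: "\<exists>x\<in>carr X. P x = y" if y: "y \<in> carr X" for y
  proof (rule riesz_on_subspace[OF HY, where D = "carr X" and f = "\<lambda>x. ip X y x"
        and C = "hnorm X y * (1 / sqrt c)"])
    fix x assume x: "x \<in> carr X"
    have "norm (ip X y x) \<le> hnorm X y * hnorm X x" by (rule cauchy_schwarz[OF S y x])
    also have "\<dots> \<le> hnorm X y * (1 / sqrt c * hnorm ?Y x)" using lower[OF x] by (intro mult_left_mono) auto
    finally show "norm (ip X y x) \<le> hnorm X y * (1 / sqrt c) * hnorm ?Y x" by (simp only: mult.assoc)
  next
    fix z assume z: "z \<in> carr ?Y" and eq: "\<And>x. x \<in> carr X \<Longrightarrow> ip X y x = ip ?Y z x"
    have zX: "z \<in> carr X" and Pz: "P z \<in> carr X" using z BL_carr[OF PB] by auto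
    have "ip X (P z - y) x = 0" if "x \<in> carr X" for x
      using eq[OF that] that y Pz by (simp add: ip_simps[OF S])
    then have "P z - y = 0"
      by (intro ip_self_eq_0[OF hilbert_ips[OF X]]) (use y Pz carr_diff[OF S] in auto)
    then show ?thesis using zX by auto
  qed (use y in \<open>auto simp: carr_simps[OF S] ip_simps[OF S]\<close>)
  have lowP: "c * hnorm X x \<le> hnorm X (P x)" if x: "x \<in> carr X" for x
  proof (cases "hnorm X x = 0")
    case False
    have "c * (hnorm X x)\<^sup>2 \<le> hnorm X (P x) * hnorm X x"
      using co[OF x] cauchy_schwarz[OF S BL_carr[OF PB x] x] by linarith
    then show ?thesis using False by (simp add: power2_eq_square less_le)
  qed simp
  have inj: "inj_on P (carr X)"
  proof (rule inj_onI)
    fix x y assume xy: "x \<in> carr X" "y \<in> carr X" "P x = P y"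
    then have "P (x - y) = 0" by (simp add: lin_on_diff[OF S S L])
    then have "hnorm X (x - y) = 0"
      using lowP[of "x - y"] xy c by (simp add: carr_simps[OF S] hnorm_0[OF S] mult_le_0_iff order_antisym)
    then show "x = y" using hnorm_eq_0[OF hilbert_ips[OF X], of "x - y"] xy by (simp add: carr_simps[OF S])
  qed
  show bij: "bij_betw P (carr X) (carr X)"
    unfolding bij_betw_def using inj surj BL_carr[OF PB] by (auto simp: image_iff)
  let ?I = "inv_into (carr X) P"
  have I: "?I y \<in> carr X" "P (?I y) = y" if "y \<in> carr X" for y
    using that bij by (metis bij_betw_imp_surj_on inv_into_into f_inv_into_f)+
  have uni: "?I y = x" if "x \<in> carr X" "P x = y" for x y using that inj by (metis inv_into_f_f)
  show "?I \<in> BL X X"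
  proof (rule BL_I[of _ _ _ "1 / c"])
    show "lin_on X X ?I"
    proof (rule lin_onI)
      show "?I (x + y) = ?I x + ?I y" if "x \<in> carr X" "y \<in> carr X" for x y
        using that by (intro uni) (simp_all add: I carr_simps[OF S] lin_on_add[OF L])
      show "?I (smul X k x) = smul X k (?I x)" if "x \<in> carr X" for x k
        using that by (intro uni) (simp_all add: I carr_simps[OF S] lin_on_smul[OF L])
    qed (rule I)
    show "hnorm X (?I x) \<le> 1 / c * hnorm X x" if "x \<in> carr X" for x
      using lowP[OF I(1)[OF that]] I(2)[OF that] c by (simp add: field_simps)
  qed
qed

section \<open>Self-adjoint operators\<close>

locale selfadjoint_op =
  fixes X :: "('k::rc_scalar, 'v::ab_group_add) ip_space" and T :: "('v \<times> 'v) set"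
  assumes hilbert_X: "hilbert X" and sa: "selfadjoint X T"
begin

abbreviation "D \<equiv> Domain T"
abbreviation "t \<equiv> ap T"

lemmas I = hilbert_ips[OF hilbert_X]
lemmas S = hilbert_semi[OF hilbert_X]

lemma T_carr: "(x, y) \<in> T \<Longrightarrow> x \<in> carr X" "(x, y) \<in> T \<Longrightarrow> y \<in> carr X"
  using sa by (auto simp: selfadjoint_def lin_op_def)

lemma ap_eq: "(x, y) \<in> T \<Longrightarrow> t x = y"
  unfolding ap_def
  by (rule the_equality) (use sa in \<open>auto simp: selfadjoint_def lin_op_def dest: single_valuedD\<close>)

lemma D_graph: "x \<in> D \<Longrightarrow> (x, t x) \<in> T" using ap_eq by blast

lemma D_carr: "x \<in> D \<Longrightarrow> x \<in> carr X" using T_carr by blast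
lemma D_sub: "D \<subseteq> carr X" using D_carr by blast
lemma t_carr: "x \<in> D \<Longrightarrow> t x \<in> carr X" using D_graph T_carr by blast

lemma D_dense: "dense_in X D" using sa by (simp add: selfadjoint_def)

lemma graph_subspace: "0 \<in> T" "u \<in> T \<Longrightarrow> v \<in> T \<Longrightarrow> u + v \<in> T" "u \<in> T \<Longrightarrow> smul (X \<oplus>\<^sub>H X) c u \<in> T"
proof -
  have "module.subspace (smul (X \<oplus>\<^sub>H X)) T" using sa unfolding selfadjoint_def lin_op_def by blast
  then show "0 \<in> T" "u \<in> T \<Longrightarrow> v \<in> T \<Longrightarrow> u + v \<in> T" "u \<in> T \<Longrightarrow> smul (X \<oplus>\<^sub>H X) c u \<in> T"
    unfolding module_subspace_iff[OF dsum_vs[OF semi_vs[OF S] semi_vs[OF S]]] by blast+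
qed

lemma D_0: "0 \<in> D" and t_0: "t 0 = 0"
  using graph_subspace(1) ap_eq by (auto simp: zero_prod_def)
lemma add: assumes "x \<in> D" "y \<in> D" shows D_add: "x + y \<in> D" and t_add: "t (x + y) = t x + t y"
  using graph_subspace(2)[OF D_graph[OF assms(1)] D_graph[OF assms(2)]] ap_eq by auto
lemma smul: assumes "x \<in> D" shows D_smul: "smul X c x \<in> D" and t_smul: "t (smul X c x) = smul X c (t x)"
  using graph_subspace(3)[OF D_graph[OF assms], of c] ap_eq by auto
lemma D_minus: "x \<in> D \<Longrightarrow> - x \<in> D" and t_minus: "x \<in> D \<Longrightarrow> t (- x) = - t x"
  using smul[of x "-1"] by (simp_all add: smul_simps[OF S])
lemma D_diff: "x \<in> D \<Longrightarrow> y \<in> D \<Longrightarrow> x - y \<in> D"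
  and t_diff: "x \<in> D \<Longrightarrow> y \<in> D \<Longrightarrow> t (x - y) = t x - t y"
  using add[of x "- y"] by (simp_all add: D_minus t_minus)

lemmas D_simps = D_0 D_add D_smul D_minus D_diff
lemmas t_simps = t_0 t_add t_smul t_minus t_diff
lemmas cs = carr_simps[OF S]
lemmas ips = ip_simps[OF S]

lemma adjoint_graph: "graph_adj X T = T" using sa by (simp add: selfadjoint_def)

lemma sym: "x \<in> D \<Longrightarrow> y \<in> D \<Longrightarrow> ip X (t x) y = ip X x (t y)"
proof -
  assume x: "x \<in> D" and y: "y \<in> D"
  have "(y, t y) \<in> graph_adj X T" using D_graph[OF y] adjoint_graph by simp
  then show ?thesis unfolding graph_adj_def using D_graph[OF x] by blast
qed

lemma graphI:
  assumes "y \<in> carr X" "z \<in> carr X" "\<And>u. u \<in> D \<Longrightarrow> ip X (t u) y = ip X u z"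
  shows "y \<in> D" "t y = z"
proof -
  have "(y, z) \<in> graph_adj X T" unfolding graph_adj_def using assms ap_eq by blast
  then have "(y, z) \<in> T" using adjoint_graph by simp
  then show "y \<in> D" "t y = z" using ap_eq by auto
qed

text \<open>
  An adjoint is always closed, by continuity of the inner product.
\<close>

lemma graph_closed:
  assumes s: "\<And>n. s n \<in> D" and x: "x \<in> carr X" and y: "y \<in> carr X"
    and lim: "(\<lambda>n. hnorm X (s n - x)) \<longlonglongrightarrow> 0" "(\<lambda>n. hnorm X (t (s n) - y)) \<longlonglongrightarrow> 0"
  shows "x \<in> D" "t x = y"
proof -
  have "ip X (t u) x = ip X u y" if u: "u \<in> D" for u
  proof -
    have "(\<lambda>n. ip X (t u) (s n)) \<longlonglongrightarrow> ip X (t u) x"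
      using s x u by (intro ip_tendsto(1)[OF S _ _ lim(1)]) (auto simp: D_carr t_carr)
    moreover have "(\<lambda>n. ip X u (t (s n))) \<longlonglongrightarrow> ip X u y"
      using s y u by (intro ip_tendsto(1)[OF S _ _ lim(2)]) (auto simp: D_carr t_carr)
    ultimately show ?thesis using sym[OF u s] LIMSEQ_unique by simp
  qed
  then show "x \<in> D" "t x = y" using graphI x y by blast+
qed

subsection \<open>The graph space\<close>

text \<open>
  For c > 0 the norm is equivalent to the graph norm, and the form is that of T^2 + c.
\<close>

definition gs :: "real \<Rightarrow> ('k, 'v) ip_space" where
  "gs c = X\<lparr>carr := D, ip := (\<lambda>x y. ip X (t x) (t y) + of_real c * ip X x y)\<rparr>"

lemma gs_simps [simp]: "carr (gs c) = D" "smul (gs c) = smul X"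
  "ip (gs c) x y = ip X (t x) (t y) + of_real c * ip X x y"
  by (simp_all add: gs_def)

lemma gs_self: "x \<in> D \<Longrightarrow> ip (gs c) x x = of_real ((hnorm X (t x))\<^sup>2 + c * (hnorm X x)\<^sup>2)"
  by (simp add: ip_self[OF S] D_carr t_carr)

lemma gs_norm: "c \<ge> 0 \<Longrightarrow> x \<in> D \<Longrightarrow> (hnorm (gs c) x)\<^sup>2 = (hnorm X (t x))\<^sup>2 + c * (hnorm X x)\<^sup>2"
  unfolding hnorm_def[of "gs c"] gs_self norm_of_real by simp

lemma gs_ips:
  assumes c: "c > 0"
  shows "inner_product_space (gs c)"
proof (rule inner_product_spaceI)
  show "vector_space (smul (gs c))" using semi_vs[OF S] by simp
  show "module.subspace (smul (gs c)) (carr (gs c))"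
    using module_subspace_iff[OF semi_vs[OF S]] D_simps by simp
  show "\<exists>r\<ge>0. ip (gs c) x x = of_real r" if "x \<in> carr (gs c)" for x
  proof (intro exI conjI)
    show "ip (gs c) x x = of_real ((hnorm X (t x))\<^sup>2 + c * (hnorm X x)\<^sup>2)"
      by (rule gs_self) (use that in simp)
    show "0 \<le> (hnorm X (t x))\<^sup>2 + c * (hnorm X x)\<^sup>2" using c by simp
  qed
  show "x = 0" if x: "x \<in> carr (gs c)" "ip (gs c) x x = 0" for x
  proof -
    have "(hnorm X (t x))\<^sup>2 + c * (hnorm X x)\<^sup>2 = 0"
      using x unfolding gs_simps(1) by (simp only: gs_self of_real_eq_0_iff)
    then have "(hnorm X x)\<^sup>2 = 0" using c by (simp add: add_nonneg_eq_0_iff)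
    then show ?thesis using hnorm_eq_0[OF I] x D_carr by simp
  qed
  show "kconj (ip (gs c) x y) = ip (gs c) y x" if "x \<in> carr (gs c)" "y \<in> carr (gs c)" for x y
    using that by (simp add: kconj_add ip_conj[OF S] D_carr t_carr)
qed (simp_all add: ips t_simps D_carr t_carr D_simps algebra_simps)

lemma gs_le:
  assumes "c \<ge> 0" "x \<in> D"
  shows "hnorm X (t x) \<le> hnorm (gs c) x" "sqrt c * hnorm X x \<le> hnorm (gs c) x"
  by (rule power2_le_imp_le; use assms in \<open>simp add: gs_norm power_mult_distrib\<close>)+

lemma gs_le_add: "c \<ge> 0 \<Longrightarrow> x \<in> D \<Longrightarrow> hnorm (gs c) x \<le> hnorm X (t x) + sqrt c * hnorm X x"
  by (rule power2_le_imp_le) (simp_all add: gs_norm power2_sum power_mult_distrib)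

lemma gs_hilbert:
  assumes c: "c > 0"
  shows "hilbert (gs c)"
  unfolding hilbert_iff
proof (intro conjI gs_ips c allI impI)
  fix s assume s: "cauchy_in (gs c) s"
  have sD: "s n \<in> D" for n using s by (simp add: cauchy_in_def)
  have d: "hnorm X (t (s m) - t (s n)) \<le> hnorm (gs c) (s m - s n)"
    "hnorm X (s m - s n) \<le> hnorm (gs c) (s m - s n) / sqrt c" for m n
    using gs_le[of c "s m - s n"] c sD by (simp_all add: t_diff D_diff field_simps)
  have "cauchy_in X (\<lambda>n. t (s n))"
    using s sD d(1) unfolding cauchy_in_def by (meson le_less_trans t_carr)
  then obtain y where y: "y \<in> carr X" "(\<lambda>n. hnorm X (t (s n) - y)) \<longlonglongrightarrow> 0" by (rule hilbertD[OF hilbert_X])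
  have "cauchy_in X s"
    unfolding cauchy_in_def
  proof (intro conjI allI impI)
    show "s n \<in> carr X" for n using sD D_carr by blast
    fix e :: real assume "e > 0"
    then have "e * sqrt c > 0" using c by simp
    then obtain N where N: "\<And>m n. m \<ge> N \<Longrightarrow> n \<ge> N \<Longrightarrow> hnorm (gs c) (s m - s n) < e * sqrt c"
      using s unfolding cauchy_in_def by blast
    have "hnorm X (s m - s n) < e" if "m \<ge> N" "n \<ge> N" for m n
    proof -
      have "hnorm (gs c) (s m - s n) / sqrt c < e" using N[OF that] c by (simp add: field_simps)
      then show ?thesis using d(2)[of m n] by linarith
    qed
    then show "\<exists>N. \<forall>m\<ge>N. \<forall>n\<ge>N. hnorm X (s m - s n) < e" by blast
  qed
  then obtain x where x: "x \<in> carr X" "(\<lambda>n. hnorm X (s n - x)) \<longlonglongrightarrow> 0" by (rule hilbertD[OF hilbert_X])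
  have xD: "x \<in> D" "t x = y" using graph_closed[OF sD x(1) y(1) x(2) y(2)] .
  have "(\<lambda>n. hnorm X (t (s n) - y) + sqrt c * hnorm X (s n - x)) \<longlonglongrightarrow> 0 + sqrt c * 0"
    by (intro tendsto_intros x y)
  then have "(\<lambda>n. hnorm X (t (s n) - y) + sqrt c * hnorm X (s n - x)) \<longlonglongrightarrow> 0" by simp
  then have "(\<lambda>n. hnorm (gs c) (s n - x)) \<longlonglongrightarrow> 0"
    by (rule Lim_null_comparison[rotated])
      (use gs_le_add[of c "s n - x" for n] sD xD c in \<open>auto simp: D_diff t_diff\<close>)
  then show "\<exists>x\<in>carr (gs c). (\<lambda>n. hnorm (gs c) (s n - x)) \<longlonglongrightarrow> 0" using xD by auto
qed

subsection \<open>The operator inverse to \<open>T\<^sup>2 + c\<close>\<close>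

lemma square_eq_0:
  assumes c: "c > 0" and y: "y \<in> D" "t y \<in> D" "t (t y) + smul X (of_real c) y = 0"
  shows "y = 0"
proof -
  have "ip (gs c) y y = ip X y (t (t y) + smul X (of_real c) y)"
    using y(1,2) by (simp add: ips sym[OF y(1,2)] D_carr t_carr cs)
  also have "\<dots> = 0" unfolding y(3) by (simp add: ips D_carr y(1))
  finally have "ip (gs c) y y = 0" .
  then show ?thesis using ip_self_eq_0[OF gs_ips[OF c]] y by simp
qed

text \<open>
  Riesz representation of the functional <x, .> in the graph space gives y with
  <Ty, Tu> + c <y, u> = <x, u> for all u in D; by self-adjointness Ty then lies in D.
\<close>

lemma square_solve:
  assumes c: "c > 0" and x: "x \<in> carr X"
  obtains y where "y \<in> D" "t y \<in> D" "t (t y) + smul X (of_real c) y = x"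
proof (rule riesz_on_subspace[OF gs_hilbert[OF c], where D = D and f = "ip X x" and C = "hnorm X x / sqrt c"])
  fix u assume u: "u \<in> D"
  have "norm (ip X x u) \<le> hnorm X x * hnorm X u" using x u by (simp add: cauchy_schwarz[OF S] D_carr)
  also have "\<dots> \<le> hnorm X x * (hnorm (gs c) u / sqrt c)"
    using gs_le(2)[of c u] c u by (intro mult_left_mono) (simp_all add: field_simps)
  finally show "norm (ip X x u) \<le> hnorm X x / sqrt c * hnorm (gs c) u" by simp
next
  fix y assume y: "y \<in> carr (gs c)" and eq: "\<And>u. u \<in> D \<Longrightarrow> ip X x u = ip (gs c) y u"
  have yD: "y \<in> D" using y by simp
  let ?z = "x - smul X (of_real c) y"
  have "ip X (t u) (t y) = ip X u ?z" if u: "u \<in> D" for u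
  proof -
    have "ip X u x = ip (gs c) u y"
      using arg_cong[OF eq[OF u], of kconj] u x yD ip_conj[OF ips_semi[OF gs_ips[OF c]], of y u]
      by (simp add: ip_conj[OF S] D_carr)
    then show ?thesis using u x yD by (simp add: ips D_carr cs)
  qed
  from graphI[OF t_carr[OF yD] _ this] have "t y \<in> D" "t (t y) = ?z"
    using x yD by (simp_all add: cs D_carr)
  then show thesis using that[OF yD] by simp
qed (use x in \<open>auto simp: D_simps ips D_carr\<close>)

definition res where "res c x = (THE y. (y, x - smul X (of_real c) y) \<in> T ^^ 2)"

lemma square_iff: "(x, z) \<in> T ^^ 2 \<longleftrightarrow> x \<in> D \<and> t x \<in> D \<and> z = t (t x)"
  using ap_eq D_graph by (auto simp: numeral_2_eq_2)

lemma res_unique: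
  assumes c: "c > 0" and y: "y \<in> D" "t y \<in> D" "t (t y) + smul X (of_real c) y = x"
  shows "res c x = y"
  unfolding res_def
proof (rule the_equality)
  show "(y, x - smul X (of_real c) y) \<in> T ^^ 2" using y by (auto simp: square_iff)
  fix y' assume "(y', x - smul X (of_real c) y') \<in> T ^^ 2"
  then have y': "y' \<in> D" "t y' \<in> D" "t (t y') + smul X (of_real c) y' = x"
    by (auto simp: square_iff) (metis diff_add_cancel)
  have "y' - y = 0"
  proof (rule square_eq_0[OF c])
    show "t (t (y' - y)) + smul X (of_real c) (y' - y) = 0"
      using y y' by (simp add: t_simps smul_diff_right[OF S]) (metis add_diff_add diff_self)
  qed (use y y' in \<open>simp_all add: D_diff t_diff\<close>)
  then show "y' = y" by simp
qed

lemma res_props: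
  assumes c: "c > 0" and x: "x \<in> carr X"
  shows "res c x \<in> D" "t (res c x) \<in> D" "t (t (res c x)) + smul X (of_real c) (res c x) = x"
proof -
  obtain y where y: "y \<in> D" "t y \<in> D" "t (t y) + smul X (of_real c) y = x"
    using square_solve[OF c x] by blast
  then have "res c x = y" by (rule res_unique[OF c])
  then show "res c x \<in> D" "t (res c x) \<in> D" "t (t (res c x)) + smul X (of_real c) (res c x) = x"
    using y by simp_all
qed

lemma res_tt: "c > 0 \<Longrightarrow> x \<in> carr X \<Longrightarrow> t (t (res c x)) = x - smul X (of_real c) (res c x)"
  using res_props(3)[of c x] by (metis add_diff_cancel_right')

text \<open>
  The weak form of (T^2 + c) y = x, which is the form in which the resolvent is used.
\<close>

lemma res_weak:
  assumes c: "c > 0" and x: "x \<in> carr X" and u: "u \<in> D"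
  shows "ip (gs c) u (res c x) = ip X u x" "ip (gs c) (res c x) u = ip X x u"
proof -
  note r = res_props[OF c x]
  have "ip (gs c) u (res c x) = ip X u (t (t (res c x)) + smul X (of_real c) (res c x))"
    using u r(1,2) by (simp add: ips sym[OF u r(2)] D_carr t_carr cs)
  then show 1: "ip (gs c) u (res c x) = ip X u x" by (simp only: r(3))
  show "ip (gs c) (res c x) u = ip X x u"
    using 1 ip_conj[OF ips_semi[OF gs_ips[OF c]], of u "res c x"] u r x
    by (metis ip_conj[OF S] D_carr gs_simps(1))
qed

lemma res_norm: "c > 0 \<Longrightarrow> x \<in> carr X \<Longrightarrow> of_real ((hnorm (gs c) (res c x))\<^sup>2) = ip X (res c x) x"
  using res_weak(1)[of c x "res c x"] res_props(1)[of c x]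
  by (simp only: ip_self[OF ips_semi[OF gs_ips], symmetric] gs_simps(1))

lemma res_lin: assumes c: "c > 0" shows "lin_on X X (res c)"
proof (rule lin_onI)
  fix x assume x: "x \<in> carr X"
  note rx = res_props[OF c x]
  show "res c x \<in> carr X" using rx D_carr by blast
  show "res c (smul X k x) = smul X k (res c x)" for k
  proof (rule res_unique[OF c])
    have "t (t (smul X k (res c x))) + smul X (of_real c) (smul X k (res c x))
        = smul X k (t (t (res c x)) + smul X (of_real c) (res c x))"
      using rx(1,2) by (simp add: t_simps smul_simps[OF S] mult.commute)
    then show "t (t (smul X k (res c x))) + smul X (of_real c) (smul X k (res c x)) = smul X k x"
      by (simp only: rx(3))
  qed (use rx in \<open>simp_all add: D_simps t_simps\<close>)
  fix y assume y: "y \<in> carr X"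
  note ry = res_props[OF c y]
  show "res c (x + y) = res c x + res c y"
  proof (rule res_unique[OF c])
    have "t (t (res c x + res c y)) + smul X (of_real c) (res c x + res c y)
       = (t (t (res c x)) + smul X (of_real c) (res c x)) + (t (t (res c y)) + smul X (of_real c) (res c y))"
      using rx(1,2) ry(1,2) by (simp add: t_simps smul_simps[OF S] algebra_simps)
    then show "t (t (res c x + res c y)) + smul X (of_real c) (res c x + res c y) = x + y"
      by (simp only: rx(3) ry(3))
  qed (use rx ry in \<open>simp_all add: D_simps t_simps\<close>)
qed

lemma res_gs_bound:
  assumes c: "c > 0" and x: "x \<in> carr X"
  shows "hnorm (gs c) (res c x) \<le> hnorm X x / sqrt c"
proof (cases "hnorm (gs c) (res c x) = 0")
  case False
  let ?n = "hnorm (gs c) (res c x)"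
  have p: "?n > 0" using False by (simp add: less_le)
  have rD: "res c x \<in> D" by (rule res_props[OF c x])
  have "?n\<^sup>2 = norm (of_real (?n\<^sup>2) :: 'k)" by (simp add: norm_power)
  also have "\<dots> = norm (ip X (res c x) x)" by (simp only: res_norm[OF c x])
  also have "\<dots> \<le> hnorm X (res c x) * hnorm X x" using x rD by (intro cauchy_schwarz[OF S]) (auto simp: D_carr)
  also have "\<dots> \<le> (?n / sqrt c) * hnorm X x"
    using gs_le(2)[of c, OF _ rD] c by (intro mult_right_mono) (simp_all add: field_simps)
  finally have "?n * ?n \<le> ?n * (hnorm X x / sqrt c)" by (simp add: power2_eq_square)
  then show ?thesis using mult_le_cancel_left_pos[OF p] by blast
qed (use c in simp)

lemma res_commute:
  assumes c: "c > 0" and x: "x \<in> D"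
  shows "res c (t x) = t (res c x)" "t (t (res c x)) \<in> D"
proof -
  note r = res_props[OF c D_carr[OF x]] and rt = res_tt[OF c D_carr[OF x]]
  show tt: "t (t (res c x)) \<in> D" unfolding rt using x r by (simp add: D_simps)
  show "res c (t x) = t (res c x)"
  proof (rule res_unique[OF c r(2) tt])
    have "t (t (t (res c x)) + smul X (of_real c) (res c x)) = t x" by (simp only: r(3))
    then show "t (t (t (res c x))) + smul X (of_real c) (t (res c x)) = t x"
      using tt r(1,2) by (simp add: t_simps D_simps)
  qed
qed

text \<open>
  A vector that is orthogonal to the domain of T^2 is tested with its own image under the inverse
  of T^2 + 1.
\<close>

lemma square_domain_dense: "dense_in X (Domain (T ^^ 2))" "dense_in (gs 1) (Domain (T ^^ 2))"
proof -
  let ?E = "Domain (T ^^ 2)"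
  have E: "x \<in> ?E \<longleftrightarrow> x \<in> D \<and> t x \<in> D" for x by (auto simp: square_iff Domain_iff)
  have sub: "0 \<in> ?E" "\<And>x y. x \<in> ?E \<Longrightarrow> y \<in> ?E \<Longrightarrow> x + y \<in> ?E" "\<And>c x. x \<in> ?E \<Longrightarrow> smul X c x \<in> ?E"
    by (auto simp: E D_simps t_simps simp del: Domain.simps Domain_iff)
  have rE: "res 1 x \<in> ?E" if "x \<in> carr X" for x using res_props[OF _ that, of 1] by (simp add: E)
  show "dense_in X ?E"
  proof (rule dense_in_if_orthogonal[OF hilbert_X _ sub])
    show "?E \<subseteq> carr X" using E D_carr by blast
    fix x assume x: "x \<in> carr X" and o: "\<And>d. d \<in> ?E \<Longrightarrow> ip X x d = 0"
    note r = res_props[OF _ x, of 1]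
    have "ip X x (res 1 x) = 0" using o[OF rE[OF x]] .
    then have "ip (gs 1) (res 1 x) (res 1 x) = 0"
      using res_weak(2)[OF _ x, of 1 "res 1 x"] r by simp
    then have "res 1 x = 0" using ip_self_eq_0[OF gs_ips[of 1]] r(1) by simp
    then show "x = 0" using r(3) by (simp add: t_0 smul_simps[OF S])
  qed
  show "dense_in (gs 1) ?E"
  proof (rule dense_in_if_orthogonal[OF gs_hilbert])
    show "?E \<subseteq> carr (gs 1)" using E by auto
    fix x assume x: "x \<in> carr (gs 1)" and o: "\<And>d. d \<in> ?E \<Longrightarrow> ip (gs 1) x d = 0"
    have xX: "x \<in> carr X" using x D_carr by simp
    have "ip X x x = 0" using res_weak(1)[OF _ xX, of 1 x] o[OF rE[OF xX]] x by simp
    then show "x = 0" using ip_self_eq_0[OF I xX] by simp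
  qed (use sub in simp_all)
qed

text \<open>
  A symmetric operator is self-adjoint if its sum with 1 is onto; the equation
  (T^2 + 1) v = z + y identifies an element (y, z) of the adjoint with (v, T^2 v).
\<close>

theorem square_selfadjoint: "selfadjoint X (T ^^ 2)"
  unfolding selfadjoint_def
proof (intro conjI square_domain_dense(1))
  show "lin_op X X (T ^^ 2)"
    unfolding lin_op_def module_subspace_iff[OF dsum_vs[OF semi_vs[OF S] semi_vs[OF S]]]
    by (auto simp: square_iff single_valued_def D_carr t_carr D_simps t_simps zero_prod_def)
  show "graph_adj X (T ^^ 2) = T ^^ 2"
  proof (intro equalityI subsetI)
    fix p assume "p \<in> T ^^ 2"
    then obtain y where p: "p = (y, t (t y))" and y: "y \<in> D" "t y \<in> D" by (cases p) (auto simp: square_iff)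
    have "ip X (t (t x)) y = ip X x (t (t y))" if "x \<in> D" "t x \<in> D" for x
      using sym[OF that(2) y(1)] sym[OF that(1) y(2)] by simp
    then show "p \<in> graph_adj X (T ^^ 2)"
      using p y by (auto simp: graph_adj_def square_iff D_carr t_carr)
  next
    fix p assume "p \<in> graph_adj X (T ^^ 2)"
    then obtain y z where p: "p = (y, z)" and y: "y \<in> carr X" and z: "z \<in> carr X"
      and all: "\<forall>(x, w)\<in>T ^^ 2. ip X w y = ip X x z"
      by (auto simp: graph_adj_def)
    have eq: "ip X (t (t x)) y = ip X x z" if "x \<in> D" "t x \<in> D" for x
      using all square_iff[of x "t (t x)"] that by blast
    let ?v = "res 1 (z + y)"
    have v: "?v \<in> D" "t ?v \<in> D" "t (t ?v) + ?v = z + y"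
      using res_props[of 1 "z + y"] y z by (simp_all add: cs smul_simps[OF S])
    have "ip X w (y - ?v) = 0" if w: "w \<in> carr X" for w
    proof -
      let ?u = "res 1 w"
      have u: "?u \<in> D" "t ?u \<in> D" "t (t ?u) + ?u = w"
        using res_props[of 1 w] w by (simp_all add: smul_simps[OF S])
      have "ip X w y = ip X (t (t ?u) + ?u) y" using u by simp
      also have "\<dots> = ip X ?u (z + y)"
        using eq[OF u(1,2)] u(1,2) y z by (simp add: ips D_carr t_carr)
      also have "\<dots> = ip X ?u (t (t ?v) + ?v)" using v by simp
      also have "\<dots> = ip X (t (t ?u) + ?u) ?v"
        using u(1,2) v(1,2) sym[OF u(2) v(1)] sym[OF u(1) v(2)] by (simp add: ips D_carr t_carr)
      finally have "ip X w y = ip X w ?v" using u by simp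
      then show ?thesis using w y v by (simp add: ips D_carr)
    qed
    then have "y - ?v = 0" using y v by (intro ip_all_0[OF I]) (simp_all add: cs D_carr)
    then have "y = ?v" by simp
    then show "p \<in> T ^^ 2" using p v by (auto simp: square_iff)
  qed
qed

subsection \<open>Square roots of the inverse of \<open>T\<^sup>2 + 1\<close>\<close>

lemma sqrt_norm:
  assumes R: "is_pos_sqrt X R (res 1)" and x: "x \<in> carr X"
  shows "hnorm X (R x) = hnorm (gs 1) (res 1 x)" "norm (ip X (res 1 x) x) = (hnorm X (R x))\<^sup>2"
proof -
  have P: "positive_sa X R" and RR: "\<And>x. x \<in> carr X \<Longrightarrow> R (R x) = res 1 x"
    using R by (auto simp: is_pos_sqrt_def)
  have Rx: "R x \<in> carr X" using BL_carr[OF positive_saD(1)[OF P] x] .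
  have e: "ip X (res 1 x) x = of_real ((hnorm X (R x))\<^sup>2)"
    using positive_saD(2)[OF P Rx x] RR[OF x] ip_self[OF S Rx] by simp
  then show "norm (ip X (res 1 x) x) = (hnorm X (R x))\<^sup>2" by (simp add: norm_power)
  have "(of_real ((hnorm X (R x))\<^sup>2) :: 'k) = of_real ((hnorm (gs 1) (res 1 x))\<^sup>2)"
    using res_norm[OF _ x, of 1] e by (metis zero_less_one)
  then show "hnorm X (R x) = hnorm (gs 1) (res 1 x)"
    by (simp only: of_real_eq_iff) (simp add: power2_eq_iff_nonneg)
qed

text \<open>
  The range of the square root R of (T^2 + 1)^(-1) is D(T), without functional calculus.
  For f in D(T) and y = (T^2 + 1) v one has <f, y> = <Tf, Tv> + <f, v>, and the graph norm of v
  is the norm of R y; so <f, y> is bounded in terms of R y, and its representing vector z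
  satisfies f = R z. Conversely the norm of R T u is at most that of u, so that
  <R w, T u> = <w, R T u> is bounded in u, and R w lies in the domain of the adjoint of T.
\<close>

theorem sqrt_resolvent:
  assumes R: "is_pos_sqrt X R (res 1)"
  shows "inj_on R (carr X)" "R ` carr X = D"
    "\<And>w. w \<in> carr X \<Longrightarrow> hnorm X (t (R w)) \<le> hnorm X w"
proof -
  have P: "positive_sa X R" and RR: "\<And>x. x \<in> carr X \<Longrightarrow> R (R x) = res 1 x"
    using R by (auto simp: is_pos_sqrt_def)
  note L = BL_lin[OF positive_saD(1)[OF P]] and Rs = positive_saD(2)[OF P]
  have Rc: "R x \<in> carr X" if "x \<in> carr X" for x using lin_on_carr[OF L that] .
  have one: "smul X (of_real 1) x = x" for x by (simp add: smul_one[OF S])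
  have R0: "x = 0" if x: "x \<in> carr X" and "R x = 0" for x
  proof -
    have "res 1 x = 0" using RR[OF x] that(2) lin_on_0[OF S S L] by simp
    then show ?thesis using res_props(3)[OF _ x, of 1] by (simp add: t_0 smul_0_right[OF S])
  qed
  show inj: "inj_on R (carr X)"
  proof (rule inj_onI)
    fix x y assume xy: "x \<in> carr X" "y \<in> carr X" "R x = R y"
    then have "x - y = 0" by (intro R0[OF carr_diff[OF S]]) (simp_all add: lin_on_diff[OF S S L])
    then show "x = y" by simp
  qed
  note nR = sqrt_norm(1)[OF R]
  have sub: "D \<subseteq> R ` carr X"
  proof
    fix f assume f: "f \<in> D"
    let ?g = "\<lambda>v. ip X f (inv_into (carr X) R v)"
    have inv: "inv_into (carr X) R (R y) = y" if "y \<in> carr X" for y using inj that by simp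
    show "f \<in> R ` carr X"
    proof (rule riesz_on_subspace[OF hilbert_X, where D = "R ` carr X" and f = ?g and C = "hnorm (gs 1) f"])
      fix v assume "v \<in> R ` carr X"
      then obtain y where y: "y \<in> carr X" "v = R y" by blast
      have "norm (?g v) = norm (ip (gs 1) f (res 1 y))"
        using y f by (simp add: inv res_weak(1)[of 1, simplified])
      also have "\<dots> \<le> hnorm (gs 1) f * hnorm (gs 1) (res 1 y)"
        using f y res_props(1)[of 1 y] by (intro cauchy_schwarz[OF ips_semi[OF gs_ips]]) simp_all
      finally show "norm (?g v) \<le> hnorm (gs 1) f * hnorm X v" using y nR by simp
      show "?g (smul X c v) = c * ?g v" for c
        using y f inv[of "smul X c y"] by (simp add: inv cs lin_on_smul[OF L] ips D_carr)
      show "smul X c v \<in> R ` carr X" for c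
        using y by (auto simp: lin_on_smul[OF L, symmetric] cs)
      fix v' assume "v' \<in> R ` carr X"
      then obtain y' where y': "y' \<in> carr X" "v' = R y'" by blast
      show "?g (v + v') = ?g v + ?g v'"
        using y y' f inv[of "y + y'"] by (simp add: inv cs lin_on_add[OF L] ips D_carr)
      show "v + v' \<in> R ` carr X" using y y' by (auto simp: lin_on_add[OF L, symmetric] cs)
    next
      fix z assume z: "z \<in> carr X" and eq: "\<And>v. v \<in> R ` carr X \<Longrightarrow> ?g v = ip X z v"
      have "ip X (f - R z) y = 0" if y: "y \<in> carr X" for y
        using eq[of "R y"] y f z by (simp add: inv ips Rs Rc D_carr)
      then have "f - R z = 0"
        using f z by (intro ip_self_eq_0[OF I]) (simp_all add: cs Rc D_carr)
      then show ?thesis using z by auto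
    qed (use Rc in auto)
  qed
  have bound: "norm (ip X (R w) (t u)) \<le> hnorm X w * hnorm X u" if w: "w \<in> carr X" and u: "u \<in> D" for w u
  proof -
    let ?v = "res 1 (t u)"
    have tu: "t u \<in> carr X" using u t_carr by simp
    have v: "?v \<in> D" using res_props(1)[OF _ tu, of 1] by simp
    have "of_real ((hnorm (gs 1) ?v)\<^sup>2) = ip X (t ?v) u"
      using res_norm[OF _ tu, of 1] sym[OF v u] by simp
    then have "(hnorm (gs 1) ?v)\<^sup>2 = norm (ip X (t ?v) u)"
      using norm_of_real[of "(hnorm (gs 1) ?v)\<^sup>2", where 'a = 'k] by simp
    also have "\<dots> \<le> hnorm X (t ?v) * hnorm X u"
      by (rule cauchy_schwarz[OF S t_carr[OF v] D_carr[OF u]])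
    also have "\<dots> \<le> hnorm (gs 1) ?v * hnorm X u" using gs_le(1)[of 1, OF _ v] by (intro mult_right_mono) auto
    finally have "hnorm (gs 1) ?v * hnorm (gs 1) ?v \<le> hnorm (gs 1) ?v * hnorm X u" by (simp add: power2_eq_square)
    then have "hnorm (gs 1) ?v \<le> hnorm X u" by (cases "hnorm (gs 1) ?v = 0") (auto simp: less_le)
    then have "hnorm X (R (t u)) \<le> hnorm X u" using nR[OF tu] by simp
    moreover have "norm (ip X (R w) (t u)) \<le> hnorm X w * hnorm X (R (t u))"
      using w tu by (simp add: Rs cauchy_schwarz[OF S] Rc)
    ultimately show ?thesis by (meson hnorm_ge_0 mult_left_mono order_trans)
  qed
  have R_in: "R w \<in> D" if w: "w \<in> carr X" for w
  proof (rule riesz_on_subspace[OF hilbert_X, where D = D and f = "\<lambda>u. ip X (R w) (t u)" and C = "hnorm X w"])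
    fix z assume z: "z \<in> carr X" and eq: "\<And>u. u \<in> D \<Longrightarrow> ip X (R w) (t u) = ip X z u"
    have "ip X (t u) (R w) = ip X u z" if u: "u \<in> D" for u
      using arg_cong[OF eq[OF u], of kconj] u w z by (simp add: ip_conj[OF S] D_carr t_carr Rc)
    then show ?thesis using graphI(1)[OF Rc[OF w] z] by blast
  qed (use w D_sub in \<open>simp_all add: D_carr t_carr D_simps t_simps ips Rc bound\<close>)
  then show "R ` carr X = D" using sub by blast
  show "hnorm X (t (R w)) \<le> hnorm X w" if w: "w \<in> carr X" for w
  proof (rule norm_le_if_dense[OF I D_dense])
    show "norm (ip X (t (R w)) u) \<le> hnorm X w * hnorm X u" if "u \<in> D" for u
      using bound[OF w that] sym[OF R_in[OF w] that] by simp
  qed (use R_in[OF w] t_carr in auto)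
qed

text \<open>
  The completion for the norm of R x is identified with X by the extension of R.
\<close>

lemma sqrt_completion:
  assumes R: "is_pos_sqrt X R (res 1)" and c: "is_completion (X\<lparr>ip := (\<lambda>x y. ip X (R x) (R y))\<rparr>) Y j"
  defines "V \<equiv> bdd_ext Y X j (carr X) R"
  shows "V \<in> BL Y X" "\<And>x. x \<in> carr X \<Longrightarrow> V (j x) = R x"
    "\<And>y y'. y \<in> carr Y \<Longrightarrow> y' \<in> carr Y \<Longrightarrow> ip X (V y) (V y') = ip Y y y'"
    "bij_betw V (carr Y) (carr X)"
proof -
  let ?U = "X\<lparr>ip := (\<lambda>x y. ip X (R x) (R y))\<rparr>"
  have P: "positive_sa X R" using R by (simp add: is_pos_sqrt_def)
  have L: "lin_on X X R" by (rule BL_lin[OF positive_saD(1)[OF P]])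
  have f: "lin_on ?U X R" using L by (simp add: lin_on_def)
  have iso: "ip X (R x) (R y) = ip ?U x y" for x y by simp
  have dense: "x = 0" if x: "x \<in> carr X" and o: "\<And>d. d \<in> carr ?U \<Longrightarrow> ip X (R d) x = 0" for x
  proof -
    have "R x = 0"
      using o x lin_on_carr[OF L] by (intro ip_all_0[OF I]) (simp_all add: positive_saD(2)[OF P, symmetric])
    then show ?thesis
      using inj_onD[OF sqrt_resolvent(1)[OF R], of x 0] x lin_on_0[OF S S L] by (simp add: cs)
  qed
  have V: "bdd_ext Y X j (carr ?U) R = V" by (simp add: V_def)
  note cu = completion_unitary[OF c hilbert_X f, unfolded V]
  show "V \<in> BL Y X" by (rule cu(1)) (use iso dense in blast)+
  show "bij_betw V (carr Y) (carr X)" by (rule cu(4)) (use iso dense in blast)+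
  show "V (j x) = R x" if "x \<in> carr X" for x by (rule cu(2)) (use iso dense that in \<open>blast | simp\<close>)+
  show "ip X (V y) (V y') = ip Y y y'" if "y \<in> carr Y" "y' \<in> carr Y" for y y'
    by (rule cu(3)) (use iso dense that in blast)+
qed

lemma t_interpolation:
  assumes "x \<in> D" "t x \<in> D"
  shows "hnorm X (t x) \<le> hnorm X (t (t x)) + hnorm X x"
proof (rule power2_le_imp_le)
  have "(hnorm X (t x))\<^sup>2 = norm (ip X (t x) (t x))" using assms by (simp add: hnorm_def)
  also have "ip X (t x) (t x) = ip X x (t (t x))" using sym[OF assms] .
  also have "norm \<dots> \<le> hnorm X x * hnorm X (t (t x))"
    using assms by (intro cauchy_schwarz[OF S]) (auto simp: D_carr t_carr)
  also have "\<dots> \<le> (hnorm X (t (t x)) + hnorm X x)\<^sup>2"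
    using mult_nonneg_nonneg[of "hnorm X x" "hnorm X (t (t x))"]
    by (simp add: power2_sum add_nonneg_nonneg mult.commute)
  finally show "(hnorm X (t x))\<^sup>2 \<le> (hnorm X (t (t x)) + hnorm X x)\<^sup>2" .
qed simp

end

section \<open>The scale of spaces and the transported trace map\<close>

text \<open>
  The hypotheses of the theorem except for (H3.1), which enters through the locale
  regular_wave below.
\<close>

locale wave =
  fixes M :: "('k::rc_scalar, 'a::ab_group_add, 'b::ab_group_add, 'h::ab_group_add) wave_data"
  assumes H0: "hilbert (H0 M)"
    and B_sa: "selfadjoint (H0 M) (opB M)"
    and B_ker: "\<And>x. (x, 0) \<in> opB M \<Longrightarrow> x = 0"
    and H1bar: "is_completion (H1dot M) (H1bar M) (emb M)"
    and h: "hilbert (auxsp M)"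
    and Theta: "positive_sa (auxsp M) (Theta M)" "inj_on (Theta M) (carr (auxsp M))"
    and tau: "trac M \<in> BL (Hbar M 2) (auxsp M)"
    and H30: "{trac M \<phi> - Theta M \<zeta> | \<phi> \<zeta>. \<phi> \<in> carr (Hbar M 2) \<and> \<zeta> \<in> carr (auxsp M)}
              = carr (auxsp M)"
begin

sublocale B: selfadjoint_op "H0 M" "opB M" by unfold_locales (rule H0, rule B_sa)
sublocale B2: selfadjoint_op "H0 M" "opB M ^^ 2" by unfold_locales (rule H0, rule B.square_selfadjoint)

abbreviation "H \<equiv> H0 M"
abbreviation "K \<equiv> auxsp M"
abbreviation "D \<equiv> Domain (opB M)"
abbreviation "b \<equiv> ap (opB M)"
abbreviation "V \<equiv> Bbar M"
abbreviation "iV \<equiv> Bbar_inv M"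
abbreviation "Th \<equiv> Theta M"

lemmas HI = hilbert_ips[OF H0]
lemmas HS = hilbert_semi[OF H0]
lemmas KI = hilbert_ips[OF h]
lemmas KS = hilbert_semi[OF h]
lemmas cs = carr_simps[OF HS] carr_simps[OF KS]

lemma Y: "hilbert (H1bar M)" using H1bar by (simp add: is_completion_def)
lemmas YS = hilbert_semi[OF Y]

lemma H1dot_simps [simp]: "carr (H1dot M) = D" "smul (H1dot M) = smul H"
  "ip (H1dot M) x y = ip H (b x) (b y)"
  by (simp_all add: H1dot_def)

lemma Hk_simps [simp]: "Hk M 0 = H" "carr (Hk M (Suc 0)) = D" "smul (Hk M (Suc 0)) = smul H"
  "ip (Hk M (Suc 0)) x y = ip H (b x) (b y) + ip H x y"
  "carr (Hk M 2) = Domain (opB M ^^ 2)" "smul (Hk M 2) = smul H"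
  by (simp_all add: Hk_def)

lemma b_inj: "x \<in> D \<Longrightarrow> b x = 0 \<Longrightarrow> x = 0"
  using B_ker B.D_graph by metis

lemma range_b_dense: "x \<in> carr H \<Longrightarrow> (\<And>d. d \<in> D \<Longrightarrow> ip H (b d) x = 0) \<Longrightarrow> x = 0"
  using B.graphI[of x 0] b_inj by (simp add: cs ip_0_right[OF HS] B.D_carr)

lemma b_lin: "lin_on (H1dot M) H b"
  by (rule lin_onI) (simp_all add: B.t_carr B.t_add B.t_smul)

lemma V: "V \<in> BL (H1bar M) H" and V_emb: "\<And>d. d \<in> D \<Longrightarrow> V (emb M d) = b d"
  and V_ip: "\<And>y y'. y \<in> carr (H1bar M) \<Longrightarrow> y' \<in> carr (H1bar M) \<Longrightarrow> ip H (V y) (V y') = ip (H1bar M) y y'"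
  and V_bij: "bij_betw V (carr (H1bar M)) (carr H)"
proof -
  have 1: "ip H (b x) (b y) = ip (H1dot M) x y" for x y by simp
  have 2: "x = 0" if "x \<in> carr H" "\<And>d. d \<in> carr (H1dot M) \<Longrightarrow> ip H (b d) x = 0" for x
    using range_b_dense that by simp
  have V_eq: "bdd_ext (H1bar M) H (emb M) (carr (H1dot M)) b = V" by (simp add: Bbar_def)
  note c = completion_unitary[OF H1bar H0 b_lin, unfolded V_eq]
  show "V \<in> BL (H1bar M) H" by (rule c(1)) (use 1 2 in blast)+
  show "bij_betw V (carr (H1bar M)) (carr H)" by (rule c(4)) (use 1 2 in blast)+
  show "V (emb M d) = b d" if "d \<in> D" for d by (rule c(2)) (use 1 2 that in \<open>blast | simp\<close>)+
  show "ip H (V y) (V y') = ip (H1bar M) y y'" if "y \<in> carr (H1bar M)" "y' \<in> carr (H1bar M)" for y y'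
    by (rule c(3)) (use 1 2 that in blast)+
qed

lemmas V_carr = BL_carr[OF V]
lemmas V_lin = BL_lin[OF V]
lemmas V_simps = lin_on_add[OF V_lin] lin_on_smul[OF V_lin] lin_on_diff[OF YS HS V_lin]
  lin_on_minus[OF YS HS V_lin] lin_on_0[OF YS HS V_lin]
lemmas Ycs = carr_simps[OF YS]

lemma iV_carr: "x \<in> carr H \<Longrightarrow> iV x \<in> carr (H1bar M)"
  and V_iV: "x \<in> carr H \<Longrightarrow> V (iV x) = x"
  and iV_V: "y \<in> carr (H1bar M) \<Longrightarrow> iV (V y) = y"
  using V_bij unfolding Bbar_inv_def
  by (metis bij_betw_imp_surj_on inv_into_into, metis bij_betw_imp_surj_on f_inv_into_f,
      metis bij_betw_imp_inj_on inv_into_f_f)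

lemma V_inj: "y \<in> carr (H1bar M) \<Longrightarrow> y' \<in> carr (H1bar M) \<Longrightarrow> V y = V y' \<Longrightarrow> y = y'"
  by (metis iV_V)

lemma iV_add: "x \<in> carr H \<Longrightarrow> y \<in> carr H \<Longrightarrow> iV (x + y) = iV x + iV y"
  by (rule V_inj) (simp_all add: V_simps iV_carr V_iV cs Ycs)
lemma iV_smul: "x \<in> carr H \<Longrightarrow> iV (smul H c x) = smul (H1bar M) c (iV x)"
  by (rule V_inj) (simp_all add: V_simps iV_carr V_iV cs Ycs)

lemma hnorm_V: "y \<in> carr (H1bar M) \<Longrightarrow> hnorm H (V y) = hnorm (H1bar M) y"
  by (rule hnorm_cong) (simp add: V_ip)

lemma emb_carr: "x \<in> D \<Longrightarrow> emb M x \<in> carr (H1bar M)"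
  using H1bar BL_carr[of "emb M" "H1dot M"] by (simp add: is_completion_def)

lemma Hbar_simps [simp]:
  "carr (Hbar M (Suc 0)) = carr (H1bar M)" "smul (Hbar M k) = smul (H1bar M)"
  "carr (Hbar M 2) = {x \<in> carr (H1bar M). V x \<in> D}"
  "carr (Hbar M 3) = {x \<in> carr (H1bar M). V x \<in> Domain (opB M ^^ 2)}"
  "ip (Hbar M (Suc 0)) x y = ip H (V x) (V y)"
  using V_carr by (auto simp: Hbar_def numeral_2_eq_2[symmetric])

lemma hnorm_Hbar: "hnorm (Hbar M (Suc 0)) x = hnorm H (V x)" "hnorm (Hbar M 2) x = hnorm (B.gs 1) (V x)"
  "hnorm (Hbar M 3) x = hnorm (B2.gs 1) (V x)"
  by (rule hnorm_cong; simp add: Hbar_def Hk_def)+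

lemma Hbar1: "hilbert (Hbar M (Suc 0))"
  by (rule hilbert_cong[OF _ _ _ Y]) (simp_all add: V_ip)

text \<open>
  The trace map transported to D(B) by the isometry Bbar.
\<close>

definition t :: "'a \<Rightarrow> 'h" where "t u = trac M (iV u)"

lemma trac_eq: "\<phi> \<in> carr (H1bar M) \<Longrightarrow> trac M \<phi> = t (V \<phi>)"
  by (simp add: t_def iV_V)

lemma t_lin: "lin_on (B.gs c) K t"
  unfolding t_def
  using BL_lin[OF tau]
  by (intro lin_onI) (auto simp: iV_add iV_smul B.D_carr iV_carr V_iV lin_on_carr lin_on_add
      lin_on_smul[of "Hbar M 2" K "trac M", simplified])

lemma t_BL: assumes c: "c > 0" shows "t \<in> BL (B.gs c) K"
proof -
  obtain C where C: "C \<ge> 0" "\<And>x. x \<in> carr (Hbar M 2) \<Longrightarrow> hnorm K (trac M x) \<le> C * hnorm (Hbar M 2) x"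
    using BL_bound[OF tau] by blast
  show ?thesis
  proof (rule BL_I[OF t_lin, where C = "C * (1 + 1 / sqrt c)"])
    fix u assume "u \<in> carr (B.gs c)"
    then have u: "u \<in> D" by simp
    have "hnorm (B.gs 1) u \<le> hnorm H (b u) + hnorm H u" using B.gs_le_add[of 1, OF _ u] by simp
    also have "\<dots> \<le> hnorm (B.gs c) u + hnorm (B.gs c) u / sqrt c"
    proof (rule add_mono)
      show "hnorm H (b u) \<le> hnorm (B.gs c) u" using B.gs_le(1)[of c, OF _ u] c by simp
      show "hnorm H u \<le> hnorm (B.gs c) u / sqrt c" using B.gs_le(2)[of c, OF _ u] c by (simp add: field_simps)
    qed
    also have "\<dots> = (1 + 1 / sqrt c) * hnorm (B.gs c) u" by (simp add: algebra_simps)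
    finally have "C * hnorm (B.gs 1) u \<le> C * ((1 + 1 / sqrt c) * hnorm (B.gs c) u)" using C(1) by (rule mult_left_mono)
    then show "hnorm K (t u) \<le> C * (1 + 1 / sqrt c) * hnorm (B.gs c) u"
      using C(2)[of "iV u"] u by (simp add: t_def hnorm_Hbar iV_carr V_iV B.D_carr mult.assoc)
  qed
qed

lemma t_carr: "u \<in> D \<Longrightarrow> t u \<in> carr K"
  and t_add: "u \<in> D \<Longrightarrow> v \<in> D \<Longrightarrow> t (u + v) = t u + t v"
  and t_smul: "u \<in> D \<Longrightarrow> t (smul H c u) = smul K c (t u)"
  using lin_on_carr[OF t_lin[of 1]] lin_on_add[OF t_lin[of 1]] lin_on_smul[OF t_lin[of 1]] by simp_all
lemma t_minus: "u \<in> D \<Longrightarrow> t (- u) = - t u" and t_diff: "u \<in> D \<Longrightarrow> v \<in> D \<Longrightarrow> t (u - v) = t u - t v"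
  and t_0: "t 0 = 0"
  using lin_on_minus[OF ips_semi[OF B.gs_ips[of 1]] KS t_lin] lin_on_diff[OF ips_semi[OF B.gs_ips[of 1]] KS t_lin]
    lin_on_0[OF ips_semi[OF B.gs_ips[of 1]] KS t_lin] by simp_all
lemmas t_simps = t_0 t_add t_smul t_minus t_diff

lemma H30': "z \<in> carr K \<Longrightarrow> \<exists>u\<in>D. \<exists>w\<in>carr K. z = t u - Th w"
proof -
  assume "z \<in> carr K"
  then obtain \<phi> w where "\<phi> \<in> carr (Hbar M 2)" "w \<in> carr K" "z = trac M \<phi> - Th w" using H30 by blast
  then show ?thesis by (intro bexI[of _ "V \<phi>"] bexI[of _ w]) (auto simp: trac_eq)
qed

subsection \<open>The adjoint of the trace map for the graph norms\<close>

definition g :: "real \<Rightarrow> 'h \<Rightarrow> 'a" where "g l = bdd_adj (B.gs (l\<^sup>2)) K t"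

text \<open>
  Since gs carries the scalar product of B^2 + l^2, the operator g l is the composition of
  (B^2 + l^2)^(-1) with the formal adjoint of t.
\<close>

lemma g: assumes "l \<noteq> 0" shows g_BL: "g l \<in> BL K (B.gs (l\<^sup>2))"
  and g_adj: "\<And>u z. u \<in> D \<Longrightarrow> z \<in> carr K \<Longrightarrow> ip K (t u) z = ip (B.gs (l\<^sup>2)) u (g l z)"
proof -
  have c: "l\<^sup>2 > 0" using assms by simp
  note a = bdd_adj_props[OF B.gs_hilbert[OF c] KS t_BL[OF c], folded g_def]
  show "g l \<in> BL K (B.gs (l\<^sup>2))" by (fact a(1))
  show "ip K (t u) z = ip (B.gs (l\<^sup>2)) u (g l z)" if "u \<in> D" "z \<in> carr K" for u z
    using a(2)[of u z] that by (simp only: B.gs_simps(1))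
qed

lemma g_adj': "l \<noteq> 0 \<Longrightarrow> u \<in> D \<Longrightarrow> z \<in> carr K \<Longrightarrow>
    ip K (t u) z = ip H (b u) (b (g l z)) + of_real (l\<^sup>2) * ip H u (g l z)"
  by (simp add: g_adj)

lemma g_D: "l \<noteq> 0 \<Longrightarrow> z \<in> carr K \<Longrightarrow> g l z \<in> D"
  using BL_carr[OF g_BL] by simp

lemma g_lin: "l \<noteq> 0 \<Longrightarrow> lin_on K (B.gs (l\<^sup>2)) (g l)" by (rule BL_lin[OF g_BL])

lemma g_add: "l \<noteq> 0 \<Longrightarrow> z \<in> carr K \<Longrightarrow> w \<in> carr K \<Longrightarrow> g l (z + w) = g l z + g l w"
  and g_smul: "l \<noteq> 0 \<Longrightarrow> z \<in> carr K \<Longrightarrow> g l (smul K c z) = smul H c (g l z)"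
  using lin_on_add[OF g_lin] lin_on_smul[OF g_lin] by simp_all
lemma g_0: "l \<noteq> 0 \<Longrightarrow> g l 0 = 0" and g_minus: "l \<noteq> 0 \<Longrightarrow> z \<in> carr K \<Longrightarrow> g l (- z) = - g l z"
  and g_diff: "l \<noteq> 0 \<Longrightarrow> z \<in> carr K \<Longrightarrow> w \<in> carr K \<Longrightarrow> g l (z - w) = g l z - g l w"
  using lin_on_0[OF KS ips_semi[OF B.gs_ips] g_lin] lin_on_minus[OF KS ips_semi[OF B.gs_ips] g_lin]
    lin_on_diff[OF KS ips_semi[OF B.gs_ips] g_lin] by simp_all
lemmas g_simps = g_add g_smul g_0 g_minus g_diff

lemma R0_eq: "R0 M l = B.res (l\<^sup>2)"
  by (rule ext) (simp add: R0_def pow_res_def B.res_def)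

lemma Gbreve_eq: "l \<noteq> 0 \<Longrightarrow> x \<in> carr H \<Longrightarrow> Gbreve M l x = t (b (B.res (l\<^sup>2) x))"
  using B.res_props[of "l\<^sup>2" x] by (simp add: Gbreve_def R0_eq trac_eq emb_carr V_emb)

lemma b_res_bound:
  assumes c: "c > 0" and x: "x \<in> carr H"
  shows "hnorm (B.gs c) (b (B.res c x)) \<le> 3 * hnorm H x"
proof -
  note r = B.res_props[OF c x]
  have 1: "sqrt c * hnorm (B.gs c) (B.res c x) \<le> hnorm H x"
    using B.res_gs_bound[OF c x] c by (simp add: field_simps)
  have 2: "sqrt c * hnorm H (B.res c x) \<le> hnorm (B.gs c) (B.res c x)"
    and 3: "hnorm H (b (B.res c x)) \<le> hnorm (B.gs c) (B.res c x)"
    using B.gs_le[of c, OF _ r(1)] c by simp_all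
  have "hnorm H (b (b (B.res c x))) \<le> hnorm H x + hnorm H (smul H (of_real c) (B.res c x))"
    unfolding B.res_tt[OF c x] using x r B.D_carr by (intro hnorm_triangle_diff[OF HS]) (auto simp: cs)
  also have "hnorm H (smul H (of_real c) (B.res c x)) = sqrt c * (sqrt c * hnorm H (B.res c x))"
    using r c by (simp add: hnorm_smul[OF HS] B.D_carr)
  also have "\<dots> \<le> sqrt c * hnorm (B.gs c) (B.res c x)" using 2 c by (intro mult_left_mono) auto
  finally have "hnorm H (b (b (B.res c x))) \<le> 2 * hnorm H x" using 1 by simp
  moreover have "sqrt c * hnorm H (b (B.res c x)) \<le> sqrt c * hnorm (B.gs c) (B.res c x)"
    using 3 c by (intro mult_left_mono) auto
  moreover have "hnorm (B.gs c) (b (B.res c x)) \<le> hnorm H (b (b (B.res c x))) + sqrt c * hnorm H (b (B.res c x))"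
    by (rule B.gs_le_add) (use c r in auto)
  ultimately show ?thesis using 1 by linarith
qed

lemma b_res_lin: assumes c: "c > 0" shows "lin_on H (B.gs c') (\<lambda>x. b (B.res c x))"
proof -
  note r = B.res_props[OF c] and L = B.res_lin[OF c]
  show ?thesis by (rule lin_onI) (simp_all add: r lin_on_add[OF L] lin_on_smul[OF L] B.t_simps)
qed

lemma b_res_BL: assumes c: "c > 0" shows "(\<lambda>x. b (B.res c x)) \<in> BL H (B.gs c)"
  by (rule BL_I[OF b_res_lin[OF c], of _ 3]) (rule b_res_bound[OF c])

lemma Gbreve_BL: assumes l: "l \<noteq> 0" shows "Gbreve M l \<in> BL H K"
proof -
  have c: "l\<^sup>2 > 0" using l by simp
  show ?thesis
    by (rule BL_cong[OF BL_comp[OF b_res_BL[OF c] t_BL[OF c]] _ HS]) (simp add: Gbreve_eq l)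
qed

lemma eq_if_ip_eq:
  assumes "x \<in> carr H" "y \<in> carr H" "\<And>u. u \<in> carr H \<Longrightarrow> ip H u x = ip H u y"
  shows "x = y"
  using ip_all_0[OF HI, of "x - y"] assms by (simp add: ip_simps[OF HS] cs)

text \<open>
  The weak form of the resolvent equation, tested with B (g l z), removes the resolvent from the
  definition of G(l).
\<close>

lemma G_eq:
  assumes l: "l \<noteq> 0" and z: "z \<in> carr K"
  shows "G M l z = b (g l z)"
proof -
  have c: "l\<^sup>2 > 0" using l by simp
  note a = bdd_adj_props[OF H0 KS Gbreve_BL[OF l], folded G_def]
  note gD = g_D[OF l z]
  show ?thesis
  proof (rule eq_if_ip_eq)
    show "G M l z \<in> carr H" using BL_carr[OF a(1) z] .
    show "b (g l z) \<in> carr H" using gD B.t_carr by simp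
    fix x assume x: "x \<in> carr H"
    note r = B.res_props[OF c x]
    have "ip H x (G M l z) = ip K (t (b (B.res (l\<^sup>2) x))) z"
      using a(2)[OF x z] x by (simp add: Gbreve_eq l)
    also have "\<dots> = ip H (b (b (B.res (l\<^sup>2) x))) (b (g l z)) + of_real (l\<^sup>2) * ip H (B.res (l\<^sup>2) x) (b (g l z))"
      using g_adj'[OF l r(2) z] B.sym[OF r(1) gD] by simp
    also have "\<dots> = ip H (b (b (B.res (l\<^sup>2) x)) + smul H (of_real (l\<^sup>2)) (B.res (l\<^sup>2) x)) (b (g l z))"
      using r(1,2) gD by (simp add: ip_simps[OF HS] B.t_carr B.D_carr cs del: of_real_power)
    finally show "ip H x (G M l z) = ip H x (b (g l z))" by (simp only: r(3))
  qed
qed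

lemma ap_converse: "u \<in> D \<Longrightarrow> ap (converse (opB M)) (b u) = u"
  unfolding ap_def[of "converse (opB M)"]
proof (rule the_equality)
  assume u: "u \<in> D"
  then show "(b u, u) \<in> (opB M)\<inverse>" using B.D_graph by simp
  fix v assume "(b u, v) \<in> (opB M)\<inverse>"
  then have v: "v \<in> D" "b v = b u" by (auto simp: B.ap_eq)
  have "v - u = 0" by (rule b_inj) (use u v in \<open>simp_all add: B.D_diff B.t_diff\<close>)
  then show "v = u" by simp
qed

text \<open>
  Both sides are bounded extensions of the same operator, because B commutes with the resolvent.
  They are compared in the norm of H1bar, which is weaker than that of the third space of the scale.
\<close>

lemma R0bar_eq:
  assumes l: "l \<noteq> 0" and y: "y \<in> carr (H1bar M)"
  shows "R0bar M l y = iV (B.res (l\<^sup>2) (V y))"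
proof -
  have c: "l\<^sup>2 > 0" using l by simp
  let ?F = "\<lambda>y. iV (B.res (l\<^sup>2) (V y))"
  note r = B.res_props[OF c]
  have r2: "B.res (l\<^sup>2) x \<in> Domain (opB M ^^ 2)" if "x \<in> carr H" for x
    using r[OF that] by (auto simp: B.square_iff Domain_iff)
  have ap2: "ap (opB M ^^ 2) (B.res (l\<^sup>2) x) = b (b (B.res (l\<^sup>2) x))" if "x \<in> carr H" for x
    using r[OF that] by (intro B2.ap_eq) (simp add: B.square_iff)
  have F: "?F \<in> BL (H1bar M) (Hbar M 3)"
  proof (rule BL_I)
    show "lin_on (H1bar M) (Hbar M 3) ?F"
      by (rule lin_onI) (simp_all add: V_simps V_carr iV_carr V_iV r2 B.D_carr r
        lin_on_add[OF B.res_lin[OF c]] lin_on_smul[OF B.res_lin[OF c]] iV_add iV_smul)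
    fix y assume y: "y \<in> carr (H1bar M)"
    let ?x = "V y"
    have x: "?x \<in> carr H" using y V_carr by simp
    have "hnorm (Hbar M 3) (?F y) = hnorm (B2.gs 1) (B.res (l\<^sup>2) ?x)"
      using x r B.D_carr by (simp add: hnorm_Hbar V_iV)
    also have "\<dots> \<le> hnorm H (b (b (B.res (l\<^sup>2) ?x))) + hnorm H (B.res (l\<^sup>2) ?x)"
      using B2.gs_le_add[of 1, OF _ r2[OF x]] ap2[OF x] by simp
    also have "\<dots> \<le> hnorm (B.gs (l\<^sup>2)) (b (B.res (l\<^sup>2) ?x)) + hnorm (B.gs (l\<^sup>2)) (B.res (l\<^sup>2) ?x) / sqrt (l\<^sup>2)"
      using B.gs_le(1)[of "l\<^sup>2", OF _ r(2)[OF x]] B.gs_le(2)[of "l\<^sup>2", OF _ r(1)[OF x]] c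
      by (intro add_mono) (auto simp: field_simps)
    also have "\<dots> \<le> 3 * hnorm H ?x + (hnorm H ?x / sqrt (l\<^sup>2)) / sqrt (l\<^sup>2)"
      using b_res_bound[OF c x] B.res_gs_bound[OF c x] c by (intro add_mono divide_right_mono) auto
    also have "\<dots> = (3 + 1 / l\<^sup>2) * hnorm (H1bar M) y"
      using y by (simp add: hnorm_V algebra_simps power2_eq_square)
    finally show "hnorm (Hbar M 3) (?F y) \<le> (3 + 1 / l\<^sup>2) * hnorm (H1bar M) y" .
  qed
  have Fe: "?F (emb M x) = emb M (B.res (l\<^sup>2) x)" if x: "x \<in> D" for x
  proof (rule V_inj)
    have xH: "x \<in> carr H" using x B.D_carr by simp
    show "?F (emb M x) \<in> carr (H1bar M)"
      using x r(1)[OF B.t_carr[OF x]] by (simp add: V_emb iV_carr B.D_carr)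
    show "emb M (B.res (l\<^sup>2) x) \<in> carr (H1bar M)" using r(1)[OF xH] emb_carr by simp
    show "V (?F (emb M x)) = V (emb M (B.res (l\<^sup>2) x))"
      using x r(1)[OF B.t_carr[OF x]] r(1)[OF xH] B.res_commute(1)[OF c x] by (simp add: V_emb V_iV B.D_carr)
  qed
  have "\<exists>F. F \<in> BL (H1bar M) (Hbar M 3) \<and> (\<forall>x\<in>D. F (emb M x) = emb M (R0 M l x))"
    using F Fe by (intro exI[of _ ?F]) (simp add: R0_eq)
  from someI_ex[OF this] have R: "R0bar M l \<in> BL (H1bar M) (Hbar M 3)"
    "\<And>x. x \<in> D \<Longrightarrow> R0bar M l (emb M x) = emb M (B.res (l\<^sup>2) x)"
    unfolding R0bar_def bdd_ext_def by (simp_all add: R0_eq)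
  have weaken: "F \<in> BL (H1bar M) (H1bar M)" if F: "F \<in> BL (H1bar M) (Hbar M 3)" for F
  proof -
    obtain C where C: "C \<ge> 0" "\<And>x. x \<in> carr (H1bar M) \<Longrightarrow> hnorm (Hbar M 3) (F x) \<le> C * hnorm (H1bar M) x"
      using BL_bound[OF F] by blast
    show ?thesis
    proof (rule BL_I)
      show "lin_on (H1bar M) (H1bar M) F" using BL_lin[OF F] by (simp add: lin_on_def)
      fix x assume x: "x \<in> carr (H1bar M)"
      then have Fx: "F x \<in> carr (H1bar M)" "V (F x) \<in> Domain (opB M ^^ 2)" using BL_carr[OF F] by simp_all
      have "hnorm (H1bar M) (F x) = hnorm H (V (F x))" using Fx by (simp add: hnorm_V)
      also have "\<dots> \<le> hnorm (Hbar M 3) (F x)" using B2.gs_le(2)[of 1, OF _ Fx(2)] by (simp add: hnorm_Hbar)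
      finally show "hnorm (H1bar M) (F x) \<le> C * hnorm (H1bar M) x" using C(2)[OF x] by simp
    qed
  qed
  have dense: "dense_in (H1bar M) (emb M ` D)" using H1bar by (simp add: is_completion_def)
  show ?thesis
    by (rule BL_eq_on_dense[OF hilbert_ips[OF Y] hilbert_ips[OF Y] weaken[OF R(1)] weaken[OF F] dense _ y])
      (use R(2) Fe in \<open>force simp del: Domain_iff\<close>)
qed

lemma Gbarbreve_eq: "l \<noteq> 0 \<Longrightarrow> y \<in> carr (H1bar M) \<Longrightarrow> Gbarbreve M l y = t (B.res (l\<^sup>2) (V y))"
  by (simp add: Gbarbreve_def R0bar_eq t_def)

lemma res_BL: assumes c: "c > 0" shows "B.res c \<in> BL H (B.gs c)"
proof (rule BL_I[of _ _ _ "1 / sqrt c"])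
  show "lin_on H (B.gs c) (B.res c)"
    using B.res_lin[OF c] B.res_props(1)[OF c] by (simp add: lin_on_def)
  show "hnorm (B.gs c) (B.res c x) \<le> 1 / sqrt c * hnorm H x" if "x \<in> carr H" for x
    using B.res_gs_bound[OF c that] by simp
qed

lemma V_BL: "V \<in> BL (Hbar M (Suc 0)) H"
  by (rule BL_I[of _ _ _ 1]) (use V_lin in \<open>simp_all add: lin_on_def hnorm_Hbar\<close>)

lemma Gbarbreve_BL: assumes l: "l \<noteq> 0" shows "Gbarbreve M l \<in> BL (Hbar M (Suc 0)) K"
proof -
  have c: "l\<^sup>2 > 0" using l by simp
  show ?thesis
    by (rule BL_cong[OF BL_comp[OF BL_comp[OF V_BL res_BL[OF c]] t_BL[OF c]] _ hilbert_semi[OF Hbar1]])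
      (simp add: Gbarbreve_eq l)
qed

lemma Gbar: assumes l: "l \<noteq> 0" and z: "z \<in> carr K"
  shows Gbar_carr: "Gbar M l z \<in> carr (H1bar M)" and V_Gbar: "V (Gbar M l z) = g l z"
proof -
  have c: "l\<^sup>2 > 0" using l by simp
  note a = bdd_adj_props[OF Hbar1 KS Gbarbreve_BL[OF l]]
  have ad: "Gbar M l = bdd_adj (Hbar M (Suc 0)) K (Gbarbreve M l)" by (simp add: Gbar_def)
  note a = a[folded ad]
  show car: "Gbar M l z \<in> carr (H1bar M)" using BL_carr[OF a(1) z] by simp
  show "V (Gbar M l z) = g l z"
  proof (rule eq_if_ip_eq)
    show "V (Gbar M l z) \<in> carr H" using car V_carr by simp
    show "g l z \<in> carr H" using g_D[OF l z] B.D_carr by simp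
    fix u assume u: "u \<in> carr H"
    have "ip H u (V (Gbar M l z)) = ip K (Gbarbreve M l (iV u)) z"
      using a(2)[of "iV u" z] u z by (simp add: iV_carr V_iV)
    also have "\<dots> = ip (B.gs (l\<^sup>2)) (B.res (l\<^sup>2) u) (g l z)"
      using u z l B.res_props(1)[OF c u] by (simp add: Gbarbreve_eq iV_carr V_iV g_adj del: B.gs_simps)
    also have "\<dots> = ip H u (g l z)" by (rule B.res_weak(2)[OF c u g_D[OF l z]])
    finally show "ip H u (V (Gbar M l z)) = ip H u (g l z)" .
  qed
qed

lemma trac_Gbar: "l \<noteq> 0 \<Longrightarrow> z \<in> carr K \<Longrightarrow> trac M (Gbar M l z) = t (g l z)"
  by (simp add: trac_eq Gbar_carr V_Gbar)

subsection \<open>The coercive operator\<close>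

definition A :: "real \<Rightarrow> 'h \<Rightarrow> 'h" where
  "A l z = smul K (of_real (l\<^sup>2)) (t (g l z)) + Th z"

lemma Th_carr: "z \<in> carr K \<Longrightarrow> Th z \<in> carr K" using BL_carr[OF positive_saD(1)[OF Theta(1)]] .
lemmas Th_lin = BL_lin[OF positive_saD(1)[OF Theta(1)]]
lemmas Th_simps = lin_on_add[OF Th_lin] lin_on_smul[OF Th_lin] lin_on_diff[OF KS KS Th_lin]
  lin_on_minus[OF KS KS Th_lin] lin_on_0[OF KS KS Th_lin]
lemmas Th_sym = positive_saD(2)[OF Theta(1)]
lemma hTheta_eq: "hTheta M = form_space K Th" by (simp add: hTheta_def form_space_def)

lemma Theta_semi: "semi_ip_space (hTheta M)"
  unfolding hTheta_eq by (rule form_space_semi[OF KS Theta(1)])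

lemma Theta_norm: "z \<in> carr K \<Longrightarrow> ip K (Th z) z = of_real ((hnorm (hTheta M) z)\<^sup>2)"
  using ip_self[OF Theta_semi, of z] by (simp add: hTheta_eq)

lemma Theta_cs: "z \<in> carr K \<Longrightarrow> w \<in> carr K \<Longrightarrow>
    norm (ip K (Th z) w) \<le> hnorm (hTheta M) z * hnorm (hTheta M) w"
  using cauchy_schwarz[OF Theta_semi, of z w] by (simp add: hTheta_eq)

lemma Th_inj: "z \<in> carr K \<Longrightarrow> Th z = 0 \<Longrightarrow> z = 0"
  using inj_onD[OF Theta(2), of z 0] by (simp add: Th_simps cs)

lemma A_form:
  assumes l: "l \<noteq> 0" and z: "z \<in> carr K" and w: "w \<in> carr K"
  shows "ip K (A l z) w = of_real (l\<^sup>2) * ip (B.gs (l\<^sup>2)) (g l z) (g l w) + ip K (Th z) w"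
  using z w g_D[OF l z] unfolding A_def
  by (simp add: ip_simps[OF KS] t_carr cs Th_carr g_adj[OF l] del: B.gs_simps of_real_power)

lemma A_self: assumes l: "l \<noteq> 0" and z: "z \<in> carr K"
  shows "ip K (A l z) z = of_real (l\<^sup>2 * (hnorm (B.gs (l\<^sup>2)) (g l z))\<^sup>2 + (hnorm (hTheta M) z)\<^sup>2)"
  unfolding A_form[OF l z z] Theta_norm[OF z]
  using ip_self[OF ips_semi[OF B.gs_ips], of "l\<^sup>2" "g l z"] g_D[OF l z] l
  by (simp del: B.gs_simps(3))

lemma A_positive: assumes l: "l \<noteq> 0" shows "positive_sa K (A l)"
  unfolding positive_sa_def
proof (intro conjI ballI)
  have c: "l\<^sup>2 > 0" using l by simp
  show "A l \<in> BL K K"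
    unfolding A_def[abs_def]
    by (intro BL_add[OF KS] BL_smul[OF KS] BL_comp[OF g_BL[OF l] t_BL[OF c]] positive_saD(1)[OF Theta(1)])
  fix z assume z: "z \<in> carr K"
  show "\<exists>r\<ge>0. ip K (A l z) z = of_real r"
    using A_self[OF l z] by (metis add_nonneg_nonneg mult_nonneg_nonneg zero_le_power2)
  fix w assume w: "w \<in> carr K"
  have "ip K z (A l w) = kconj (ip K (A l w) z)"
    using z w by (simp add: ip_conj[OF KS] A_def cs t_carr g_D l Th_carr)
  also have "\<dots> = of_real (l\<^sup>2) * kconj (ip (B.gs (l\<^sup>2)) (g l w) (g l z)) + kconj (ip K (Th w) z)"
    unfolding A_form[OF l w z] by (simp add: kconj_add del: B.gs_simps of_real_power)
  also have "\<dots> = ip K (A l z) w"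
    unfolding A_form[OF l z w]
    using z w g_D[OF l] ip_conj[OF ips_semi[OF B.gs_ips[OF c]], of "g l w" "g l z"]
    by (simp add: ip_conj[OF KS] Th_carr Th_sym del: B.gs_simps(3) of_real_power)
  finally show "ip K (A l z) w = ip K z (A l w)" by simp
qed

text \<open>
  With q z = <A l z, z> the set Z of all z with q z \<le> 1 is weakly bounded, since by (H3.0)
  <z, y> = <g l z, u> - <z, w>_Theta for y = t u - Theta w, where the first product is that of the
  graph space. Uniform boundedness and scaling give the estimate.
\<close>

lemma A_coercive: assumes l: "l \<noteq> 0"
  shows "\<exists>c>0. \<forall>z\<in>carr K. c * (hnorm K z)\<^sup>2 \<le> norm (ip K (A l z) z)"
proof -
  have c: "l\<^sup>2 > 0" using l by simp
  define q where "q z = l\<^sup>2 * (hnorm (B.gs (l\<^sup>2)) (g l z))\<^sup>2 + (hnorm (hTheta M) z)\<^sup>2" for z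
  have q0: "q z \<ge> 0" for z by (simp add: q_def)
  have Aq: "norm (ip K (A l z) z) = q z" if "z \<in> carr K" for z
    unfolding A_self[OF l that] q_def[symmetric] norm_of_real using q0 by simp
  define Z where "Z = {z \<in> carr K. q z \<le> 1}"
  have "\<exists>N. \<forall>z\<in>Z. norm (ip K z y) \<le> N" if y: "y \<in> carr K" for y
  proof -
    obtain u w where u: "u \<in> D" and w: "w \<in> carr K" and yuw: "y = t u - Th w" using H30'[OF y] by blast
    have "norm (ip K z y) \<le> hnorm (B.gs (l\<^sup>2)) u * (1 / \<bar>l\<bar>) + hnorm (hTheta M) w" if "z \<in> Z" for z
    proof -
      have z: "z \<in> carr K" and qz: "q z \<le> 1" using that by (auto simp: Z_def)
      have gs2: "l\<^sup>2 * (hnorm (B.gs (l\<^sup>2)) (g l z))\<^sup>2 \<le> 1" and th2: "(hnorm (hTheta M) z)\<^sup>2 \<le> 1"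
        using qz c zero_le_power2[of "hnorm (hTheta M) z"] mult_nonneg_nonneg[OF less_imp_le[OF c] zero_le_power2]
        unfolding q_def by (smt (verit))+
      have th: "hnorm (hTheta M) z \<le> 1" using th2 by (simp add: power2_le_imp_le abs_square_le_1)
      have "(\<bar>l\<bar> * hnorm (B.gs (l\<^sup>2)) (g l z))\<^sup>2 \<le> 1\<^sup>2" using gs2 by (simp add: power_mult_distrib)
      then have "\<bar>l\<bar> * hnorm (B.gs (l\<^sup>2)) (g l z) \<le> 1" by (rule power2_le_imp_le) simp
      then have gs: "hnorm (B.gs (l\<^sup>2)) (g l z) \<le> 1 / \<bar>l\<bar>" using l by (simp add: field_simps)
      have "ip K z y = ip K z (t u) - ip K (Th z) w"
        using z u w by (simp add: yuw ip_simps[OF KS] t_carr Th_carr Th_sym)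
      then have "norm (ip K z y) \<le> norm (ip K (t u) z) + norm (ip K (Th z) w)"
        using z u by (simp add: norm_triangle_ineq4 norm_ip_commute[OF KS] t_carr)
      also have "norm (ip K (t u) z) \<le> hnorm (B.gs (l\<^sup>2)) u * hnorm (B.gs (l\<^sup>2)) (g l z)"
        unfolding g_adj[OF l u z] using u g_D[OF l z] c by (intro cauchy_schwarz[OF ips_semi[OF B.gs_ips]]) simp_all
      also have "\<dots> \<le> hnorm (B.gs (l\<^sup>2)) u * (1 / \<bar>l\<bar>)" using gs by (intro mult_left_mono) auto
      also have "norm (ip K (Th z) w) \<le> hnorm (hTheta M) z * hnorm (hTheta M) w" by (rule Theta_cs[OF z w])
      also have "\<dots> \<le> 1 * hnorm (hTheta M) w" using th by (intro mult_right_mono) auto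
      finally show ?thesis by simp
    qed
    then show ?thesis by blast
  qed
  then obtain N0 where N0: "\<And>z. z \<in> Z \<Longrightarrow> hnorm K z \<le> N0"
    using weakly_bounded_imp_bounded[OF h, of Z] by (auto simp: Z_def)
  define N where "N = \<bar>N0\<bar> + 1"
  have N: "N > 0" "\<And>z. z \<in> Z \<Longrightarrow> hnorm K z \<le> N" using N0 by (auto simp: N_def) (smt (verit) N0)
  have bd: "hnorm K z \<le> N * sqrt (q z)" if z: "z \<in> carr K" for z
  proof (rule field_le_epsilon)
    fix e :: real assume e: "e > 0"
    \<comment> \<open>The summand e / N keeps the scaling factor 1 / r finite when q z = 0.\<close>
    define r where "r = sqrt (q z) + e / N"
    have r: "r > 0" using e N q0 by (simp add: r_def add_nonneg_pos)
    have rq: "q z \<le> r\<^sup>2"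
    proof -
      have "(sqrt (q z))\<^sup>2 \<le> r\<^sup>2" using e N q0 by (intro power_mono) (auto simp: r_def)
      then show ?thesis using q0 by simp
    qed
    let ?z = "smul K (of_real (1 / r)) z"
    have zc: "?z \<in> carr K" using z by (simp add: cs)
    have "q ?z = (1 / r)\<^sup>2 * q z"
    proof -
      have "hnorm (B.gs (l\<^sup>2)) (g l ?z) = (1 / r) * hnorm (B.gs (l\<^sup>2)) (g l z)"
        using hnorm_smul[OF ips_semi[OF B.gs_ips[OF c]], of "g l z" "of_real (1 / r)"] g_D[OF l z] r z
        by (simp add: g_smul l norm_divide)
      moreover have "hnorm (hTheta M) ?z = (1 / r) * hnorm (hTheta M) z"
        using hnorm_smul[OF Theta_semi, of z "of_real (1 / r)"] z r by (simp add: hTheta_eq norm_divide)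
      ultimately show ?thesis by (simp add: q_def power_mult_distrib power_divide algebra_simps)
    qed
    also have "\<dots> \<le> 1" using rq r by (simp add: power_divide divide_simps)
    finally have "?z \<in> Z" using zc by (simp add: Z_def)
    then have "hnorm K ?z \<le> N" by (rule N)
    then have "hnorm K z \<le> N * r" using z r by (simp add: hnorm_smul[OF KS] norm_divide field_simps)
    also have "\<dots> = N * sqrt (q z) + e" using N by (simp add: r_def algebra_simps)
    finally show "hnorm K z \<le> N * sqrt (q z) + e" .
  qed
  have "1 / N\<^sup>2 * (hnorm K z)\<^sup>2 \<le> norm (ip K (A l z) z)" if z: "z \<in> carr K" for z
  proof -
    have "(hnorm K z)\<^sup>2 \<le> (N * sqrt (q z))\<^sup>2" using bd[OF z] by (intro power_mono) auto
    then show ?thesis using N q0[of z] by (simp add: Aq z power_mult_distrib field_simps)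
  qed
  then show ?thesis using N by (intro exI[of _ "1 / N\<^sup>2"]) simp
qed

lemma A_bij: "l \<noteq> 0 \<Longrightarrow> bij_betw (A l) (carr K) (carr K)"
  and A_inv: "l \<noteq> 0 \<Longrightarrow> inv_into (carr K) (A l) \<in> BL K K"
  using A_coercive[of l] coercive_bijection[OF h A_positive[of l]] by blast+

end

section \<open>The regularity condition on the trace\<close>

context wave begin

text \<open>
  H_(-1) belongs to the operator B and H_(-2) to the operator B^2, which is self-adjoint too; so
  both are covered by the results on square roots.
\<close>

lemma pow_res_eq: "pow_res M 2 1 = B.res 1" "pow_res M 4 1 = B2.res 1"
proof -
  show "pow_res M 2 1 = B.res 1" by (rule ext) (simp add: pow_res_def B.res_def)
  have "opB M ^^ 4 = (opB M ^^ 2) ^^ 2" by (simp add: numeral_eq_Suc O_assoc)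
  then show "pow_res M 4 1 = B2.res 1" by (intro ext) (simp add: pow_res_def B2.res_def)
qed

lemma B2_eq: "x \<in> Domain (opB M ^^ 2) \<longleftrightarrow> x \<in> D \<and> b x \<in> D"
  "x \<in> D \<Longrightarrow> b x \<in> D \<Longrightarrow> ap (opB M ^^ 2) x = b (b x)"
  using B.square_iff by (auto intro!: B2.ap_eq) 

context
  fixes S1 S2 :: "'a \<Rightarrow> 'a"
    and Hm1 :: "('k, 'm1::ab_group_add) ip_space" and j1 :: "'a \<Rightarrow> 'm1"
    and Hm2 :: "('k, 'm2::ab_group_add) ip_space" and j2 :: "'a \<Rightarrow> 'm2"
  assumes Hm1: "is_Hneg M 1 S1 Hm1 j1" and Hm2: "is_Hneg M 2 S2 Hm2 j2"
begin

lemma S1: "is_pos_sqrt H S1 (B.res 1)" and S2: "is_pos_sqrt H S2 (B2.res 1)"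
  using Hm1 Hm2 by (simp_all add: is_Hneg_def pow_res_eq)

lemma C1: "is_completion (H\<lparr>ip := (\<lambda>x y. ip H (S1 x) (S1 y))\<rparr>) Hm1 j1"
  and C2: "is_completion (H\<lparr>ip := (\<lambda>x y. ip H (S2 x) (S2 y))\<rparr>) Hm2 j2"
  using Hm1 Hm2 by (simp_all add: is_Hneg_def Hneg_pre_def)

lemma P1: "positive_sa H S1" and S1S1: "x \<in> carr H \<Longrightarrow> S1 (S1 x) = B.res 1 x"
  and P2: "positive_sa H S2" and S2S2: "x \<in> carr H \<Longrightarrow> S2 (S2 x) = B2.res 1 x"
  using S1 S2 by (auto simp: is_pos_sqrt_def)

lemmas S1_carr = BL_carr[OF positive_saD(1)[OF P1]]
lemmas S1_sym = positive_saD(2)[OF P1]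
lemmas S2_sym = positive_saD(2)[OF P2]

lemma Hm_hilbert: "hilbert Hm1" "hilbert Hm2"
  using C1 C2 by (auto simp: is_completion_def)

lemma j_lin: "lin_on H Hm1 j1" "lin_on H Hm2 j2"
proof -
  have "j1 \<in> BL (H\<lparr>ip := (\<lambda>x y. ip H (S1 x) (S1 y))\<rparr>) Hm1" "j2 \<in> BL (H\<lparr>ip := (\<lambda>x y. ip H (S2 x) (S2 y))\<rparr>) Hm2"
    using C1 C2 unfolding is_completion_def by blast+
  from this[THEN BL_lin] show "lin_on H Hm1 j1" "lin_on H Hm2 j2" by (simp_all add: lin_on_def)
qed

lemma j_ip: "x \<in> carr H \<Longrightarrow> y \<in> carr H \<Longrightarrow> ip Hm1 (j1 x) (j1 y) = ip H (S1 x) (S1 y)"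
  "x \<in> carr H \<Longrightarrow> y \<in> carr H \<Longrightarrow> ip Hm2 (j2 x) (j2 y) = ip H (S2 x) (S2 y)"
  using C1 C2 unfolding is_completion_def by auto

lemma j_dense: "dense_in Hm1 (j1 ` carr H)" "dense_in Hm2 (j2 ` carr H)"
  using C1 C2 unfolding is_completion_def by auto

text \<open>
  The unitary extensions of S1 and S2 to the spaces of negative order.
\<close>

definition V1 where "V1 = bdd_ext Hm1 H j1 (carr H) S1"
definition V2 where "V2 = bdd_ext Hm2 H j2 (carr H) S2"

lemmas V1 = B.sqrt_completion[OF S1 C1, folded V1_def]
lemmas V2 = B2.sqrt_completion[OF S2 C2, folded V2_def]

lemma S2_D: "u \<in> carr H \<Longrightarrow> S2 u \<in> D" "u \<in> carr H \<Longrightarrow> b (S2 u) \<in> D"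
  using B2.sqrt_resolvent(2)[OF S2] B2_eq by blast+

text \<open>
  By sqrt_resolvent S2 maps H0 onto D(B^2), where u |-> t (B u) is bounded for the graph norm
  of B^2. The adjoint of this composition is the adjoint of the trace, transported to H0 by V2.
\<close>

lemma trace_S2_BL: "(\<lambda>u. t (b (S2 u))) \<in> BL H K"
proof -
  obtain C where C: "C \<ge> 0" "\<And>u. u \<in> carr (B.gs 1) \<Longrightarrow> hnorm K (t u) \<le> C * hnorm (B.gs 1) u"
    using BL_bound[OF t_BL[of 1]] by auto
  obtain C' where C': "C' \<ge> 0" "\<And>u. u \<in> carr H \<Longrightarrow> hnorm H (S2 u) \<le> C' * hnorm H u"
    using BL_bound[OF positive_saD(1)[OF P2]] by blast
  note L = BL_lin[OF positive_saD(1)[OF P2]]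
  show ?thesis
  proof (rule BL_I[where C = "C * (2 + C')"])
    show "lin_on H K (\<lambda>u. t (b (S2 u)))"
      by (rule lin_onI) (simp_all add: S2_D t_carr lin_on_add[OF L] lin_on_smul[OF L] B.t_simps t_simps)
    fix u assume u: "u \<in> carr H"
    let ?f = "S2 u"
    note f = S2_D[OF u]
    have bb: "hnorm H (b (b ?f)) \<le> hnorm H u"
      using B2.sqrt_resolvent(3)[OF S2 u] B2_eq(2)[OF f] by simp
    have "hnorm (B.gs 1) (b ?f) \<le> hnorm H (b (b ?f)) + hnorm H (b ?f)"
      using B.gs_le_add[of 1, OF _ f(2)] by simp
    also have "\<dots> \<le> hnorm H (b (b ?f)) + (hnorm H (b (b ?f)) + hnorm H ?f)"
      using B.t_interpolation[OF f] by simp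
    also have "\<dots> \<le> (2 + C') * hnorm H u" using bb C'(2)[OF u] by (simp add: algebra_simps)
    finally have "C * hnorm (B.gs 1) (b ?f) \<le> C * ((2 + C') * hnorm H u)" using C(1) by (rule mult_left_mono)
    then show "hnorm K (t (b ?f)) \<le> C * (2 + C') * hnorm H u" using C(2)[of "b ?f"] f by (simp add: mult.assoc)
  qed
qed

text \<open>
  The existence of an operator with the defining property has to be proved before anything is
  known about the chosen one.
\<close>

lemma tau_star_props:
  "tau_star M S2 Hm2 j2 \<in> BL K Hm2"
  "z \<in> carr K \<Longrightarrow> u \<in> carr H \<Longrightarrow> ip H (V2 (tau_star M S2 Hm2 j2 z)) u = ip K z (t (b (S2 u)))"
proof -
  define v where "v = bdd_adj H K (\<lambda>u. t (b (S2 u)))"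
  have vB: "v \<in> BL K H" and va: "\<And>u z. u \<in> carr H \<Longrightarrow> z \<in> carr K \<Longrightarrow> ip K (t (b (S2 u))) z = ip H u (v z)"
    using bdd_adj_props[OF H0 KS trace_S2_BL] unfolding v_def by blast+
  define T where "T z = inv_into (carr Hm2) V2 (v z)" for z
  have TB: "T \<in> BL K Hm2"
    using BL_comp[OF vB isometry_inverse_BL[OF Hm_hilbert(2) HS V2(1,3,4)]] unfolding T_def[abs_def] .
  have VT: "V2 (T z) = v z" if "z \<in> carr K" for z
    using V2(4) BL_carr[OF vB that] unfolding T_def by (metis bij_betw_imp_surj_on f_inv_into_f)
  have eq: "ip H (v z) u = ip K z (t (b (S2 u)))" if "z \<in> carr K" "u \<in> carr H" for z u
    using arg_cong[OF va[OF that(2,1)], of kconj] that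
    by (simp add: ip_conj[OF HS] ip_conj[OF KS] BL_carr[OF vB] t_carr S2_D)
  have tr: "trac M (emb M x) = t (b x)" if "x \<in> D" "b x \<in> D" for x
    using that by (simp add: trac_eq emb_carr V_emb)
  have inv: "inv_into (carr H) S2 x \<in> carr H" "S2 (inv_into (carr H) S2 x) = x" if "x \<in> Domain (opB M ^^ 2)" for x
    using that B2.sqrt_resolvent(2)[OF S2] by (metis inv_into_into, metis f_inv_into_f)
  have "\<exists>T. T \<in> BL K Hm2 \<and> (\<forall>\<zeta>\<in>carr K. \<forall>\<phi>\<in>carr (Hk M 2).
        ip H (bdd_ext Hm2 H j2 (carr H) S2 (T \<zeta>)) (inv_into (carr H) S2 \<phi>) = ip K \<zeta> (trac M (emb M \<phi>)))"
  proof (intro exI[of _ T] conjI ballI TB)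
    fix z x assume z: "z \<in> carr K" and x: "x \<in> carr (Hk M 2)"
    then have xD: "x \<in> D" "b x \<in> D" and xd: "x \<in> Domain (opB M ^^ 2)" using B2_eq(1)[of x] by auto
    show "ip H (bdd_ext Hm2 H j2 (carr H) S2 (T z)) (inv_into (carr H) S2 x) = ip K z (trac M (emb M x))"
      using eq[OF z inv(1)[OF xd]] VT[OF z] inv(2)[OF xd] tr[OF xD] by (simp add: V2_def)
  qed
  from someI_ex[OF this]
  have TS: "tau_star M S2 Hm2 j2 \<in> BL K Hm2" and TSp: "\<And>z x. z \<in> carr K \<Longrightarrow> x \<in> carr (Hk M 2) \<Longrightarrow>
      ip H (V2 (tau_star M S2 Hm2 j2 z)) (inv_into (carr H) S2 x) = ip K z (trac M (emb M x))"
    unfolding tau_star_def V2_def by blast+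
  show "tau_star M S2 Hm2 j2 \<in> BL K Hm2" by (rule TS)
  assume z: "z \<in> carr K" and u: "u \<in> carr H"
  have "S2 u \<in> Domain (opB M ^^ 2)" using B2.sqrt_resolvent(2)[OF S2] u by blast
  moreover have "inv_into (carr H) S2 (S2 u) = u" using B2.sqrt_resolvent(1)[OF S2] u by simp
  ultimately show "ip H (V2 (tau_star M S2 Hm2 j2 z)) u = ip K z (t (b (S2 u)))"
    using TSp[OF z, of "S2 u"] tr S2_D[OF u] by simp
qed

text \<open>
  This estimate is the inclusion of H_(-1) in H_(-2). It compares the forms of the two inverses:
  <y, x> with y = (B^4 + 1)^(-1) x is the product of y and (B^2 + 1)^(-1) x in H_1.
\<close>

lemma S2_le_S1: "x \<in> carr H \<Longrightarrow> hnorm H (S2 x) \<le> 3 * hnorm H (S1 x)"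
proof -
  assume x: "x \<in> carr H"
  let ?y = "B2.res 1 x" and ?z = "B.res 1 x"
  have yd: "?y \<in> Domain (opB M ^^ 2)" by (rule B2.res_props(1)[OF _ x]) simp
  then have y: "?y \<in> D" "b ?y \<in> D" by (simp_all add: B2_eq)
  have z: "?z \<in> D" by (rule B.res_props(1)[OF _ x]) simp
  have n2: "hnorm H (S2 x) = hnorm (B2.gs 1) ?y" by (rule B2.sqrt_norm[OF S2 x])
  have n1: "hnorm H (S1 x) = hnorm (B.gs 1) ?z" by (rule B.sqrt_norm[OF S1 x])
  have "hnorm (B.gs 1) ?y \<le> hnorm H (b ?y) + hnorm H ?y" using B.gs_le_add[of 1, OF _ y(1)] by simp
  also have "\<dots> \<le> hnorm H (b (b ?y)) + 2 * hnorm H ?y" using B.t_interpolation[OF y] by simp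
  also have "\<dots> \<le> 3 * hnorm (B2.gs 1) ?y"
    using B2.gs_le[of 1, OF _ yd] B2_eq(2)[OF y] by simp
  finally have y1: "hnorm (B.gs 1) ?y \<le> 3 * hnorm H (S2 x)" by (simp only: n2)
  have "(hnorm H (S2 x))\<^sup>2 = norm (ip H ?y x)" by (rule B2.sqrt_norm(2)[OF S2 x, symmetric])
  also have "ip H ?y x = ip (B.gs 1) ?y ?z" by (rule B.res_weak(1)[OF _ x y(1), symmetric]) simp
  also have "norm \<dots> \<le> hnorm (B.gs 1) ?y * hnorm (B.gs 1) ?z"
    using y z by (intro cauchy_schwarz[OF ips_semi[OF B.gs_ips]]) simp_all
  also have "\<dots> \<le> (3 * hnorm H (S2 x)) * hnorm H (S1 x)" unfolding n1 by (intro mult_right_mono y1) simp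
  finally have "hnorm H (S2 x) * hnorm H (S2 x) \<le> hnorm H (S2 x) * (3 * hnorm H (S1 x))"
    by (simp add: power2_eq_square mult_ac)
  then show ?thesis by (cases "hnorm H (S2 x) = 0") (auto simp: less_le)
qed

text \<open>
  If w = G(1) xi lies in D(B), then <xi, trac phi> = <w, (B^2 + 1) phi> for phi in D(B^2). The
  right-hand side is the pairing of phi with the element (B^2 + 1) w of H_(-1): writing w = S1 s,
  this element is the preimage X of s under the unitary V1. It remains to check that its
  image in H_(-2) is tau_star xi; then (H3.1) applies.
\<close>

theorem G_range_trivial:
  assumes H31: "tau_star M S2 Hm2 j2 ` carr K \<inter> Hneg1_in_Hneg2 M Hm1 j1 Hm2 j2 = {0}"
    and inj: "inj_on (tau_star M S2 Hm2 j2) (carr K)"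
    and xi: "\<xi> \<in> carr K" and GD: "G M 1 \<xi> \<in> D"
  shows "\<xi> = 0"
proof -
  let ?T = "tau_star M S2 Hm2 j2"
  define w where "w = G M 1 \<xi>"
  have w: "w \<in> D" "w = b (g 1 \<xi>)" using GD xi by (simp_all add: w_def G_eq)
  have gD: "g 1 \<xi> \<in> D" using xi by (simp add: g_D)
  have wform: "ip K \<xi> (t (b x)) = ip H w (b (b x) + x)" if "x \<in> D" "b x \<in> D" for x
  proof -
    have "ip K (t (b x)) \<xi> = ip H (b (b x)) w + ip H x w"
      using g_adj'[of 1 "b x" \<xi>] that xi w B.sym[OF that(1) gD] by simp
    then have "ip K (t (b x)) \<xi> = ip H (b (b x) + x) w"
      using that w(1) by (simp add: ip_simps[OF HS] B.D_carr B.t_carr)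
    from arg_cong[OF this, of kconj] show ?thesis
      using that xi w(1) by (simp add: ip_conj[OF HS] ip_conj[OF KS] B.D_carr B.t_carr t_carr cs)
  qed
  define E where "E = bdd_ext Hm1 Hm2 j1 (carr H) j2"
  have jn: "hnorm Hm2 (j2 x) \<le> 3 * hnorm Hm1 (j1 x)" if "x \<in> carr H" for x
    using S2_le_S1[OF that] that by (simp add: hnorm_def j_ip)
  have EB: "E \<in> BL Hm1 Hm2" unfolding E_def
    by (rule bdd_ext_props(1)[OF HS Hm_hilbert(1) Hm_hilbert(2) j_lin(1) j_dense(1) j_lin(2)])
      (rule jn)
  have Ej: "E (j1 x) = j2 x" if x: "x \<in> carr H" for x unfolding E_def
    by (rule bdd_ext_props(2)[OF HS Hm_hilbert(1) Hm_hilbert(2) j_lin(1) j_dense(1) j_lin(2) _ x])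
      (rule jn)
  have "w \<in> S1 ` carr H" using B.sqrt_resolvent(2)[OF S1] w(1) by simp
  then obtain s where s: "s \<in> carr H" "S1 s = w" by (metis imageE)
  define X where "X = inv_into (carr Hm1) V1 s"
  have X: "X \<in> carr Hm1" "V1 X = s" using V1(4) s(1) unfolding X_def
    by (metis bij_betw_imp_surj_on inv_into_into f_inv_into_f)+
  have EX: "E X \<in> carr Hm2" and TX: "?T \<xi> \<in> carr Hm2"
    using BL_carr[OF EB X(1)] BL_carr[OF tau_star_props(1) xi] .
  have QB: "(\<lambda>x. V2 (E x)) \<in> BL Hm1 H" by (rule BL_comp[OF EB V2(1)])
  note Q = bdd_adj_props[OF Hm_hilbert(1) HS QB]
  have "V2 (E X) = V2 (?T \<xi>)"
  proof -
    have "ip H (V2 (E X)) u = ip H (V2 (?T \<xi>)) u" if u: "u \<in> carr H" for u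
    proof -
      let ?f = "S2 u"
      note f = S2_D[OF u]
      have fH: "?f \<in> carr H" "b (b ?f) \<in> carr H" using f B.D_carr B.t_carr by auto
      define x0 where "x0 = b (b ?f) + ?f"
      have x0: "x0 \<in> carr H" using fH by (simp add: x0_def cs)
      have r0: "B.res 1 x0 = ?f" using f by (intro B.res_unique) (simp_all add: x0_def smul_one[OF HS])
      let ?q = "bdd_adj Hm1 H (\<lambda>x. V2 (E x)) u"
      have q: "?q \<in> carr Hm1" using BL_carr[OF Q(1) u] .
      have j1x: "j1 x \<in> carr Hm1" if "x \<in> carr H" for x using lin_on_carr[OF j_lin(1) that] .
      \<comment> \<open>The adjoint of the inclusion followed by V2 sends u to the image of (B^2 + 1) S2 u; this is checked on the dense image of H0.\<close>
      have "?q - j1 x0 = 0"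
      proof (rule dense_orthogonal[OF hilbert_ips[OF Hm_hilbert(1)] j_dense(1)])
        show "?q - j1 x0 \<in> carr Hm1" using q j1x[OF x0] by (simp add: carr_diff[OF hilbert_semi[OF Hm_hilbert(1)]])
        fix d assume "d \<in> j1 ` carr H"
        then obtain y where y: "y \<in> carr H" "d = j1 y" by blast
        have "ip Hm1 d ?q = ip H y ?f"
          using Q(2)[OF j1x[OF y(1)] u] y u by (simp add: Ej V2(2) S2_sym)
        moreover have "ip Hm1 d (j1 x0) = ip H y ?f"
          using y x0 r0 by (simp add: j_ip S1_sym S1_carr S1S1)
        ultimately show "ip Hm1 d (?q - j1 x0) = 0"
          using y j1x x0 q by (simp add: ip_simps[OF hilbert_semi[OF Hm_hilbert(1)]])
      qed
      then have qe: "?q = j1 x0" by simp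
      have "ip H (V2 (E X)) u = ip Hm1 X (j1 x0)" using Q(2)[OF X(1) u] qe by simp
      also have "\<dots> = ip H (V1 X) (V1 (j1 x0))" by (rule V1(3)[OF X(1) j1x[OF x0], symmetric])
      also have "\<dots> = ip H w x0" using V1(2)[OF x0] X(2) s x0 by (simp add: S1_sym[symmetric])
      also have "\<dots> = ip H (V2 (?T \<xi>)) u"
        unfolding tau_star_props(2)[OF xi u] wform[OF f] x0_def ..
      finally show ?thesis .
    qed
    then have "V2 (E X) - V2 (?T \<xi>) = 0"
      using BL_carr[OF V2(1) EX] BL_carr[OF V2(1) TX]
      by (intro ip_self_eq_0[OF HI]) (simp_all add: cs ip_simps[OF HS])
    then show ?thesis by simp
  qed
  then have "E X = ?T \<xi>" using V2(4) EX TX by (metis bij_betw_imp_inj_on inj_onD)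
  then have "?T \<xi> \<in> ?T ` carr K \<inter> Hneg1_in_Hneg2 M Hm1 j1 Hm2 j2"
    using xi X(1) unfolding Hneg1_in_Hneg2_def E_def by (metis IntI imageI)
  then have "?T \<xi> = 0" using H31 by blast
  also have "0 = ?T 0" using lin_on_0[OF KS hilbert_semi[OF Hm_hilbert(2)] BL_lin[OF tau_star_props(1)]] by simp
  finally show ?thesis using inj_onD[OF inj] xi cs by blast
qed

end

end

section \<open>The weak form of the perturbed operator\<close>

lemma ap_graph_on: "x \<in> carr X \<Longrightarrow> ap (graph_on X F) x = F x"
  by (auto simp: ap_def graph_on_def)

lemma graph_on_cong: "(\<And>x. x \<in> carr X \<Longrightarrow> F x = F' x) \<Longrightarrow> graph_on X F = graph_on X F'"
  unfolding graph_on_def by (rule Collect_cong) metis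

text \<open>
  Condition (H3.1) in the form provided by G_range_trivial.
\<close>

locale regular_wave = wave M
  for M :: "('k::rc_scalar, 'a::ab_group_add, 'b::ab_group_add, 'h::ab_group_add) wave_data" +
  assumes regular: "\<xi> \<in> carr K \<Longrightarrow> G M 1 \<xi> \<in> D \<Longrightarrow> \<xi> = 0"
begin

\<comment> \<open>Membership in the domain of B is treated as an atomic condition from here on.\<close>
declare DomainE [rule del]

text \<open>
  The relation between a second component psi of the domain, the image omega under Bbar of the
  first component of the value, and the last component eta of the value.
\<close>

definition weak :: "'a \<Rightarrow> 'a \<Rightarrow> 'h \<Rightarrow> bool" where
  "weak \<psi> \<omega> \<eta> \<longleftrightarrow> \<psi> \<in> carr H \<and> \<omega> \<in> carr H \<and> \<eta> \<in> carr K \<and>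
     (\<forall>u\<in>D. ip H (b u) \<psi> = ip H u \<omega> + ip K (t u) \<eta>)"

lemma weakD: "weak \<psi> \<omega> \<eta> \<Longrightarrow> u \<in> D \<Longrightarrow> ip H (b u) \<psi> = ip H u \<omega> + ip K (t u) \<eta>"
  and weak_carr: "weak \<psi> \<omega> \<eta> \<Longrightarrow> \<psi> \<in> carr H \<and> \<omega> \<in> carr H \<and> \<eta> \<in> carr K"
  by (simp_all add: weak_def)

text \<open>
  The hypothesis gives <Bu, G(1) xi> = <u, a - g 1 xi>, so that G(1) xi lies in the domain of the
  adjoint of B.
\<close>

lemma trace_unbounded:
  assumes a: "a \<in> carr H" and xi: "\<xi> \<in> carr K" and eq: "\<And>u. u \<in> D \<Longrightarrow> ip K (t u) \<xi> = ip H u a"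
  shows "\<xi> = 0"
proof (rule regular[OF xi])
  have gD: "g 1 \<xi> \<in> D" using xi by (simp add: g_D)
  have "ip H (b u) (b (g 1 \<xi>)) = ip H u (a - g 1 \<xi>)" if u: "u \<in> D" for u
    using eq[OF u] g_adj'[of 1 u \<xi>] u xi a gD by (simp add: ip_simps[OF HS] B.D_carr eq_diff_eq)
  from B.graphI(1)[OF B.t_carr[OF gD] _ this] show "G M 1 \<xi> \<in> D"
    using a gD xi by (simp add: cs B.D_carr G_eq)
qed

lemma weak_diff: "weak \<psi> \<omega> \<eta> \<Longrightarrow> weak \<psi>' \<omega>' \<eta>' \<Longrightarrow> weak (\<psi> - \<psi>') (\<omega> - \<omega>') (\<eta> - \<eta>')"
  unfolding weak_def by (simp add: cs ip_simps[OF HS] ip_simps[OF KS] B.D_carr B.t_carr t_carr)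

lemma weak_add: "weak \<psi> \<omega> \<eta> \<Longrightarrow> weak \<psi>' \<omega>' \<eta>' \<Longrightarrow> weak (\<psi> + \<psi>') (\<omega> + \<omega>') (\<eta> + \<eta>')"
  unfolding weak_def by (simp add: cs ip_simps[OF HS] ip_simps[OF KS] B.D_carr B.t_carr t_carr)

lemma weak_smul: "weak \<psi> \<omega> \<eta> \<Longrightarrow> weak (smul H c \<psi>) (smul H c \<omega>) (smul K c \<eta>)"
  unfolding weak_def by (simp add: cs ip_simps[OF HS] ip_simps[OF KS] B.D_carr B.t_carr t_carr algebra_simps)

lemma weak_0: "weak 0 \<omega> \<eta> \<Longrightarrow> \<omega> = 0 \<and> \<eta> = 0"
proof -
  assume r: "weak 0 \<omega> \<eta>"
  note c = weak_carr[OF r]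
  have eq: "ip K (t u) \<eta> = ip H u (- \<omega>)" if "u \<in> D" for u
    using weakD[OF r that] that c by (simp add: ip_simps[OF HS] B.D_carr B.t_carr eq_neg_iff_add_eq_0 add.commute)
  have e0: "\<eta> = 0" by (rule trace_unbounded[OF _ _ eq]) (use c in \<open>simp_all add: cs\<close>)
  have "\<omega> = 0"
  proof (rule dense_orthogonal[OF HI B.D_dense])
    show "ip H u \<omega> = 0" if "u \<in> D" for u
      using eq[OF that] e0 that c by (simp add: ip_simps[OF HS] ip_simps[OF KS] B.D_carr t_carr)
  qed (use c in simp)
  then show ?thesis using e0 by simp
qed

lemma weak_unique: "weak \<psi> \<omega> \<eta> \<Longrightarrow> weak \<psi> \<omega>' \<eta>' \<Longrightarrow> \<omega> = \<omega>' \<and> \<eta> = \<eta>'"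
  using weak_0[of "\<omega> - \<omega>'" "\<eta> - \<eta>'"] weak_diff[of \<psi> \<omega> \<eta> \<psi> \<omega>' \<eta>'] by simp

text \<open>
  The definition of g l turns <Bu, B (g l eta)> into <t u, eta> - l^2 <u, g l eta>.
\<close>

lemma weak_of_decomposition:
  assumes l: "l \<noteq> 0" and p: "\<psi>l \<in> D" and e: "\<eta> \<in> carr K"
  shows "weak (\<psi>l + G M l \<eta>) (b \<psi>l - smul H (of_real (l\<^sup>2)) (g l \<eta>)) \<eta>"
proof -
  have gD: "g l \<eta> \<in> D" using l e by (simp add: g_D)
  have "ip H (b u) (\<psi>l + b (g l \<eta>)) = ip H u (b \<psi>l - smul H (of_real (l\<^sup>2)) (g l \<eta>)) + ip K (t u) \<eta>"
    if u: "u \<in> D" for u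
    using u p gD B.sym[OF u p] g_adj'[OF l u e]
    by (simp add: ip_simps[OF HS] B.D_carr B.t_carr cs del: of_real_power)
  then show ?thesis
    unfolding weak_def using p e gD l by (simp add: G_eq cs B.D_carr B.t_carr)
qed

text \<open>
  Conversely, the weak identity says that psi - B (g l eta) lies in the domain of the adjoint of B.
\<close>

lemma weak_decomposition:
  assumes l: "l \<noteq> 0" and r: "weak \<psi> \<omega> \<eta>"
  obtains \<psi>l where "\<psi>l \<in> D" "\<psi> = \<psi>l + G M l \<eta>" "\<omega> = b \<psi>l - smul H (of_real (l\<^sup>2)) (g l \<eta>)"
proof -
  note c = weak_carr[OF r]
  have gD: "g l \<eta> \<in> D" using l c by (simp add: g_D)
  let ?p = "\<psi> - b (g l \<eta>)" and ?q = "\<omega> + smul H (of_real (l\<^sup>2)) (g l \<eta>)"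
  have pq: "?p \<in> carr H" "?q \<in> carr H" using c gD by (simp_all add: cs B.D_carr B.t_carr)
  have "ip H (b u) ?p = ip H u ?q" if u: "u \<in> D" for u
    using u gD c weakD[OF r u] g_adj'[OF l u, of \<eta>]
    by (simp add: ip_simps[OF HS] B.D_carr B.t_carr cs del: of_real_power)
  note m = B.graphI[OF pq this]
  show thesis by (rule that[of ?p]) (use m l c in \<open>simp_all add: G_eq\<close>)
qed

lemma psi0:
  assumes l: "l \<noteq> 0" and p: "\<psi>l \<in> D" and e: "\<eta> \<in> carr K"
  shows psi0_carr: "psi0 M l \<psi>l \<eta> \<in> carr (H1bar M)"
    and V_psi0: "V (psi0 M l \<psi>l \<eta>) = b \<psi>l - smul H (of_real (l\<^sup>2)) (g l \<eta>)"
proof -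
  have gD: "g l \<eta> \<in> D" using l e by (simp add: g_D)
  have eq: "psi0 M l \<psi>l \<eta> = emb M \<psi>l - smul (H1bar M) (of_real (l\<^sup>2)) (iV (g l \<eta>))"
    by (simp only: psi0_def G_eq[OF l e] ap_converse[OF gD])
  show "psi0 M l \<psi>l \<eta> \<in> carr (H1bar M)"
    unfolding eq using p gD by (simp add: Ycs emb_carr iV_carr B.D_carr)
  show "V (psi0 M l \<psi>l \<eta>) = b \<psi>l - smul H (of_real (l\<^sup>2)) (g l \<eta>)"
    unfolding eq using p gD by (simp add: V_simps Ycs emb_carr iV_carr B.D_carr V_iV V_emb)
qed

text \<open>
  The perturbed operator, described without reference to l.
\<close>

definition Wrel :: "(('b \<times> 'a \<times> 'h) \<times> ('b \<times> 'a \<times> 'h)) set" where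
  "Wrel = {((\<phi>, \<psi>, \<zeta>), (\<omega>, - b (V \<phi>), \<eta>)) | \<phi> \<psi> \<zeta> \<omega> \<eta>.
     \<phi> \<in> carr (H1bar M) \<and> V \<phi> \<in> D \<and> \<zeta> \<in> carr K \<and> Th \<zeta> = t (V \<phi>) \<and>
     \<omega> \<in> carr (H1bar M) \<and> weak \<psi> (V \<omega>) \<eta>}"

lemma Wrel_iff: "((\<phi>, \<psi>, \<zeta>), (\<omega>, \<pi>, \<eta>)) \<in> Wrel \<longleftrightarrow> \<pi> = - b (V \<phi>) \<and>
     \<phi> \<in> carr (H1bar M) \<and> V \<phi> \<in> D \<and> \<zeta> \<in> carr K \<and> Th \<zeta> = t (V \<phi>) \<and>
     \<omega> \<in> carr (H1bar M) \<and> weak \<psi> (V \<omega>) \<eta>"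
  by (auto simp: Wrel_def)

lemma Htot_simps [simp]: "carr (Htot M) = carr (H1bar M) \<times> carr H \<times> carr K"
  "smul (Htot M) c (x, y, z) = (smul (H1bar M) c x, smul H c y, smul K c z)"
  "ip (Htot M) (x, y, z) (x', y', z') = ip H (V x) (V x') + (ip H y y' + ip K (Th z) z')"
  by (simp_all add: Htot_def hTheta_eq)

lemma WTheta_eq:
  assumes l: "l \<noteq> 0"
  shows "WTheta M l = Wrel"
proof (intro equalityI subsetI)
  fix w assume "w \<in> WTheta M l"
  then obtain \<phi> \<psi> \<zeta> \<psi>l \<eta> where w: "w = ((\<phi>, \<psi>, \<zeta>), (psi0 M l \<psi>l \<eta>, Abar M \<phi>, \<eta>))"
    and d: "(\<phi>, \<psi>, \<zeta>) \<in> DWTheta M l" and p: "\<psi>l \<in> D" and e: "\<eta> \<in> carr K" and psi: "\<psi> = \<psi>l + G M l \<eta>"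
    unfolding WTheta_def by auto
  show "w \<in> Wrel"
    using d weak_of_decomposition[OF l p e] psi0[OF l p e] unfolding w Wrel_iff
    by (auto simp: DWTheta_def Abar_def psi trac_eq)
next
  fix w assume "w \<in> Wrel"
  then obtain \<phi> \<psi> \<zeta> \<omega> \<eta> where w: "w = ((\<phi>, \<psi>, \<zeta>), (\<omega>, - b (V \<phi>), \<eta>))" and
    f: "\<phi> \<in> carr (H1bar M)" "V \<phi> \<in> D" "\<zeta> \<in> carr K" "Th \<zeta> = t (V \<phi>)" "\<omega> \<in> carr (H1bar M)" and r: "weak \<psi> (V \<omega>) \<eta>"
    unfolding Wrel_def by blast
  note c = weak_carr[OF r]
  obtain \<psi>l where p: "\<psi>l \<in> D" "\<psi> = \<psi>l + G M l \<eta>" "V \<omega> = b \<psi>l - smul H (of_real (l\<^sup>2)) (g l \<eta>)"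
    using weak_decomposition[OF l r] by blast
  have "\<omega> = psi0 M l \<psi>l \<eta>"
    using c p by (intro V_inj[OF f(5) psi0_carr[OF l p(1)]]) (simp_all add: V_psi0 l)
  moreover have "(\<phi>, \<psi>, \<zeta>) \<in> DWTheta M l"
    using f c p by (auto simp: DWTheta_def trac_eq)
  ultimately show "w \<in> WTheta M l"
    unfolding WTheta_def using w p c by (auto simp: Abar_def)
qed

lemma hTheta_ips: "inner_product_space (hTheta M)"
proof -
  have "z = 0" if "z \<in> carr (hTheta M)" "ip (hTheta M) z z = 0" for z
  proof -
    have z: "z \<in> carr K" using that(1) by (simp add: hTheta_eq)
    have n: "hnorm (hTheta M) z = 0" using that(2) by (simp add: hnorm_def)
    have "ip K w (Th z) = 0" if w: "w \<in> carr K" for w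
    proof -
      have "norm (ip K (Th z) w) \<le> 0" using Theta_cs[OF z w] n by simp
      then show ?thesis using norm_ip_commute[OF KS Th_carr[OF z] w] by simp
    qed
    then show ?thesis using ip_all_0[OF KI Th_carr[OF z]] Th_inj[OF z] by blast
  qed
  then show ?thesis using Theta_semi by (simp add: inner_product_space_iff_semi)
qed

lemmas Y1I = hilbert_ips[OF Hbar1]
lemmas Y1S = hilbert_semi[OF Hbar1]
lemmas TS = ips_semi[OF hTheta_ips]

lemma Htot_def': "Htot M = Hbar M (Suc 0) \<oplus>\<^sub>H H \<oplus>\<^sub>H hTheta M" by (simp add: Htot_def)

lemma Htot_ips: "inner_product_space (Htot M)"
  unfolding Htot_def' by (intro dsum_ips Y1I HI hTheta_ips)

lemmas ZS = ips_semi[OF Htot_ips]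

lemma Wrel_carr: "(x, y) \<in> Wrel \<Longrightarrow> x \<in> carr (Htot M) \<and> y \<in> carr (Htot M)"
  by (cases x; cases y) (auto simp: Wrel_iff weak_carr cs B.t_carr dest: weak_carr)

lemma Wrel_diff: "(x, y) \<in> Wrel \<Longrightarrow> (x', y') \<in> Wrel \<Longrightarrow> (x - x', y - y') \<in> Wrel"
  by (cases x; cases y; cases x'; cases y')
    (auto simp: Wrel_iff V_simps B.D_simps B.t_simps t_simps Th_simps Ycs cs intro!: weak_diff)

lemma Wrel_lin_op: "lin_op (Htot M) (Htot M) Wrel"
  unfolding lin_op_def module_subspace_iff[OF dsum_vs[OF semi_vs[OF ZS] semi_vs[OF ZS]]]
proof (intro conjI ballI allI)
  show "Wrel \<subseteq> carr (Htot M) \<times> carr (Htot M)" using Wrel_carr by auto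
  show "single_valued Wrel"
    unfolding single_valued_def
  proof (intro allI impI)
    fix x y z assume "(x, y) \<in> Wrel" "(x, z) \<in> Wrel"
    then show "y = z"
      by (cases x; cases y; cases z) (auto simp: Wrel_iff dest: weak_unique intro: V_inj)
  qed
  have "weak 0 0 0" by (simp add: weak_def cs ip_simps[OF HS] ip_simps[OF KS] B.D_carr B.t_carr t_carr)
  then show "0 \<in> Wrel"
    unfolding zero_prod_def by (simp add: Wrel_iff V_simps B.D_simps B.t_simps t_simps Th_simps Ycs cs)
  show "x + y \<in> Wrel" if "x \<in> Wrel" "y \<in> Wrel" for x y
    using that by (cases x; cases y)
      (auto simp: Wrel_iff V_simps B.D_simps B.t_simps t_simps Th_simps Ycs cs intro!: weak_add)
  show "smul (Htot M \<oplus>\<^sub>H Htot M) c x \<in> Wrel" if "x \<in> Wrel" for x c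
    using that by (cases x)
      (auto simp: Wrel_iff V_simps B.D_simps B.t_simps t_simps Th_simps Ycs cs smul_simps[OF HS] intro!: weak_smul)
qed

text \<open>
  Each weak identity is tested with the first component of the other element, transported by Bbar;
  the trace terms become Theta products because t (Bbar phi) = Theta zeta on the domain.
\<close>

lemma Wrel_skew:
  assumes "(x, y) \<in> Wrel" "(x', y') \<in> Wrel"
  shows "ip (Htot M) y x' = - ip (Htot M) x y'"
proof -
  obtain \<phi> \<psi> \<zeta> \<omega> \<eta> where x: "x = (\<phi>, \<psi>, \<zeta>)" "y = (\<omega>, - b (V \<phi>), \<eta>)" and
    f: "\<phi> \<in> carr (H1bar M)" "V \<phi> \<in> D" "\<zeta> \<in> carr K" "Th \<zeta> = t (V \<phi>)" "\<omega> \<in> carr (H1bar M)" and r: "weak \<psi> (V \<omega>) \<eta>"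
    using assms(1) unfolding Wrel_def by blast
  obtain \<phi>' \<psi>' \<zeta>' \<omega>' \<eta>' where x': "x' = (\<phi>', \<psi>', \<zeta>')" "y' = (\<omega>', - b (V \<phi>'), \<eta>')" and
    f': "\<phi>' \<in> carr (H1bar M)" "V \<phi>' \<in> D" "\<zeta>' \<in> carr K" "Th \<zeta>' = t (V \<phi>')" "\<omega>' \<in> carr (H1bar M)" and r': "weak \<psi>' (V \<omega>') \<eta>'"
    using assms(2) unfolding Wrel_def by blast
  note c = weak_carr[OF r] weak_carr[OF r']
  have 1: "ip H (b (V \<phi>)) \<psi>' = ip H (V \<phi>) (V \<omega>') + ip K (Th \<zeta>) \<eta>'"
    using weakD[OF r' f(2)] f(4) by simp
  have "ip H (b (V \<phi>')) \<psi> = ip H (V \<phi>') (V \<omega>) + ip K (Th \<zeta>') \<eta>"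
    using weakD[OF r f'(2)] f'(4) by simp
  from arg_cong[OF this, of kconj]
  have 2: "ip H \<psi> (b (V \<phi>')) = ip H (V \<omega>) (V \<phi>') + ip K \<eta> (Th \<zeta>')"
    using f f' c by (simp add: kconj_add ip_conj[OF HS] ip_conj[OF KS] B.t_carr B.D_carr V_carr t_carr)
  show ?thesis
    unfolding x x' using f f' c 1 2
    by (simp add: ip_simps[OF HS] B.t_carr Th_sym V_carr)
qed

section \<open>Solving the resolvent equation\<close>

text \<open>
  The solution p of (B^2 + l^2) p = B beta + l alpha in the weak sense, where B beta need not
  exist: the first component, transported by Bbar, of the resolvent of the free operator.
\<close>

definition p0 :: "real \<Rightarrow> 'a \<Rightarrow> 'a \<Rightarrow> 'a" where
  "p0 l \<alpha> \<beta> = smul H (of_real l) (B.res (l\<^sup>2) \<alpha>) + b (B.res (l\<^sup>2) \<beta>)"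

lemma p0:
  assumes l: "l \<noteq> 0" and a: "\<alpha> \<in> carr H" and be: "\<beta> \<in> carr H"
  shows p0_D: "p0 l \<alpha> \<beta> \<in> D"
    and p0_weak: "\<And>u. u \<in> D \<Longrightarrow> ip H (b u) (b (p0 l \<alpha> \<beta>)) + of_real (l\<^sup>2) * ip H u (p0 l \<alpha> \<beta>)
      = ip H (b u) \<beta> + of_real l * ip H u \<alpha>"
proof -
  have c: "l\<^sup>2 > 0" using l by simp
  note ra = B.res_props[OF c a] and rb = B.res_props[OF c be]
  show "p0 l \<alpha> \<beta> \<in> D" using ra rb by (simp add: p0_def B.D_simps)
  fix u assume u: "u \<in> D"
  have 1: "ip H (b u) (b (B.res (l\<^sup>2) \<alpha>)) = ip H u \<alpha> - of_real (l\<^sup>2) * ip H u (B.res (l\<^sup>2) \<alpha>)"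
    using B.res_weak(1)[OF c a u] unfolding B.gs_simps by (metis add_diff_cancel_right')
  have 2: "ip H (b u) (b (b (B.res (l\<^sup>2) \<beta>))) = ip H (b u) \<beta> - of_real (l\<^sup>2) * ip H u (b (B.res (l\<^sup>2) \<beta>))"
    unfolding B.res_tt[OF c be] using u be rb B.sym[OF u rb(1)]
    by (simp add: ip_simps[OF HS] cs B.D_carr B.t_carr del: of_real_power)
  show "ip H (b u) (b (p0 l \<alpha> \<beta>)) + of_real (l\<^sup>2) * ip H u (p0 l \<alpha> \<beta>) = ip H (b u) \<beta> + of_real l * ip H u \<alpha>"
    using ra(1,2) rb(1,2) u unfolding p0_def
    by (simp add: 1 2 B.t_simps B.D_simps ip_simps[OF HS] cs B.D_carr B.t_carr algebra_simps del: of_real_power)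
qed

lemma p0_unique:
  assumes l: "l \<noteq> 0" and a: "\<alpha> \<in> carr H" and be: "\<beta> \<in> carr H" and p: "p \<in> D"
    and w: "\<And>u. u \<in> D \<Longrightarrow> ip H (b u) (b p) + of_real (l\<^sup>2) * ip H u p = ip H (b u) \<beta> + of_real l * ip H u \<alpha>"
  shows "p0 l \<alpha> \<beta> = p"
proof -
  have c: "l\<^sup>2 > 0" using l by simp
  note q = p0_D[OF l a be] and qw = p0_weak[OF l a be]
  let ?d = "p0 l \<alpha> \<beta> - p"
  have d: "?d \<in> D" using p q by (simp add: B.D_diff)
  have "ip (B.gs (l\<^sup>2)) ?d ?d = 0"
    using qw[OF d] w[OF d] p q d
    by (simp add: B.t_diff ip_diff_right[OF HS] B.D_carr B.t_carr cs algebra_simps del: of_real_power)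
  from ip_self_eq_0[OF B.gs_ips[OF c] _ this] have "?d = 0" using d by simp
  then show ?thesis by simp
qed

lemma p0_second:
  assumes l: "l \<noteq> 0" and a: "\<alpha> \<in> carr H" and be: "\<beta> \<in> carr H"
  shows "\<beta> - b (p0 l \<alpha> \<beta>) \<in> D"
    "b (\<beta> - b (p0 l \<alpha> \<beta>)) = smul H (of_real (l\<^sup>2)) (p0 l \<alpha> \<beta>) - smul H (of_real l) \<alpha>"
proof -
  note q = p0_D[OF l a be]
  have e: "ip H (b u) (\<beta> - b (p0 l \<alpha> \<beta>)) = ip H u (smul H (of_real (l\<^sup>2)) (p0 l \<alpha> \<beta>) - smul H (of_real l) \<alpha>)"
    if u: "u \<in> D" for u
    using p0_weak[OF l a be u] q u a be
    by (simp add: ip_simps[OF HS] B.D_carr B.t_carr cs algebra_simps del: of_real_power)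
  have c: "\<beta> - b (p0 l \<alpha> \<beta>) \<in> carr H" "smul H (of_real (l\<^sup>2)) (p0 l \<alpha> \<beta>) - smul H (of_real l) \<alpha> \<in> carr H"
    using q a be by (simp_all add: B.D_carr B.t_carr cs)
  show "\<beta> - b (p0 l \<alpha> \<beta>) \<in> D"
    "b (\<beta> - b (p0 l \<alpha> \<beta>)) = smul H (of_real (l\<^sup>2)) (p0 l \<alpha> \<beta>) - smul H (of_real l) \<alpha>"
    using B.graphI[OF c e] by blast+
qed

text \<open>
  The resolvent of the unperturbed operator in terms of p0.
\<close>

definition free_res :: "real \<Rightarrow> 'b \<times> 'a \<times> 'h \<Rightarrow> 'b \<times> 'a \<times> 'h" where
  "free_res l = (\<lambda>(\<phi>, \<psi>, \<zeta>). (iV (p0 l (V \<phi>) \<psi>), smul H (of_real (1 / l)) (\<psi> - b (p0 l (V \<phi>) \<psi>)),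
     smul K (of_real (1 / l)) \<zeta>))"

lemma smul_inv_cancel: "semi_ip_space X \<Longrightarrow> l \<noteq> 0 \<Longrightarrow> smul X (of_real l) (smul X (of_real (1 / l)) x) = x"
  "semi_ip_space X \<Longrightarrow> l \<noteq> 0 \<Longrightarrow> smul X (of_real (1 / l)) (smul X (of_real l) x) = x"
  by (simp_all add: smul_smul smul_one flip: of_real_mult)

lemma free_res_second:
  assumes l: "l \<noteq> 0" and a: "\<alpha> \<in> carr H" and be: "\<beta> \<in> carr H"
  shows "smul H (of_real (1 / l)) (\<beta> - b (p0 l \<alpha> \<beta>)) \<in> D"
    "b (smul H (of_real (1 / l)) (\<beta> - b (p0 l \<alpha> \<beta>))) = smul H (of_real l) (p0 l \<alpha> \<beta>) - \<alpha>"
proof -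
  note s = p0_second[OF l a be]
  show "smul H (of_real (1 / l)) (\<beta> - b (p0 l \<alpha> \<beta>)) \<in> D" by (rule B.D_smul[OF s(1)])
  have "b (smul H (of_real (1 / l)) (\<beta> - b (p0 l \<alpha> \<beta>)))
      = smul H (of_real (1 / l)) (smul H (of_real l) (smul H (of_real l) (p0 l \<alpha> \<beta>) - \<alpha>))"
    unfolding B.t_smul[OF s(1)] s(2) by (simp add: smul_diff_right[OF HS] smul_smul[OF HS] power2_eq_square)
  then show "b (smul H (of_real (1 / l)) (\<beta> - b (p0 l \<alpha> \<beta>))) = smul H (of_real l) (p0 l \<alpha> \<beta>) - \<alpha>"
    by (simp only: smul_inv_cancel[OF HS l])
qed

lemma resolvent_Wtilde:
  assumes l: "l \<noteq> 0"
  shows "resolvent (Htot M) (Wtilde M) l = graph_on (Htot M) (free_res l)"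
proof (intro equalityI subsetI)
  fix w assume "w \<in> resolvent (Htot M) (Wtilde M) l"
  then obtain \<phi> \<psi> \<zeta> where f: "\<phi> \<in> carr (H1bar M)" "V \<phi> \<in> D" and p: "\<psi> \<in> D" and z: "\<zeta> \<in> carr K"
    and w: "w = (- (emb M \<psi>, - b (V \<phi>), 0) + smul (Htot M) (of_real l) (\<phi>, \<psi>, \<zeta>), (\<phi>, \<psi>, \<zeta>))"
    unfolding resolvent_def Wtilde_def by (auto simp: Abar_def hTheta_eq)
  let ?a = "smul (H1bar M) (of_real l) \<phi> - emb M \<psi>" and ?b = "smul H (of_real l) \<psi> + b (V \<phi>)"
    and ?c = "smul K (of_real l) \<zeta>"
  have w': "w = ((?a, ?b, ?c), (\<phi>, \<psi>, \<zeta>))" by (simp add: w)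
  have car: "?a \<in> carr (H1bar M)" "?b \<in> carr H" "?c \<in> carr K"
    using f p z by (simp_all add: Ycs emb_carr cs B.D_carr B.t_carr)
  have Va: "V ?a = smul H (of_real l) (V \<phi>) - b \<psi>" using f p by (simp add: V_simps Ycs emb_carr V_emb)
  have "p0 l (V ?a) ?b = V \<phi>"
  proof (rule p0_unique[OF l V_carr[OF car(1)] car(2) f(2)])
    fix u assume u: "u \<in> D"
    show "ip H (b u) (b (V \<phi>)) + of_real (l\<^sup>2) * ip H u (V \<phi>) = ip H (b u) ?b + of_real l * ip H u (V ?a)"
      unfolding Va using u f p B.sym[OF u p]
      by (simp add: ip_simps[OF HS] B.D_carr B.t_carr cs algebra_simps power2_eq_square)
  qed
  then have "free_res l (?a, ?b, ?c) = (\<phi>, \<psi>, \<zeta>)"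
    using f by (simp add: free_res_def iV_V smul_inv_cancel[OF HS l] smul_inv_cancel[OF KS l] del: of_real_divide)
  then show "w \<in> graph_on (Htot M) (free_res l)" unfolding w' graph_on_def using car by auto
next
  fix w assume "w \<in> graph_on (Htot M) (free_res l)"
  then obtain a \<beta> c where w: "w = ((a, \<beta>, c), free_res l (a, \<beta>, c))"
    and car: "a \<in> carr (H1bar M)" "\<beta> \<in> carr H" "c \<in> carr K"
    unfolding graph_on_def by auto
  let ?p = "p0 l (V a) \<beta>"
  let ?s = "smul H (of_real (1 / l)) (\<beta> - b ?p)" and ?z = "smul K (of_real (1 / l)) c"
  note s = free_res_second[OF l V_carr[OF car(1)] car(2)]
  note p = p0_D[OF l V_carr[OF car(1)] car(2)]
  have pH: "?p \<in> carr H" using p B.D_carr by simp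
  have R: "free_res l (a, \<beta>, c) = (iV ?p, ?s, ?z)" by (simp add: free_res_def)
  have "((iV ?p, ?s, ?z), (emb M ?s, Abar M (iV ?p), 0)) \<in> Wtilde M"
    unfolding Wtilde_def using s(1) p pH car by (simp add: iV_carr V_iV hTheta_eq cs del: of_real_divide)
  moreover have "- (emb M ?s, Abar M (iV ?p), 0) + smul (Htot M) (of_real l) (iV ?p, ?s, ?z) = (a, \<beta>, c)"
  proof -
    have "- emb M ?s + smul (H1bar M) (of_real l) (iV ?p) = a"
    proof (rule V_inj)
      show "- emb M ?s + smul (H1bar M) (of_real l) (iV ?p) \<in> carr (H1bar M)"
        using s(1) pH by (simp add: Ycs emb_carr iV_carr del: of_real_divide)
      show "V (- emb M ?s + smul (H1bar M) (of_real l) (iV ?p)) = V a"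
        using s pH by (simp add: V_simps Ycs emb_carr iV_carr V_emb V_iV del: of_real_divide)
    qed (rule car)
    then show ?thesis
      using pH by (simp add: Abar_def V_iV smul_inv_cancel[OF HS l] smul_inv_cancel[OF KS l] del: of_real_divide)
  qed
  ultimately show "w \<in> resolvent (Htot M) (Wtilde M) l"
    unfolding resolvent_def w R by (smt (verit) mem_Collect_eq)
qed

subsection \<open>Boundedness\<close>

lemma BL_ids: "(\<lambda>x. x) \<in> BL K (hTheta M)" "c > 0 \<Longrightarrow> (\<lambda>x. x) \<in> BL (B.gs c) H" "c > 0 \<Longrightarrow> b \<in> BL (B.gs c) H"
  "iV \<in> BL H (Hbar M (Suc 0))" "Th \<in> BL (hTheta M) K"
proof -
  obtain C where C: "C \<ge> 0" "\<And>z. z \<in> carr K \<Longrightarrow> hnorm K (Th z) \<le> C * hnorm K z"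
    using BL_bound[OF positive_saD(1)[OF Theta(1)]] by blast
  have le: "hnorm (hTheta M) z \<le> sqrt C * hnorm K z" if z: "z \<in> carr K" for z
  proof (rule power2_le_imp_le)
    have "(hnorm (hTheta M) z)\<^sup>2 = norm (ip K (Th z) z)" by (simp add: hnorm_def hTheta_eq)
    also have "\<dots> \<le> hnorm K (Th z) * hnorm K z" by (rule cauchy_schwarz[OF KS Th_carr[OF z] z])
    also have "\<dots> \<le> (C * hnorm K z) * hnorm K z" using C z by (intro mult_right_mono) auto
    also have "\<dots> = (sqrt C * hnorm K z)\<^sup>2" using C(1) by (simp add: power_mult_distrib) (simp add: power2_eq_square)
    finally show "(hnorm (hTheta M) z)\<^sup>2 \<le> (sqrt C * hnorm K z)\<^sup>2" .
  qed (use C in simp)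
  show "(\<lambda>x. x) \<in> BL K (hTheta M)"
    by (rule BL_I[where C = "sqrt C"]) (use le in \<open>auto simp: lin_on_def hTheta_eq\<close>)
  show "(\<lambda>x. x) \<in> BL (B.gs c) H" if c: "c > 0"
    by (rule BL_I[where C = "1 / sqrt c"])
      (use B.gs_le(2)[of c] c in \<open>auto simp: lin_on_def B.D_carr field_simps simp del: Domain_iff\<close>)
  show "b \<in> BL (B.gs c) H" if c: "c > 0"
    by (rule BL_I[where C = 1])
      (use B.gs_le(1)[of c] c in \<open>simp_all add: lin_on_def B.t_carr B.t_simps\<close>)
  show "iV \<in> BL H (Hbar M (Suc 0))"
    by (rule BL_I[where C = 1]) (simp_all add: lin_on_def iV_carr iV_add iV_smul hnorm_Hbar V_iV)
  have "hnorm K (Th z) \<le> sqrt C * hnorm (hTheta M) z" if z: "z \<in> carr K" for z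
  proof (cases "hnorm K (Th z) = 0")
    case False
    have "hnorm K (Th z) * hnorm K (Th z) = norm (ip K (Th z) (Th z))"
      by (simp add: hnorm_def)
    also have "\<dots> \<le> hnorm (hTheta M) z * hnorm (hTheta M) (Th z)" by (rule Theta_cs[OF z Th_carr[OF z]])
    also have "\<dots> \<le> hnorm (hTheta M) z * (sqrt C * hnorm K (Th z))"
      using le[OF Th_carr[OF z]] by (intro mult_left_mono) auto
    finally have "hnorm K (Th z) * hnorm K (Th z) \<le> hnorm K (Th z) * (sqrt C * hnorm (hTheta M) z)" by (simp add: mult_ac)
    then show ?thesis using False by (simp add: less_le)
  qed (use C in simp)
  then show "Th \<in> BL (hTheta M) K"
    by (intro BL_I[where C = "sqrt C"]) (simp_all add: lin_on_def hTheta_eq Th_carr Th_simps)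
qed

lemmas S2' = ips_semi[OF dsum_ips[OF HI hTheta_ips]]

lemma BL_proj: "(\<lambda>u. V (fst u)) \<in> BL (Htot M) H" "(\<lambda>u. fst (snd u)) \<in> BL (Htot M) H"
  "(\<lambda>u. snd (snd u)) \<in> BL (Htot M) (hTheta M)" "fst \<in> BL (Htot M) (Hbar M (Suc 0))"
  unfolding Htot_def'
  by (rule BL_comp[OF BL_fst V_BL] BL_comp[OF BL_snd BL_fst] BL_comp[OF BL_snd BL_snd] BL_fst; intro Y1S HS TS S2')+

lemma p0_BL: assumes l: "l \<noteq> 0"
  shows "(\<lambda>u. p0 l (V (fst u)) (fst (snd u))) \<in> BL (Htot M) (B.gs (l\<^sup>2))"
proof -
  have c: "l\<^sup>2 > 0" using l by simp
  note gsS = ips_semi[OF B.gs_ips[OF c]]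
  have "(\<lambda>u. smul (B.gs (l\<^sup>2)) (of_real l) (B.res (l\<^sup>2) (V (fst u))) + b (B.res (l\<^sup>2) (fst (snd u))))
      \<in> BL (Htot M) (B.gs (l\<^sup>2))"
    by (intro BL_add[OF gsS] BL_smul[OF gsS] BL_comp[OF BL_proj(1) res_BL[OF c]] BL_comp[OF BL_proj(2) b_res_BL[OF c]])
  then show ?thesis by (simp add: p0_def)
qed

lemma free_res_BL: assumes l: "l \<noteq> 0" shows "free_res l \<in> BL (Htot M) (Htot M)"
proof -
  have c: "l\<^sup>2 > 0" using l by simp
  have "(\<lambda>u. (iV (p0 l (V (fst u)) (fst (snd u))),
      smul H (of_real (1 / l)) (fst (snd u) - b (p0 l (V (fst u)) (fst (snd u)))),
      smul (hTheta M) (of_real (1 / l)) (snd (snd u)))) \<in> BL (Htot M) (Hbar M (Suc 0) \<oplus>\<^sub>H H \<oplus>\<^sub>H hTheta M)"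
    by (intro BL_Pair Y1S HS TS S2' BL_smul[OF HS] BL_smul[OF TS] BL_diff[OF HS] BL_proj
        BL_comp[OF p0_BL[OF l] BL_ids(3)[OF c]]
        BL_comp[OF BL_comp[OF p0_BL[OF l] BL_ids(2)[OF c]] BL_ids(4)])
  then show ?thesis by (simp add: free_res_def case_prod_beta' Htot_def' hTheta_eq)
qed

lemma GTheta_breve_eq:
  assumes l: "l \<noteq> 0" and car: "a \<in> carr (H1bar M)" "\<beta> \<in> carr H"
  shows "GTheta_breve M l (a, \<beta>, c) = t (p0 l (V a) \<beta>) - smul K (of_real (1 / l)) (Th c)"
proof -
  have c: "l\<^sup>2 > 0" using l by simp
  show ?thesis
    using B.res_props(1,2)[OF c V_carr[OF car(1)]] B.res_props(1,2)[OF c car(2)]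
    by (simp add: GTheta_breve_def Gbarbreve_eq Gbreve_eq l car p0_def t_simps B.D_simps inverse_eq_divide)
qed

lemma GTheta_breve_BL: assumes l: "l \<noteq> 0" shows "GTheta_breve M l \<in> BL (Htot M) K"
proof -
  have c: "l\<^sup>2 > 0" using l by simp
  have "(\<lambda>u. t (p0 l (V (fst u)) (fst (snd u))) - smul K (of_real (1 / l)) (Th (snd (snd u)))) \<in> BL (Htot M) K"
    by (intro BL_diff[OF KS] BL_smul[OF KS] BL_comp[OF p0_BL[OF l] t_BL[OF c]] BL_comp[OF BL_proj(3) BL_ids(5)])
  then show ?thesis by (rule BL_cong[OF _ _ ZS]) (auto simp: GTheta_breve_eq l simp del: of_real_divide)
qed

lemma Gbar_eq: "l \<noteq> 0 \<Longrightarrow> z \<in> carr K \<Longrightarrow> Gbar M l z = iV (g l z)"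
  by (metis iV_V Gbar_carr V_Gbar)

lemma GTheta_eq:
  assumes l: "l \<noteq> 0" and z: "z \<in> carr K"
  shows "GTheta M l z = (smul (H1bar M) (of_real l) (iV (g l z)), - b (g l z), - smul K (of_real (1 / l)) z)"
  using assms by (simp add: GTheta_def Gbar_eq G_eq inverse_eq_divide)

lemma GTheta_BL: assumes l: "l \<noteq> 0" shows "GTheta M l \<in> BL K (Htot M)"
proof -
  have c: "l\<^sup>2 > 0" using l by simp
  have "(\<lambda>z. (smul (Hbar M (Suc 0)) (of_real l) (iV (g l z)), - b (g l z), - smul (hTheta M) (of_real (1 / l)) z))
      \<in> BL K (Hbar M (Suc 0) \<oplus>\<^sub>H H \<oplus>\<^sub>H hTheta M)"
    by (intro BL_Pair Y1S HS TS S2' BL_smul[OF Y1S] BL_minus[OF HS] BL_minus[OF TS] BL_smul[OF TS] BL_ids(1)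
        BL_comp[OF g_BL[OF l] BL_ids(3)[OF c]]
        BL_comp[OF BL_comp[OF g_BL[OF l] BL_ids(2)[OF c]] BL_ids(4)])
  then show ?thesis unfolding Htot_def'
    by (rule BL_cong[OF _ _ KS]) (simp add: GTheta_eq l hTheta_eq del: of_real_divide)
qed

text \<open>
  So the inverse of Gamma_Theta(l) is that of A l up to a scalar.
\<close>

lemma Gamma_eq: "l \<noteq> 0 \<Longrightarrow> z \<in> carr K \<Longrightarrow> GammaTheta M l z = smul K (of_real (- (1 / l))) (A l z)"
  by (simp add: GammaTheta_def A_def trac_Gbar smul_simps[OF KS] inverse_eq_divide power2_eq_square)

lemma A_carr: "l \<noteq> 0 \<Longrightarrow> z \<in> carr K \<Longrightarrow> A l z \<in> carr K"
  using BL_carr[OF positive_saD(1)[OF A_positive]] by blast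

lemma A_inv_props: assumes l: "l \<noteq> 0" and z: "z \<in> carr K"
  shows "inv_into (carr K) (A l) z \<in> carr K" "A l (inv_into (carr K) (A l) z) = z"
  using A_bij[OF l] z by (metis bij_betw_imp_surj_on inv_into_into f_inv_into_f)+

lemma Gamma_bij: assumes l: "l \<noteq> 0" shows "bij_betw (GammaTheta M l) (carr K) (carr K)"
proof (rule bij_betw_byWitness[where f' = "\<lambda>y. inv_into (carr K) (A l) (smul K (of_real (- l)) y)"])
  have c1: "smul K (of_real (- l)) (smul K (of_real (- (1 / l))) z) = z"
    and c2: "smul K (of_real (- (1 / l))) (smul K (of_real (- l)) z) = z" for z
    using smul_inv_cancel[OF KS, of "- l" z] l by simp_all
  show "\<forall>z\<in>carr K. inv_into (carr K) (A l) (smul K (of_real (- l)) (GammaTheta M l z)) = z"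
    using A_bij[OF l] by (simp add: Gamma_eq l c1 bij_betw_imp_inj_on del: of_real_minus of_real_divide)
  show "\<forall>z\<in>carr K. GammaTheta M l (inv_into (carr K) (A l) (smul K (of_real (- l)) z)) = z"
    by (simp add: Gamma_eq l A_inv_props cs c2 del: of_real_minus of_real_divide)
qed (auto simp: Gamma_eq l A_carr cs A_inv_props simp del: of_real_minus of_real_divide)

lemma Gamma_inv: assumes l: "l \<noteq> 0" and z: "z \<in> carr K"
  shows "inv_into (carr K) (GammaTheta M l) z \<in> carr K"
    "GammaTheta M l (inv_into (carr K) (GammaTheta M l) z) = z"
  using Gamma_bij[OF l] z by (metis bij_betw_imp_surj_on inv_into_into f_inv_into_f)+

lemma Gamma_inv_BL: assumes l: "l \<noteq> 0"
  shows "inv_into (carr K) (GammaTheta M l) \<in> BL K K"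
proof -
  have "(\<lambda>y. inv_into (carr K) (A l) (smul K (of_real (- l)) y)) \<in> BL K K"
    by (intro BL_comp[OF BL_smul[OF KS BL_id] A_inv[OF l]])
  then show ?thesis
  proof (rule BL_cong[OF _ _ KS])
    fix y assume y: "y \<in> carr K"
    let ?z = "inv_into (carr K) (A l) (smul K (of_real (- l)) y)"
    have z: "?z \<in> carr K" using y l by (simp add: A_inv_props cs del: of_real_minus)
    have "GammaTheta M l ?z = y"
      using y l z smul_inv_cancel(2)[OF KS, of "- l" y] smul_inv_cancel(1)[OF KS, of "- l" y]
      by (simp add: Gamma_eq A_inv_props cs del: of_real_minus of_real_divide)
    then show "inv_into (carr K) (GammaTheta M l) y = ?z"
      using z Gamma_bij[OF l] by (metis bij_betw_imp_inj_on inv_into_f_f)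
  qed
qed

text \<open>
  The right-hand side of the resolvent formula.
\<close>

definition perturbed_res :: "real \<Rightarrow> 'b \<times> 'a \<times> 'h \<Rightarrow> 'b \<times> 'a \<times> 'h" where
  "perturbed_res l u = free_res l u + GTheta M l (inv_into (carr K) (GammaTheta M l) (GTheta_breve M l u))"

text \<open>
  With xi the value of the inverse of Gamma_Theta(l), the last component of the value of the operator
  is - xi. The equation for xi is the boundary condition Theta zeta = t (Bbar phi).
\<close>

lemma perturbed_res_solves:
  assumes l: "l \<noteq> 0" and f: "f \<in> carr (Htot M)"
  shows "(perturbed_res l f, smul (Htot M) (of_real l) (perturbed_res l f) - f) \<in> Wrel"
proof -
  obtain a \<beta> c where f': "f = (a, \<beta>, c)" and car: "a \<in> carr (H1bar M)" "\<beta> \<in> carr H" "c \<in> carr K"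
    using f by auto
  define \<xi> where "\<xi> = inv_into (carr K) (GammaTheta M l) (GTheta_breve M l f)"
  have yc: "GTheta_breve M l f \<in> carr K" using BL_carr[OF GTheta_breve_BL[OF l] f] .
  have xi: "\<xi> \<in> carr K" and Gx: "GammaTheta M l \<xi> = GTheta_breve M l f"
    using Gamma_inv[OF l yc] by (simp_all add: \<xi>_def)
  let ?p = "p0 l (V a) \<beta>" and ?g = "g l \<xi>"
  let ?s = "smul H (of_real (1 / l)) (\<beta> - b ?p)"
  note s = free_res_second[OF l V_carr[OF car(1)] car(2)]
  have pD: "?p \<in> D" using p0_D[OF l V_carr[OF car(1)] car(2)] .
  have gD: "?g \<in> D" using l xi by (simp add: g_D)
  have pH: "?p \<in> carr H" "b ?p \<in> carr H" "?g \<in> carr H" "b ?g \<in> carr H"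
    using pD gD by (simp_all add: B.D_carr B.t_carr)
  define \<phi> where "\<phi> = iV ?p + smul (H1bar M) (of_real l) (iV ?g)"
  define \<psi> where "\<psi> = ?s - b ?g"
  define \<zeta> where "\<zeta> = smul K (of_real (1 / l)) (c - \<xi>)"
  have perturbed_res: "perturbed_res l f = (\<phi>, \<psi>, \<zeta>)"
    unfolding perturbed_res_def \<xi>_def[symmetric]
    using l xi by (simp add: f' free_res_def GTheta_eq \<phi>_def \<psi>_def \<zeta>_def smul_diff_right[OF KS] del: of_real_divide)
  have \<phi>c: "\<phi> \<in> carr (H1bar M)" using pH by (simp add: \<phi>_def Ycs iV_carr)
  have V\<phi>: "V \<phi> = ?p + smul H (of_real l) ?g" using pH by (simp add: \<phi>_def Ycs iV_carr V_simps V_iV)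
  have V\<phi>D: "V \<phi> \<in> D" unfolding V\<phi> using pD gD by (simp add: B.D_simps)
  have \<zeta>c: "\<zeta> \<in> carr K" using car xi by (simp add: \<zeta>_def cs)
  have lz: "smul K (of_real l) \<zeta> - c = - \<xi>" by (simp add: \<zeta>_def smul_inv_cancel[OF KS l] del: of_real_divide)
  have "Th \<zeta> = t (V \<phi>)"
  proof -
    have "smul K (of_real (- l)) (t ?g) - smul K (of_real (1 / l)) (Th \<xi>) = t ?p - smul K (of_real (1 / l)) (Th c)"
      using Gx GTheta_breve_eq[OF l car(1,2), of c] l xi
      by (simp add: f' GammaTheta_def trac_Gbar smul_simps[OF KS] inverse_eq_divide)
    then have "smul K (of_real (1 / l)) (Th c - Th \<xi>) = t ?p + smul K (of_real l) (t ?g)"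
      by (simp add: smul_simps[OF KS] algebra_simps)
    then show ?thesis
      using pD gD car xi by (simp add: \<zeta>_def V\<phi> Th_simps cs t_simps B.D_simps del: of_real_divide)
  qed
  moreover have "smul H (of_real l) \<psi> - \<beta> = - b (V \<phi>)"
    unfolding \<psi>_def V\<phi> using pD gD
    by (simp add: smul_diff_right[OF HS, of _ _ "b ?g"] smul_inv_cancel[OF HS l] B.t_simps B.D_simps
      del: of_real_divide)
  moreover have "smul (H1bar M) (of_real l) \<phi> - a \<in> carr (H1bar M)" using \<phi>c car by (simp add: Ycs)
  moreover have "weak \<psi> (V (smul (H1bar M) (of_real l) \<phi> - a)) (smul K (of_real l) \<zeta> - c)"
  proof -
    have r: "weak (?s + G M l (- \<xi>)) (b ?s - smul H (of_real (l\<^sup>2)) (g l (- \<xi>))) (- \<xi>)"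
      using xi by (intro weak_of_decomposition[OF l s(1)]) (simp add: cs)
    have 1: "?s + G M l (- \<xi>) = \<psi>"
      using l xi gD by (simp add: \<psi>_def G_eq cs g_simps B.t_simps)
    have 2: "b ?s - smul H (of_real (l\<^sup>2)) (g l (- \<xi>)) = V (smul (H1bar M) (of_real l) \<phi> - a)"
      unfolding s(2) using l xi \<phi>c car
      by (simp add: V_simps Ycs V\<phi> g_simps smul_simps[OF HS] power2_eq_square algebra_simps)
    show ?thesis using r unfolding 1 2 lz .
  qed
  ultimately show ?thesis
    using \<phi>c V\<phi>D \<zeta>c unfolding perturbed_res by (simp add: f' Wrel_iff)
qed

text \<open>
  The difference d of two solutions is an eigenvector for the eigenvalue l, which is real and
  nonzero; skew-symmetry gives l <d, d> = - l <d, d>.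
\<close>

lemma Wrel_resolvent_unique:
  assumes l: "l \<noteq> 0" and "(x, y) \<in> Wrel" "(x', y') \<in> Wrel"
    and eq: "- y + smul (Htot M) (of_real l) x = - y' + smul (Htot M) (of_real l) x'"
  shows "x = x'"
proof -
  note c = Wrel_carr[OF assms(2)] Wrel_carr[OF assms(3)]
  let ?d = "x - x'"
  have dc: "?d \<in> carr (Htot M)" using c carr_diff[OF ZS] by blast
  have "y - y' = smul (Htot M) (of_real l) ?d"
    unfolding smul_diff_right[OF ZS] using eq by (simp add: algebra_simps)
  then have "(?d, smul (Htot M) (of_real l) ?d) \<in> Wrel" using Wrel_diff[OF assms(2,3)] by simp
  from Wrel_skew[OF this this]
  have "of_real l * ip (Htot M) ?d ?d = - (of_real l * ip (Htot M) ?d ?d)"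
    using dc by (simp only: ip_smul_left[OF ZS] ip_smul_right[OF ZS] kconj_of_real)
  then have "ip (Htot M) ?d ?d = 0" using l by (simp add: eq_neg_iff_add_eq_0 del: Htot_simps)
  then have "?d = 0" using ip_self_eq_0[OF Htot_ips dc] by blast
  then show ?thesis by simp
qed

lemma resolvent_Wrel: assumes l: "l \<noteq> 0"
  shows "resolvent (Htot M) Wrel l = graph_on (Htot M) (perturbed_res l)"
proof (intro equalityI subsetI)
  fix w assume "w \<in> resolvent (Htot M) Wrel l"
  then obtain x y where w: "w = (- y + smul (Htot M) (of_real l) x, x)" and xy: "(x, y) \<in> Wrel"
    unfolding resolvent_def by blast
  let ?f = "- y + smul (Htot M) (of_real l) x"
  have fc: "?f \<in> carr (Htot M)"
    using Wrel_carr[OF xy] carr_add[OF ZS] carr_neg[OF ZS] carr_smul[OF ZS] by blast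
  have "x = perturbed_res l ?f"
    by (rule Wrel_resolvent_unique[OF l xy perturbed_res_solves[OF l fc]]) simp
  then show "w \<in> graph_on (Htot M) (perturbed_res l)" unfolding w graph_on_def using fc by blast
next
  fix w assume "w \<in> graph_on (Htot M) (perturbed_res l)"
  then obtain f where w: "w = (f, perturbed_res l f)" and f: "f \<in> carr (Htot M)" unfolding graph_on_def by blast
  have "f = - (smul (Htot M) (of_real l) (perturbed_res l f) - f) + smul (Htot M) (of_real l) (perturbed_res l f)" by simp
  then show "w \<in> resolvent (Htot M) Wrel l"
    unfolding resolvent_def w using perturbed_res_solves[OF l f] by blast
qed

section \<open>Density and skew-adjointness\<close>

lemma NTheta_eq: "NTheta M = {(\<phi>, \<psi>, \<zeta>). \<phi> \<in> carr (H1bar M) \<and> V \<phi> \<in> D \<and> \<psi> \<in> D \<and> \<zeta> \<in> carr K \<and> t (V \<phi>) = Th \<zeta>}"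
  by (auto simp: NTheta_def hTheta_eq trac_eq)

text \<open>
  For arbitrary p and zeta, subtracting (g 1 kappa, - kappa) with A 1 kappa = t p - Theta zeta from
  (p, zeta) restores the boundary condition. So the functional (alpha, gamma), being zero on the set
  of pairs that satisfy it, factors through t p - Theta zeta, and symmetry of A 1 exhibits it as
  <xi, t p - Theta zeta>. With zeta = 0 this bounds <t p, xi> in the norm of H0.
\<close>

lemma NTheta_annihilator:
  assumes a: "\<alpha> \<in> carr H" and ga: "\<gamma> \<in> carr K"
    and o: "\<And>p \<zeta>. p \<in> D \<Longrightarrow> \<zeta> \<in> carr K \<Longrightarrow> t p = Th \<zeta> \<Longrightarrow> ip H \<alpha> p + ip K \<gamma> \<zeta> = 0"
  shows "\<alpha> = 0" "\<gamma> = 0"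
proof -
  have l: "(1::real) \<noteq> 0" and c: "(1::real)\<^sup>2 > 0" by simp_all
  note r = B.res_props[OF c a]
  define \<xi> where "\<xi> = inv_into (carr K) (A 1) (t (B.res (1\<^sup>2) \<alpha>) - \<gamma>)"
  have xi: "\<xi> \<in> carr K" "A 1 \<xi> = t (B.res (1\<^sup>2) \<alpha>) - \<gamma>"
    using A_inv_props[OF l, of "t (B.res (1\<^sup>2) \<alpha>) - \<gamma>"] r ga by (simp_all add: \<xi>_def cs t_carr)
  have key: "ip H \<alpha> p + ip K \<gamma> \<zeta> = ip K \<xi> (t p - Th \<zeta>)" if p: "p \<in> D" and z: "\<zeta> \<in> carr K" for p \<zeta>
  proof -
    define \<kappa> where "\<kappa> = inv_into (carr K) (A 1) (t p - Th \<zeta>)"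
    have k: "\<kappa> \<in> carr K" "A 1 \<kappa> = t p - Th \<zeta>"
      using A_inv_props[OF l, of "t p - Th \<zeta>"] p z by (simp_all add: \<kappa>_def cs t_carr Th_carr)
    have gk: "g 1 \<kappa> \<in> D" using k by (simp add: g_D)
    have "t (p - g 1 \<kappa>) = Th (\<zeta> + \<kappa>)"
      using k(2) p z k(1) gk by (simp add: A_def t_simps Th_simps smul_one[OF KS] algebra_simps)
    then have "ip H \<alpha> (p - g 1 \<kappa>) + ip K \<gamma> (\<zeta> + \<kappa>) = 0"
      using p gk z k(1) by (intro o) (simp_all add: B.D_diff cs)
    then have "ip H \<alpha> p + ip K \<gamma> \<zeta> = ip H \<alpha> (g 1 \<kappa>) - ip K \<gamma> \<kappa>"
      using p gk z k(1) a ga by (simp add: ip_simps[OF HS] ip_simps[OF KS] B.D_carr algebra_simps eq_diff_eq)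
    also have "ip H \<alpha> (g 1 \<kappa>) = ip K (t (B.res (1\<^sup>2) \<alpha>)) \<kappa>"
      unfolding g_adj[OF l r(1) k(1)] B.res_weak(2)[OF c a gk] ..
    also have "\<dots> - ip K \<gamma> \<kappa> = ip K (A 1 \<xi>) \<kappa>"
      unfolding xi(2) using r ga k by (simp add: ip_simps[OF KS] t_carr)
    also have "\<dots> = ip K \<xi> (t p - Th \<zeta>)"
      unfolding positive_saD(2)[OF A_positive[OF l] xi(1) k(1)] k(2) ..
    finally show ?thesis .
  qed
  have "ip K (t u) \<xi> = ip H u \<alpha>" if u: "u \<in> D" for u
  proof -
    have "ip H \<alpha> u = ip K \<xi> (t u)"
      using key[OF u carr_0[OF KS]] u a ga xi by (simp add: Th_simps ip_simps[OF KS])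
    from arg_cong[OF this, of kconj] show ?thesis
      using u a xi by (simp add: ip_conj[OF HS] ip_conj[OF KS] B.D_carr t_carr)
  qed
  then have x0: "\<xi> = 0" by (rule trace_unbounded[OF a xi(1)])
  have k0: "ip H \<alpha> p + ip K \<gamma> \<zeta> = 0" if "p \<in> D" "\<zeta> \<in> carr K" for p \<zeta>
    using key[OF that] that x0 by (simp add: ip_simps[OF KS] cs t_carr Th_carr)
  show "\<gamma> = 0"
    using k0[OF B.D_0 ga] a ga by (intro ip_self_eq_0[OF KI ga]) (simp add: ip_simps[OF HS])
  show "\<alpha> = 0"
  proof (rule dense_orthogonal[OF HI B.D_dense a])
    fix u assume u: "u \<in> D"
    have "ip H \<alpha> u = 0" using k0[OF u carr_0[OF KS]] ga by (simp add: ip_simps[OF KS])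
    then show "ip H u \<alpha> = 0" using ip_conj[OF HS a B.D_carr[OF u]] by simp
  qed
qed

text \<open>
  Density is proved in the Hilbert space Z with h in place of h_Theta and then transferred to the
  weaker norm.
\<close>

lemma NTheta_dense: "dense_in (Htot M) (NTheta M)"
proof -
  let ?Z = "Hbar M (Suc 0) \<oplus>\<^sub>H H \<oplus>\<^sub>H K"
  have HZ: "hilbert ?Z" by (intro dsum_hilbert Hbar1 H0 h)
  have d: "dense_in ?Z (NTheta M)"
  proof (rule dense_in_if_orthogonal[OF HZ])
    show "NTheta M \<subseteq> carr ?Z" by (auto simp: NTheta_eq intro: B.D_carr)
    show "0 \<in> NTheta M" unfolding zero_prod_def by (simp add: NTheta_eq Ycs V_simps B.D_0 cs t_0 Th_simps)
    show "x + y \<in> NTheta M" if "x \<in> NTheta M" "y \<in> NTheta M" for x y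
      using that by (auto simp: NTheta_eq Ycs V_simps B.D_simps cs t_simps Th_simps)
    show "smul ?Z c x \<in> NTheta M" if "x \<in> NTheta M" for c x
      using that by (auto simp: NTheta_eq Ycs V_simps B.D_simps cs t_simps Th_simps)
    fix x assume x: "x \<in> carr ?Z" and o: "\<And>d. d \<in> NTheta M \<Longrightarrow> ip ?Z x d = 0"
    then obtain a \<beta> \<gamma> where x': "x = (a, \<beta>, \<gamma>)" and car: "a \<in> carr (H1bar M)" "\<beta> \<in> carr H" "\<gamma> \<in> carr K" by auto
    have o': "ip H (V a) (V \<phi>) + (ip H \<beta> \<psi> + ip K \<gamma> \<zeta>) = 0" if "(\<phi>, \<psi>, \<zeta>) \<in> NTheta M" for \<phi> \<psi> \<zeta>
      using o[OF that] by (simp add: x')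
    have "ip H \<beta> u = 0" if u: "u \<in> D" for u
    proof -
      have "(0, u, 0) \<in> NTheta M" using u by (simp add: NTheta_eq Ycs V_simps B.D_0 cs t_0 Th_simps)
      from o'[OF this] show ?thesis using car by (simp add: V_simps ip_simps[OF HS] ip_simps[OF KS] V_carr)
    qed
    then have "ip H u \<beta> = 0" if "u \<in> D" for u
      using that ip_conj[OF HS car(2) B.D_carr[OF that]] by simp
    then have b0: "\<beta> = 0" by (rule dense_orthogonal[OF HI B.D_dense car(2)])
    have ann: "ip H (V a) p + ip K \<gamma> \<zeta> = 0" if p: "p \<in> D" and z: "\<zeta> \<in> carr K" and e: "t p = Th \<zeta>" for p \<zeta>
    proof -
      have "(iV p, 0, \<zeta>) \<in> NTheta M" using p z e by (simp add: NTheta_eq iV_carr V_iV B.D_carr B.D_0)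
      from o'[OF this] show ?thesis using car p by (simp add: V_iV B.D_carr ip_simps[OF HS])
    qed
    have "V a = 0" by (rule NTheta_annihilator(1)[OF V_carr[OF car(1)] car(3)]) (rule ann)
    then have "a = 0" by (intro V_inj[OF car(1) carr_0[OF YS]]) (simp add: V_simps)
    moreover have "\<gamma> = 0" by (rule NTheta_annihilator(2)[OF V_carr[OF car(1)] car(3)]) (rule ann)
    ultimately show "x = 0" using b0 by (simp add: x' zero_prod_def)
  qed
  have B: "(\<lambda>u. (fst u, fst (snd u), snd (snd u))) \<in> BL ?Z (Hbar M (Suc 0) \<oplus>\<^sub>H H \<oplus>\<^sub>H hTheta M)"
    using hilbert_semi[OF dsum_hilbert[OF H0 h]]
    by (intro BL_Pair Y1S HS TS S2' BL_fst BL_comp[OF BL_snd BL_fst]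
        BL_comp[OF BL_comp[OF BL_snd BL_snd] BL_ids(1)] KS)
  obtain C where C: "\<And>x. x \<in> carr ?Z \<Longrightarrow>
      hnorm (Hbar M (Suc 0) \<oplus>\<^sub>H H \<oplus>\<^sub>H hTheta M) (fst x, fst (snd x), snd (snd x)) \<le> C * hnorm ?Z x"
    using BL_bound[OF B] by blast
  show ?thesis
  proof (rule dense_in_weaker[OF hilbert_ips[OF HZ] Htot_ips _ _ d])
    show "hnorm (Htot M) x \<le> C * hnorm ?Z x" if "x \<in> carr ?Z" for x
      using C[OF that] by (simp add: Htot_def')
  qed simp
qed

lemma restriction_subset: "{u \<in> Wtilde M. fst u \<in> NTheta M} \<subseteq> Wrel"
proof
  fix w assume "w \<in> {u \<in> Wtilde M. fst u \<in> NTheta M}"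
  then obtain \<phi> \<psi> \<zeta> where w: "w = ((\<phi>, \<psi>, \<zeta>), (emb M \<psi>, Abar M \<phi>, 0))"
    and f: "\<phi> \<in> carr (H1bar M)" "V \<phi> \<in> D" "\<psi> \<in> D" "\<zeta> \<in> carr K" "t (V \<phi>) = Th \<zeta>"
    unfolding Wtilde_def NTheta_eq by auto
  have "weak \<psi> (b \<psi>) 0"
    using f(3) by (simp add: weak_def B.D_carr B.t_carr cs B.sym ip_simps[OF KS] t_carr)
  then show "w \<in> Wrel" using f by (simp add: w Wrel_iff Abar_def emb_carr V_emb)
qed

text \<open>
  Let (y, z) belong to the adjoint and let (v, r) be in W with - r + v = z + y. Then d = y - v is
  orthogonal to the range of W + 1, which is the whole space, so that d = 0 and z = - r.
\<close>

theorem Wrel_skewadjoint: "skewadjoint (Htot M) Wrel"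
  unfolding skewadjoint_def
proof (intro conjI Wrel_lin_op)
  have dom: "NTheta M \<subseteq> Domain Wrel"
  proof
    fix x assume x: "x \<in> NTheta M"
    then obtain \<phi> \<psi> \<zeta> where x': "x = (\<phi>, \<psi>, \<zeta>)" by (cases x)
    have "((\<phi>, \<psi>, \<zeta>), (emb M \<psi>, Abar M \<phi>, 0)) \<in> Wtilde M"
      using x unfolding x' Wtilde_def NTheta_eq by (auto simp: hTheta_eq)
    then have "((\<phi>, \<psi>, \<zeta>), (emb M \<psi>, Abar M \<phi>, 0)) \<in> Wrel" using restriction_subset x x' by auto
    then show "x \<in> Domain Wrel" unfolding x' by blast
  qed
  show "dense_in (Htot M) (Domain Wrel)"
    using NTheta_dense dom Wrel_carr unfolding dense_in_iff[OF Htot_ips] by (blast elim: DomainE)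
  show "graph_adj (Htot M) Wrel = (\<lambda>(x, y). (x, - y)) ` Wrel"
  proof (intro equalityI subsetI)
    fix w assume "w \<in> (\<lambda>(x, y). (x, - y)) ` Wrel"
    then obtain x y where w: "w = (x, - y)" and xy: "(x, y) \<in> Wrel" by auto
    have "ip (Htot M) v x = ip (Htot M) u (- y)" if uv: "(u, v) \<in> Wrel" for u v
      using Wrel_skew[OF uv xy] Wrel_carr[OF uv] Wrel_carr[OF xy] ip_minus_right[OF ZS, of u y] by metis
    then show "w \<in> graph_adj (Htot M) Wrel"
      unfolding graph_adj_def w using Wrel_carr[OF xy] carr_neg[OF ZS] by blast
  next
    fix w assume "w \<in> graph_adj (Htot M) Wrel"
    then obtain y z where w: "w = (y, z)" and y: "y \<in> carr (Htot M)" and z: "z \<in> carr (Htot M)"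
      and ad: "\<And>x v. (x, v) \<in> Wrel \<Longrightarrow> ip (Htot M) v y = ip (Htot M) x z"
      unfolding graph_adj_def by blast
    let ?f = "z + y"
    have fc: "?f \<in> carr (Htot M)" using y z carr_add[OF ZS] by blast
    have one: "smul (Htot M) (of_real 1) x = x" for x using smul_one[OF ZS] by simp
    define v where "v = perturbed_res 1 ?f"
    define r where "r = v - ?f"
    have vr: "(v, r) \<in> Wrel" using perturbed_res_solves[OF _ fc, of 1] unfolding one v_def r_def by simp
    note vc = Wrel_carr[OF vr]
    let ?d = "y - v"
    have dc: "?d \<in> carr (Htot M)" using y vc carr_diff[OF ZS] by blast
    have o: "ip (Htot M) (s + x) ?d = 0" if xs: "(x, s) \<in> Wrel" for x s
    proof -
      note xc = Wrel_carr[OF xs]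
      have "ip (Htot M) s ?d = ip (Htot M) x z + ip (Htot M) x r"
        using ad[OF xs] Wrel_skew[OF xs vr] xc y vc by (simp add: ip_simps[OF ZS] del: Htot_simps)
      also have "\<dots> = ip (Htot M) x (z + r)" using xc z vc by (simp add: ip_simps[OF ZS] del: Htot_simps)
      also have "z + r = - ?d" by (simp add: r_def)
      also have "ip (Htot M) x (- ?d) = - ip (Htot M) x ?d" using xc dc by (intro ip_minus_right[OF ZS]) blast+
      finally show ?thesis using xc dc by (simp add: ip_add_left[OF ZS] del: Htot_simps)
    qed
    have md: "- ?d \<in> carr (Htot M)" using dc carr_neg[OF ZS] by blast
    have m1: "smul (Htot M) (of_real (- 1)) x = - x" for x
      using smul_minus_left[OF ZS, of 1 x] smul_one[OF ZS, of x] by simp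
    have "(perturbed_res (- 1) (- ?d), - perturbed_res (- 1) (- ?d) + ?d) \<in> Wrel"
      using perturbed_res_solves[OF _ md, of "- 1"] unfolding m1 by (simp add: algebra_simps)
    from o[OF this] have "ip (Htot M) ?d ?d = 0" by (simp del: Htot_simps)
    then have "?d = 0" using ip_self_eq_0[OF Htot_ips dc] by blast
    then have "y = v" "z = - r" by (simp_all add: r_def)
    then show "w \<in> (\<lambda>(x, y). (x, - y)) ` Wrel" using vr w by force
  qed
qed

end

theorem theorem3p4:
  fixes M :: "('k::rc_scalar, 'a::ab_group_add, 'b::ab_group_add, 'h::ab_group_add) wave_data"
    and S1 S2 :: "'a \<Rightarrow> 'a"
    and Hm1 :: "('k, 'm1::ab_group_add) ip_space" and j1 :: "'a \<Rightarrow> 'm1"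
    and Hm2 :: "('k, 'm2::ab_group_add) ip_space" and j2 :: "'a \<Rightarrow> 'm2"
    and l :: real
  assumes H0: "hilbert (H0 M)"
    and B_sa: "selfadjoint (H0 M) (opB M)"
    and B_ker: "\<And>x. (x, 0) \<in> opB M \<Longrightarrow> x = 0"
    and H1bar: "is_completion (H1dot M) (H1bar M) (emb M)"
    and Hm1: "is_Hneg M 1 S1 Hm1 j1"
    and Hm2: "is_Hneg M 2 S2 Hm2 j2"
    and h: "hilbert (auxsp M)"
    and Theta: "positive_sa (auxsp M) (Theta M)" "inj_on (Theta M) (carr (auxsp M))"
    and tau: "trac M \<in> BL (Hbar M 2) (auxsp M)"
    and H30: "{trac M \<phi> - Theta M \<zeta> | \<phi> \<zeta>. \<phi> \<in> carr (Hbar M 2) \<and> \<zeta> \<in> carr (auxsp M)}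
              = carr (auxsp M)"
    and H31: "tau_star M S2 Hm2 j2 ` carr (auxsp M) \<inter> Hneg1_in_Hneg2 M Hm1 j1 Hm2 j2 = {0}"
    and tau_star_inj: "inj_on (tau_star M S2 Hm2 j2) (carr (auxsp M))"
    and lam: "l \<noteq> 0"
  shows
    "dense_in (Htot M) (NTheta M) \<and>
     Domain (WTheta M l) = DWTheta M l \<and>
     skewadjoint (Htot M) (WTheta M l) \<and>
     {u \<in> Wtilde M. fst u \<in> NTheta M} \<subseteq> WTheta M l \<and>
     (\<forall>\<psi>l\<in>carr (Hk M 1). \<forall>\<zeta>\<in>carr (auxsp M). psi0 M l \<psi>l \<zeta> \<in> carr (H1bar M)) \<and>
     (\<forall>m. m \<noteq> 0 \<longrightarrow>
        (\<forall>\<psi>l\<in>carr (Hk M 1). \<forall>\<psi>m\<in>carr (Hk M 1).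
         \<forall>\<zeta>l\<in>carr (auxsp M). \<forall>\<zeta>m\<in>carr (auxsp M).
           \<psi>l + G M l \<zeta>l = \<psi>m + G M m \<zeta>m \<longrightarrow> psi0 M l \<psi>l \<zeta>l = psi0 M m \<psi>m \<zeta>m) \<and>
        WTheta M m = WTheta M l) \<and>
     ap (resolvent (Htot M) (Wtilde M) l) \<in> BL (Htot M) (Htot M) \<and>
     resolvent (Htot M) (Wtilde M) l =
       graph_on (Htot M) (ap (resolvent (Htot M) (Wtilde M) l)) \<and>
     GTheta_breve M l \<in> BL (Htot M) (auxsp M) \<and>
     GTheta M l \<in> BL (auxsp M) (Htot M) \<and>
     bij_betw (GammaTheta M l) (carr (auxsp M)) (carr (auxsp M)) \<and>
     inv_into (carr (auxsp M)) (GammaTheta M l) \<in> BL (auxsp M) (auxsp M) \<and>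
     resolvent (Htot M) (WTheta M l) l =
       graph_on (Htot M) (\<lambda>u. ap (resolvent (Htot M) (Wtilde M) l) u
         + GTheta M l (inv_into (carr (auxsp M)) (GammaTheta M l) (GTheta_breve M l u)))"
proof -
  interpret wave M by unfold_locales (fact H0 B_sa B_ker H1bar h Theta tau H30)+
  have regular: "\<xi> = 0" if "\<xi> \<in> carr (auxsp M)" "G M 1 \<xi> \<in> Domain (opB M)" for \<xi>
    using G_range_trivial[OF Hm1 Hm2 H31 tau_star_inj that] .
  interpret regular_wave M by unfold_locales (rule regular)
  have W: "WTheta M m = Wrel" if "m \<noteq> 0" for m by (rule WTheta_eq[OF that])
  have Rap: "ap (resolvent (Htot M) (Wtilde M) l) u = free_res l u" if "u \<in> carr (Htot M)" for u
    unfolding resolvent_Wtilde[OF lam] by (rule ap_graph_on[OF that])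
  have dom: "Domain (WTheta M l) = DWTheta M l"
  proof (intro equalityI subsetI)
    fix x assume "x \<in> Domain (WTheta M l)"
    then show "x \<in> DWTheta M l" by (auto simp: WTheta_def elim!: DomainE)
  next
    fix x assume x: "x \<in> DWTheta M l"
    obtain \<phi> \<psi> \<zeta> where x': "x = (\<phi>, \<psi>, \<zeta>)" by (cases x)
    obtain \<psi>l \<eta> where "\<psi>l \<in> carr (Hk M 1)" "\<eta> \<in> carr (auxsp M)" "\<psi> = \<psi>l + G M l \<eta>"
      using x unfolding x' DWTheta_def by blast
    then have "(x, (psi0 M l \<psi>l \<eta>, Abar M \<phi>, \<eta>)) \<in> WTheta M l"
      using x unfolding x' WTheta_def by blast
    then show "x \<in> Domain (WTheta M l)" by blast
  qed
  have indep: "psi0 M l \<psi>l \<zeta>l = psi0 M m \<psi>m \<zeta>m"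
    if m: "m \<noteq> 0" and p: "\<psi>l \<in> Domain (opB M)" "\<psi>m \<in> Domain (opB M)"
      and z: "\<zeta>l \<in> carr (auxsp M)" "\<zeta>m \<in> carr (auxsp M)" and eq: "\<psi>l + G M l \<zeta>l = \<psi>m + G M m \<zeta>m"
    for m \<psi>l \<psi>m \<zeta>l \<zeta>m
  proof (rule V_inj[OF psi0_carr[OF lam p(1) z(1)] psi0_carr[OF m p(2) z(2)]])
    show "Bbar M (psi0 M l \<psi>l \<zeta>l) = Bbar M (psi0 M m \<psi>m \<zeta>m)"
      unfolding V_psi0[OF lam p(1) z(1)] V_psi0[OF m p(2) z(2)]
      using weak_unique[OF weak_of_decomposition[OF lam p(1) z(1), unfolded eq] weak_of_decomposition[OF m p(2) z(2)]] by blast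
  qed
  show ?thesis
  proof (intro conjI)
    show "dense_in (Htot M) (NTheta M)" by (rule NTheta_dense)
    show "Domain (WTheta M l) = DWTheta M l" by (rule dom)
    show "skewadjoint (Htot M) (WTheta M l)" unfolding W[OF lam] by (rule Wrel_skewadjoint)
    show "{u \<in> Wtilde M. fst u \<in> NTheta M} \<subseteq> WTheta M l" unfolding W[OF lam] by (rule restriction_subset)
    show "\<forall>\<psi>l\<in>carr (Hk M 1). \<forall>\<zeta>\<in>carr (auxsp M). psi0 M l \<psi>l \<zeta> \<in> carr (H1bar M)"
      using psi0_carr[OF lam] by simp
    show "\<forall>m. m \<noteq> 0 \<longrightarrow>
        (\<forall>\<psi>l\<in>carr (Hk M 1). \<forall>\<psi>m\<in>carr (Hk M 1).
         \<forall>\<zeta>l\<in>carr (auxsp M). \<forall>\<zeta>m\<in>carr (auxsp M).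
           \<psi>l + G M l \<zeta>l = \<psi>m + G M m \<zeta>m \<longrightarrow> psi0 M l \<psi>l \<zeta>l = psi0 M m \<psi>m \<zeta>m) \<and>
        WTheta M m = WTheta M l"
      using indep W lam by simp
    show "ap (resolvent (Htot M) (Wtilde M) l) \<in> BL (Htot M) (Htot M)"
      by (rule BL_cong[OF free_res_BL[OF lam] Rap ZS])
    show "resolvent (Htot M) (Wtilde M) l = graph_on (Htot M) (ap (resolvent (Htot M) (Wtilde M) l))"
      using graph_on_cong[of "Htot M" "ap (resolvent (Htot M) (Wtilde M) l)" "free_res l"] Rap
      by (simp add: resolvent_Wtilde[OF lam])
    show "GTheta_breve M l \<in> BL (Htot M) (auxsp M)" by (rule GTheta_breve_BL[OF lam])
    show "GTheta M l \<in> BL (auxsp M) (Htot M)" by (rule GTheta_BL[OF lam])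
    show "bij_betw (GammaTheta M l) (carr (auxsp M)) (carr (auxsp M))" by (rule Gamma_bij[OF lam])
    show "inv_into (carr (auxsp M)) (GammaTheta M l) \<in> BL (auxsp M) (auxsp M)" by (rule Gamma_inv_BL[OF lam])
    show "resolvent (Htot M) (WTheta M l) l =
       graph_on (Htot M) (\<lambda>u. ap (resolvent (Htot M) (Wtilde M) l) u
         + GTheta M l (inv_into (carr (auxsp M)) (GammaTheta M l) (GTheta_breve M l u)))"
      unfolding W[OF lam] resolvent_Wrel[OF lam]
      by (rule graph_on_cong) (simp only: perturbed_res_def Rap)
  qed
qed

end
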